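(* The assignments $G\mapsto\Pi(G)$ and $\phi\mapsto\phi_*$ extend to a 2-functor from the 2-category $\mathsf{Gph}$ of graphs with no isolated vertices (with 2-cells given by $\times$-homotopies) to the 2-category of groupoids, functors and natural transformations. Thus $\Pi$ passes to a functor from the homotopy category $\mathsf{hFGph}$ of finite graphs with no isolated vertices to the category whose objects are groupoids and whose morphisms are functors up to natural isomorphism.
   Context: A graph $G$ is undirected without multiple edges, loops allowed: a vertex set $V(G)$ with a symmetric adjacency relation $\sim$ (edges). A vertex is isolated if it is adjacent to no vertex (a looped vertex is adjacent to itself, hence not isolated). A graph morphism $f: G\to H$ is a map $V(G)\to V(H)$ with $v_1\sim v_2 \Rightarrow f(v_1)\sim f(v_2)$. The product $G\times H$ has vertices $V(G)\times V(H)$, with $(v_1,w_1)\sim(v_2,w_2)$ iff $v_1\sim v_2$ and $w_1\sim w_2$. $P_n$ is the graph on $\{0,\dots,n\}$ whose edges are $i\sim i+1$; $I_n^\ell$ is the graph on $\{0,\dots,n\}$ whose edges are $i\sim i$ and $i\sim i+1$. A $\times$-homotopy of length $n$ from $f$ to $g$ (morphisms $G\to H$) is a morphism $\Lambda:G\times I_n^\ell\to H$ with $\Lambda(\cdot,0)=f$ and $\Lambda(\cdot,n)=g$; $f,g$ are $\times$-homotopic if one exists for some $n \geq 0$. 2-category of graphs: objects are graphs, 1-cells are graph morphisms, and 2-cells from $f$ to $g$ are $\times$-homotopies from $f$ to $g$, where two homotopies $\Lambda,\Lambda'$ of the same length $n$ are identified if they are homotopic rel endpoints, i.e. there is a morphism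 $\Theta:G\times I_n^\ell\times I_m^\ell\to H$ for some $m$ with $\Theta(\cdot,\cdot,0)=\Lambda$, $\Theta(\cdot,\cdot,m)=\Lambda'$, $\Theta(\cdot,0,j)=f$, $\Theta(\cdot,n,j)=g$ for all $j$. Vertical composition is concatenation of homotopies (identities have length $0$); the horizontal composite of $\Lambda:f\Rightarrow f'$ (with $f,f':G\to H$) and $\Lambda':g\Rightarrow g'$ (with $g,g':H\to K$) is the concatenation of $g\circ\Lambda$ with $\Lambda'\circ(f'\times \mathrm{id})$. The homotopy category $\mathsf{hFGph}$ has finite graphs as objects and $\times$-homotopy classes of graph morphisms as arrows. A walk of length $n\ge0$ in $G$ from $v_0$ to $v_n$ is a morphism $P_n\to G$, written $(v_0v_1\dots v_n)$. Concatenation of $(x v_1\dots v_{n-1}y)$ with $(y w_1\dots w_{m-1}z)$ is $(x v_1\dots v_{n-1}y w_1\dots w_{m-1}z)$. If $v_i=v_{i+2}$ in a walk, the prune at $i$ is the walk obtained by deleting the entries $v_i,v_{i+1}$. Two walks $\alpha,\beta$ of length $n$ from $x$ to $y$ are homotopic rel endpoints if there are $m\ge 0$ and a morphism $\Lambda:P_n\times I_m^\ell\to G$ with $\Lambda(\cdot,0)=\alpha$, $\Lambda(\cdot,m)=\beta$, and $\Lambda(0,j)=x$, $\Lambda(n,j)=y$ for all $j$. The fundamental groupoid $\Pi(G)$ has as objects the vertices of $G$; arrows from $v$ to $w$ are equivalence classes of walks from $v$ to $w$ under the equivalence relation generated by prunes and homotopy rel endpoints; composition is induced by concatenation. A morphism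 $\phi:G\to H$ induces the functor $\phi_*:\Pi(G)\to\Pi(H)$, $\phi_*(v)=\phi(v)$, $\phi_*[(v_0\dots v_n)]=[(\phi(v_0)\dots\phi(v_n))]$. *)

theory Defs
  imports Main "HOL-Library.FuncSet"
begin

section \<open>Categories and strict 2-categories\<close>

record ('o, 'm) cat =
  Ob :: "'o set"
  Arr :: "'m set"
  Dom :: "'m \<Rightarrow> 'o"
  Cod :: "'m \<Rightarrow> 'o"
  Ide :: "'o \<Rightarrow> 'm"
  Comp :: "'m \<Rightarrow> 'm \<Rightarrow> 'm"  \<comment> \<open>\<open>Comp C b a\<close> is \<open>b\<close> after \<open>a\<close>\<close>

locale category =
  fixes C :: "('o, 'm) cat"
  assumes Dom_in: "a \<in> Arr C \<Longrightarrow> Dom C a \<in> Ob C"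
    and Cod_in: "a \<in> Arr C \<Longrightarrow> Cod C a \<in> Ob C"
    and Ide_in: "x \<in> Ob C \<Longrightarrow> Ide C x \<in> Arr C"
    and Dom_Ide: "x \<in> Ob C \<Longrightarrow> Dom C (Ide C x) = x"
    and Cod_Ide: "x \<in> Ob C \<Longrightarrow> Cod C (Ide C x) = x"
    and Comp_in: "\<lbrakk>a \<in> Arr C; b \<in> Arr C; Cod C a = Dom C b\<rbrakk> \<Longrightarrow> Comp C b a \<in> Arr C"
    and Dom_Comp: "\<lbrakk>a \<in> Arr C; b \<in> Arr C; Cod C a = Dom C b\<rbrakk> \<Longrightarrow> Dom C (Comp C b a) = Dom C a"
    and Cod_Comp: "\<lbrakk>a \<in> Arr C; b \<in> Arr C; Cod C a = Dom C b\<rbrakk> \<Longrightarrow> Cod C (Comp C b a) = Cod C b"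
    and Comp_Ide: "a \<in> Arr C \<Longrightarrow> Comp C a (Ide C (Dom C a)) = a"
    and Ide_Comp: "a \<in> Arr C \<Longrightarrow> Comp C (Ide C (Cod C a)) a = a"
    and Comp_assoc: "\<lbrakk>a \<in> Arr C; b \<in> Arr C; c \<in> Arr C; Cod C a = Dom C b; Cod C b = Dom C c\<rbrakk>
      \<Longrightarrow> Comp C c (Comp C b a) = Comp C (Comp C c b) a"

definition cat_iso :: "('o, 'm) cat \<Rightarrow> 'm \<Rightarrow> bool" where
  "cat_iso C a \<longleftrightarrow> a \<in> Arr C \<and>
     (\<exists>b \<in> Arr C. Dom C b = Cod C a \<and> Cod C b = Dom C a \<and>
        Comp C b a = Ide C (Dom C a) \<and> Comp C a b = Ide C (Cod C a))"

locale groupoid = category +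
  assumes iso: "a \<in> Arr C \<Longrightarrow> cat_iso C a"

locale cat_functor = source: category C + target: category D
  for C :: "('o, 'm) cat" and D :: "('p, 'n) cat" +
  fixes F0 :: "'o \<Rightarrow> 'p" and F1 :: "'m \<Rightarrow> 'n"
  assumes Ob_map: "x \<in> Ob C \<Longrightarrow> F0 x \<in> Ob D"
    and Arr_map: "a \<in> Arr C \<Longrightarrow> F1 a \<in> Arr D"
    and Dom_map: "a \<in> Arr C \<Longrightarrow> Dom D (F1 a) = F0 (Dom C a)"
    and Cod_map: "a \<in> Arr C \<Longrightarrow> Cod D (F1 a) = F0 (Cod C a)"
    and Ide_map: "x \<in> Ob C \<Longrightarrow> F1 (Ide C x) = Ide D (F0 x)"
    and Comp_map: "\<lbrakk>a \<in> Arr C; b \<in> Arr C; Cod C a = Dom C b\<rbrakk>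
      \<Longrightarrow> F1 (Comp C b a) = Comp D (F1 b) (F1 a)"

text \<open>
  A strict 2-category is given by three categories: the underlying category \<open>cells1\<close> of 0-cells and
  1-cells; the category \<open>vert\<close> of 1-cells and 2-cells under vertical composition (the disjoint union
  of the hom-categories); and the category \<open>horz\<close> of 0-cells and 2-cells under horizontal
  composition.
\<close>

record ('o, 'm, 'c) two_cat =
  cells1 :: "('o, 'm) cat"
  vert :: "('m, 'c) cat"
  horz :: "('o, 'c) cat"

locale two_category =
  fixes T :: "('o, 'm, 'c) two_cat"
  assumes cells1_category: "category (cells1 T)"
    and vert_category: "category (vert T)"
    and horz_category: "category (horz T)"
    and Ob_vert: "Ob (vert T) = Arr (cells1 T)"
    and Ob_horz: "Ob (horz T) = Ob (cells1 T)"
    and Arr_horz: "Arr (horz T) = Arr (vert T)"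
    and Dom_globular: "\<alpha> \<in> Arr (vert T) \<Longrightarrow>
      Dom (cells1 T) (Dom (vert T) \<alpha>) = Dom (horz T) \<alpha> \<and>
      Dom (cells1 T) (Cod (vert T) \<alpha>) = Dom (horz T) \<alpha>"
    and Cod_globular: "\<alpha> \<in> Arr (vert T) \<Longrightarrow>
      Cod (cells1 T) (Dom (vert T) \<alpha>) = Cod (horz T) \<alpha> \<and>
      Cod (cells1 T) (Cod (vert T) \<alpha>) = Cod (horz T) \<alpha>"
    and Dom_hcomp: "\<lbrakk>\<alpha> \<in> Arr (vert T); \<beta> \<in> Arr (vert T); Cod (horz T) \<alpha> = Dom (horz T) \<beta>\<rbrakk> \<Longrightarrow>
      Dom (vert T) (Comp (horz T) \<beta> \<alpha>) = Comp (cells1 T) (Dom (vert T) \<beta>) (Dom (vert T) \<alpha>)"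
    and Cod_hcomp: "\<lbrakk>\<alpha> \<in> Arr (vert T); \<beta> \<in> Arr (vert T); Cod (horz T) \<alpha> = Dom (horz T) \<beta>\<rbrakk> \<Longrightarrow>
      Cod (vert T) (Comp (horz T) \<beta> \<alpha>) = Comp (cells1 T) (Cod (vert T) \<beta>) (Cod (vert T) \<alpha>)"
    and Ide_horz: "x \<in> Ob (cells1 T) \<Longrightarrow> Ide (horz T) x = Ide (vert T) (Ide (cells1 T) x)"
    and hcomp_Ide: "\<lbrakk>f \<in> Arr (cells1 T); g \<in> Arr (cells1 T); Cod (cells1 T) f = Dom (cells1 T) g\<rbrakk> \<Longrightarrow>
      Comp (horz T) (Ide (vert T) g) (Ide (vert T) f) = Ide (vert T) (Comp (cells1 T) g f)"
    and interchange: "\<lbrakk>\<alpha> \<in> Arr (vert T); \<alpha>' \<in> Arr (vert T); \<beta> \<in> Arr (vert T); \<beta>' \<in> Arr (vert T);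
        Cod (vert T) \<alpha> = Dom (vert T) \<alpha>'; Cod (vert T) \<beta> = Dom (vert T) \<beta>';
        Cod (horz T) \<alpha> = Dom (horz T) \<beta>\<rbrakk> \<Longrightarrow>
      Comp (horz T) (Comp (vert T) \<beta>' \<beta>) (Comp (vert T) \<alpha>' \<alpha>) =
      Comp (vert T) (Comp (horz T) \<beta>' \<alpha>') (Comp (horz T) \<beta> \<alpha>)"

locale two_functor = source: two_category S + target: two_category T
  for S :: "('o, 'm, 'c) two_cat" and T :: "('p, 'n, 'd) two_cat" +
  fixes F0 :: "'o \<Rightarrow> 'p" and F1 :: "'m \<Rightarrow> 'n" and F2 :: "'c \<Rightarrow> 'd"
  assumes cells1_functor: "cat_functor (cells1 S) (cells1 T) F0 F1"
    and vert_functor: "cat_functor (vert S) (vert T) F1 F2"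
    and horz_functor: "cat_functor (horz S) (horz T) F0 F2"

text \<open>
  Arrows that have to remember their source and target are tagged with them.
\<close>

datatype ('o, 'd) arrow = Arrow (src: 'o) (body: 'd) (tgt: 'o)


section \<open>The 2-category of groupoids\<close>

text \<open>
  Functors and natural transformations are extensional functions on the objects and arrows of their
  source, so that equality in HOL is equality of functors and of natural transformations.
\<close>

definition functors ::
  "('o, 'm) cat \<Rightarrow> ('p, 'n) cat \<Rightarrow> (('o \<Rightarrow> 'p) \<times> ('m \<Rightarrow> 'n)) set" where
  "functors C D = {(F0, F1). cat_functor C D F0 F1 \<and>
     F0 \<in> extensional (Ob C) \<and> F1 \<in> extensional (Arr C)}"

definition id_functor :: "('o, 'm) cat \<Rightarrow> ('o \<Rightarrow> 'o) \<times> ('m \<Rightarrow> 'm)" where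
  "id_functor C = (\<lambda>x \<in> Ob C. x, \<lambda>a \<in> Arr C. a)"

definition comp_functor :: "('o, 'm) cat \<Rightarrow> ('p \<Rightarrow> 'q) \<times> ('n \<Rightarrow> 'k) \<Rightarrow> ('o \<Rightarrow> 'p) \<times> ('m \<Rightarrow> 'n)
    \<Rightarrow> ('o \<Rightarrow> 'q) \<times> ('m \<Rightarrow> 'k)" where
  "comp_functor C G F = (compose (Ob C) (fst G) (fst F), compose (Arr C) (snd G) (snd F))"

definition nat_trans :: "('o, 'm) cat \<Rightarrow> ('p, 'n) cat \<Rightarrow> ('o \<Rightarrow> 'p) \<times> ('m \<Rightarrow> 'n)
    \<Rightarrow> ('o \<Rightarrow> 'p) \<times> ('m \<Rightarrow> 'n) \<Rightarrow> ('o \<Rightarrow> 'n) set" where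
  "nat_trans C D F G = {\<eta> \<in> Ob C \<rightarrow>\<^sub>E Arr D.
     (\<forall>x \<in> Ob C. Dom D (\<eta> x) = fst F x \<and> Cod D (\<eta> x) = fst G x) \<and>
     (\<forall>a \<in> Arr C. Comp D (\<eta> (Cod C a)) (snd F a) = Comp D (snd G a) (\<eta> (Dom C a)))}"

definition nat_iso_rel :: "('o, 'm) cat \<Rightarrow> ('p, 'n) cat
    \<Rightarrow> ((('o \<Rightarrow> 'p) \<times> ('m \<Rightarrow> 'n)) \<times> (('o \<Rightarrow> 'p) \<times> ('m \<Rightarrow> 'n))) set" where
  "nat_iso_rel C D = {(F, G). F \<in> functors C D \<and> G \<in> functors C D \<and>
     (\<exists>\<eta> \<in> nat_trans C D F G. \<forall>x \<in> Ob C. cat_iso D (\<eta> x))}"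

type_synonym ('o, 'm) functor_arrow =
  "(('o, 'm) cat, ('o \<Rightarrow> 'o) \<times> ('m \<Rightarrow> 'm)) arrow"

type_synonym ('o, 'm) nat_trans_arrow =
  "(('o, 'm) functor_arrow, 'o \<Rightarrow> 'm) arrow"

definition Grpd1 :: "(('o, 'm) cat, ('o, 'm) functor_arrow) cat" where
  "Grpd1 = \<lparr>
     Ob = {C. groupoid C},
     Arr = {Arrow C F D | C F D. groupoid C \<and> groupoid D \<and> F \<in> functors C D},
     Dom = src,
     Cod = tgt,
     Ide = (\<lambda>C. Arrow C (id_functor C) C),
     Comp = (\<lambda>g f. Arrow (src f) (comp_functor (src f) (body g) (body f)) (tgt g)) \<rparr>"

definition Grpd_vert :: "(('o, 'm) functor_arrow, ('o, 'm) nat_trans_arrow) cat" where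
  "Grpd_vert = \<lparr>
     Ob = Arr Grpd1,
     Arr = {Arrow f \<eta> g | f \<eta> g. f \<in> Arr Grpd1 \<and> g \<in> Arr Grpd1 \<and>
              src f = src g \<and> tgt f = tgt g \<and> \<eta> \<in> nat_trans (src f) (tgt f) (body f) (body g)},
     Dom = src,
     Cod = tgt,
     Ide = (\<lambda>f. Arrow f (\<lambda>x \<in> Ob (src f). Ide (tgt f) (fst (body f) x)) f),
     Comp = (\<lambda>\<beta> \<alpha>. Arrow (src \<alpha>)
              (\<lambda>x \<in> Ob (src (src \<alpha>)). Comp (tgt (src \<alpha>)) (body \<beta> x) (body \<alpha> x)) (tgt \<beta>)) \<rparr>"

text \<open>
  For \<open>\<alpha> : F \<Rightarrow> F'\<close> and \<open>\<beta> : G \<Rightarrow> G'\<close>, the component at \<open>x\<close> of the horizontal composite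
  is \<open>\<beta>\<close> at \<open>F' x\<close> after \<open>G\<close> of \<open>\<alpha>\<close> at \<open>x\<close>.
\<close>

definition Grpd_horz :: "(('o, 'm) cat, ('o, 'm) nat_trans_arrow) cat" where
  "Grpd_horz = \<lparr>
     Ob = Ob Grpd1,
     Arr = Arr Grpd_vert,
     Dom = (\<lambda>\<alpha>. src (src \<alpha>)),
     Cod = (\<lambda>\<alpha>. tgt (src \<alpha>)),
     Ide = (\<lambda>C. Ide Grpd_vert (Ide Grpd1 C)),
     Comp = (\<lambda>\<beta> \<alpha>. Arrow (Comp Grpd1 (src \<beta>) (src \<alpha>))
              (\<lambda>x \<in> Ob (src (src \<alpha>)).
                 Comp (tgt (src \<beta>)) (body \<beta> (fst (body (tgt \<alpha>)) x)) (snd (body (src \<beta>)) (body \<alpha> x)))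
              (Comp Grpd1 (tgt \<beta>) (tgt \<alpha>))) \<rparr>"

definition Grpd :: "(('o, 'm) cat, ('o, 'm) functor_arrow, ('o, 'm) nat_trans_arrow) two_cat" where
  "Grpd = \<lparr> cells1 = Grpd1, vert = Grpd_vert, horz = Grpd_horz \<rparr>"

definition hGrpd ::
  "(('o, 'm) cat, (('o, 'm) cat, (('o \<Rightarrow> 'o) \<times> ('m \<Rightarrow> 'm)) set) arrow) cat" where
  "hGrpd = \<lparr>
     Ob = {C. groupoid C},
     Arr = {Arrow C c D | C c D. groupoid C \<and> groupoid D \<and> c \<in> functors C D // nat_iso_rel C D},
     Dom = src,
     Cod = tgt,
     Ide = (\<lambda>C. Arrow C (nat_iso_rel C C `` {id_functor C}) C),
     Comp = (\<lambda>b a. Arrow (src a)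
              (\<Union>F \<in> body a. \<Union>G \<in> body b.
                 nat_iso_rel (src a) (tgt b) `` {comp_functor (src a) G F}) (tgt b)) \<rparr>"


section \<open>The 2-category of graphs and the homotopy category\<close>

text \<open>
  The objects of the categories of graphs are the graphs whose vertices lie in an arbitrary but fixed
  type \<open>'a\<close>. Graph morphisms and homotopies are extensional functions, and compositions of
  equivalence classes are unions over representatives of the class of the composite.
\<close>

record 'a graph =
  verts :: "'a set"
  edges :: "('a \<times> 'a) set"

definition is_graph :: "'a graph \<Rightarrow> bool" where
  "is_graph G \<longleftrightarrow> edges G \<subseteq> verts G \<times> verts G \<and> sym (edges G)"

definition no_isolated :: "'a graph \<Rightarrow> bool" where
  "no_isolated G \<longleftrightarrow> (\<forall>v \<in> verts G. \<exists>w \<in> verts G. (v, w) \<in> edges G)"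

definition gmor :: "'a graph \<Rightarrow> 'b graph \<Rightarrow> ('a \<Rightarrow> 'b) set" where
  "gmor G H = {f \<in> verts G \<rightarrow>\<^sub>E verts H. \<forall>(v, w) \<in> edges G. (f v, f w) \<in> edges H}"

definition gprod :: "'a graph \<Rightarrow> 'b graph \<Rightarrow> ('a \<times> 'b) graph" (infixl "\<times>\<^sub>g" 75) where
  "G \<times>\<^sub>g H = \<lparr> verts = verts G \<times> verts H,
     edges = {((v1, w1), (v2, w2)). (v1, v2) \<in> edges G \<and> (w1, w2) \<in> edges H} \<rparr>"

definition path_graph :: "nat \<Rightarrow> nat graph" where
  "path_graph n = \<lparr> verts = {0..n},
     edges = {(i, j). i \<le> n \<and> j \<le> n \<and> (j = i + 1 \<or> i = j + 1)} \<rparr>"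

definition Iloop :: "nat \<Rightarrow> nat graph" where
  "Iloop n = \<lparr> verts = {0..n},
     edges = {(i, j). i \<le> n \<and> j \<le> n \<and> (j = i \<or> j = i + 1 \<or> i = j + 1)} \<rparr>"

text \<open>A \<open>\<times>\<close>-homotopy is recorded together with its length.\<close>

type_synonym 'a htpy = "nat \<times> ('a \<times> nat \<Rightarrow> 'a)"

definition htpies :: "'a graph \<Rightarrow> 'a graph \<Rightarrow> ('a \<Rightarrow> 'a) \<Rightarrow> ('a \<Rightarrow> 'a) \<Rightarrow> 'a htpy set" where
  "htpies G H f g = {(n, \<Lambda>). \<Lambda> \<in> gmor (G \<times>\<^sub>g Iloop n) H \<and>
     (\<forall>v \<in> verts G. \<Lambda> (v, 0) = f v) \<and> (\<forall>v \<in> verts G. \<Lambda> (v, n) = g v)}"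

definition htpy_rel ::
  "'a graph \<Rightarrow> 'a graph \<Rightarrow> ('a \<Rightarrow> 'a) \<Rightarrow> ('a \<Rightarrow> 'a) \<Rightarrow> ('a htpy \<times> 'a htpy) set" where
  "htpy_rel G H f g = {((n, \<Lambda>), (n', \<Lambda>')).
     n = n' \<and> (n, \<Lambda>) \<in> htpies G H f g \<and> (n', \<Lambda>') \<in> htpies G H f g \<and>
     (\<exists>m. \<exists>\<Theta> \<in> gmor (G \<times>\<^sub>g Iloop n \<times>\<^sub>g Iloop m) H.
        (\<forall>x \<in> verts (G \<times>\<^sub>g Iloop n). \<Theta> (x, 0) = \<Lambda> x \<and> \<Theta> (x, m) = \<Lambda>' x) \<and>
        (\<forall>v \<in> verts G. \<forall>j \<le> m. \<Theta> ((v, 0), j) = f v \<and> \<Theta> ((v, n), j) = g v))}"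

fun hconcat :: "'a graph \<Rightarrow> 'a htpy \<Rightarrow> 'a htpy \<Rightarrow> 'a htpy" where
  "hconcat G (n, \<Lambda>) (m, \<Lambda>') = (n + m,
     \<lambda>(v, i) \<in> verts (G \<times>\<^sub>g Iloop (n + m)). if i \<le> n then \<Lambda> (v, i) else \<Lambda>' (v, i - n))"

definition const_htpy :: "'a graph \<Rightarrow> ('a \<Rightarrow> 'a) \<Rightarrow> 'a htpy" where
  "const_htpy G f = (0, \<lambda>(v, i) \<in> verts (G \<times>\<^sub>g Iloop 0). f v)"

fun post_htpy :: "'a graph \<Rightarrow> ('a \<Rightarrow> 'a) \<Rightarrow> 'a htpy \<Rightarrow> 'a htpy" where
  "post_htpy G g (n, \<Lambda>) = (n, \<lambda>(v, i) \<in> verts (G \<times>\<^sub>g Iloop n). g (\<Lambda> (v, i)))"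

fun pre_htpy :: "'a graph \<Rightarrow> 'a htpy \<Rightarrow> ('a \<Rightarrow> 'a) \<Rightarrow> 'a htpy" where
  "pre_htpy G (m, \<Lambda>') f' = (m, \<lambda>(v, i) \<in> verts (G \<times>\<^sub>g Iloop m). \<Lambda>' (f' v, i))"

type_synonym 'a graph_arrow = "('a graph, 'a \<Rightarrow> 'a) arrow"

type_synonym 'a htpy_arrow = "('a graph_arrow, 'a htpy set) arrow"

definition Gph1 :: "('a graph, 'a graph_arrow) cat" where
  "Gph1 = \<lparr>
     Ob = {G. is_graph G \<and> no_isolated G},
     Arr = {Arrow G f H | G f H. is_graph G \<and> no_isolated G \<and> is_graph H \<and> no_isolated H \<and>
              f \<in> gmor G H},
     Dom = src,
     Cod = tgt,
     Ide = (\<lambda>G. Arrow G (\<lambda>v \<in> verts G. v) G),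
     Comp = (\<lambda>g f. Arrow (src f) (compose (verts (src f)) (body g) (body f)) (tgt g)) \<rparr>"

definition Gph_vert :: "('a graph_arrow, 'a htpy_arrow) cat" where
  "Gph_vert = \<lparr>
     Ob = Arr Gph1,
     Arr = {Arrow f c g | f c g. f \<in> Arr Gph1 \<and> g \<in> Arr Gph1 \<and> src f = src g \<and> tgt f = tgt g \<and>
              c \<in> htpies (src f) (tgt f) (body f) (body g) //
                  htpy_rel (src f) (tgt f) (body f) (body g)},
     Dom = src,
     Cod = tgt,
     Ide = (\<lambda>f. Arrow f
              (htpy_rel (src f) (tgt f) (body f) (body f) `` {const_htpy (src f) (body f)}) f),
     Comp = (\<lambda>\<beta> \<alpha>. Arrow (src \<alpha>)
              (\<Union>\<Lambda> \<in> body \<alpha>. \<Union>\<Lambda>' \<in> body \<beta>.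
                 htpy_rel (src (src \<alpha>)) (tgt (src \<alpha>)) (body (src \<alpha>)) (body (tgt \<beta>)) ``
                   {hconcat (src (src \<alpha>)) \<Lambda> \<Lambda>'})
              (tgt \<beta>)) \<rparr>"

definition Gph_horz :: "('a graph, 'a htpy_arrow) cat" where
  "Gph_horz = \<lparr>
     Ob = Ob Gph1,
     Arr = Arr Gph_vert,
     Dom = (\<lambda>\<alpha>. src (src \<alpha>)),
     Cod = (\<lambda>\<alpha>. tgt (src \<alpha>)),
     Ide = (\<lambda>G. Ide Gph_vert (Ide Gph1 G)),
     Comp = (\<lambda>\<beta> \<alpha>.
       let G = src (src \<alpha>); K = tgt (src \<beta>);
           f' = body (tgt \<alpha>); g = body (src \<beta>);
           s = Comp Gph1 (src \<beta>) (src \<alpha>); t = Comp Gph1 (tgt \<beta>) (tgt \<alpha>)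
       in Arrow s
            (\<Union>\<Lambda> \<in> body \<alpha>. \<Union>\<Lambda>' \<in> body \<beta>.
               htpy_rel G K (body s) (body t) `` {hconcat G (post_htpy G g \<Lambda>) (pre_htpy G \<Lambda>' f')})
            t) \<rparr>"

definition Gph :: "('a graph, 'a graph_arrow, 'a htpy_arrow) two_cat" where
  "Gph = \<lparr> cells1 = Gph1, vert = Gph_vert, horz = Gph_horz \<rparr>"

definition htpc_rel :: "'a graph \<Rightarrow> 'a graph \<Rightarrow> (('a \<Rightarrow> 'a) \<times> ('a \<Rightarrow> 'a)) set" where
  "htpc_rel G H = {(f, g). f \<in> gmor G H \<and> g \<in> gmor G H \<and> htpies G H f g \<noteq> {}}"

definition hFGph :: "('a graph, ('a graph, ('a \<Rightarrow> 'a) set) arrow) cat" where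
  "hFGph = \<lparr>
     Ob = {G. is_graph G \<and> no_isolated G \<and> finite (verts G)},
     Arr = {Arrow G c H | G c H.
              is_graph G \<and> no_isolated G \<and> finite (verts G) \<and>
              is_graph H \<and> no_isolated H \<and> finite (verts H) \<and>
              c \<in> gmor G H // htpc_rel G H},
     Dom = src,
     Cod = tgt,
     Ide = (\<lambda>G. Arrow G (htpc_rel G G `` {\<lambda>v \<in> verts G. v}) G),
     Comp = (\<lambda>b a. Arrow (src a)
              (\<Union>f \<in> body a. \<Union>g \<in> body b.
                 htpc_rel (src a) (tgt b) `` {compose (verts (src a)) g f}) (tgt b)) \<rparr>"


section \<open>The fundamental groupoid\<close>

text \<open>A walk of length \<open>n\<close> is represented by the list of its \<open>n + 1\<close> values.\<close>

definition walks :: "'a graph \<Rightarrow> 'a \<Rightarrow> 'a \<Rightarrow> 'a list set" where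
  "walks G v w = {\<alpha>. \<alpha> \<noteq> [] \<and> hd \<alpha> = v \<and> last \<alpha> = w \<and>
     (\<lambda>i \<in> {0..length \<alpha> - 1}. \<alpha> ! i) \<in> gmor (path_graph (length \<alpha> - 1)) G}"

definition prune :: "'a list \<Rightarrow> 'a list \<Rightarrow> bool" where
  "prune \<alpha> \<beta> \<longleftrightarrow>
     (\<exists>i. i + 2 < length \<alpha> \<and> \<alpha> ! i = \<alpha> ! (i + 2) \<and> \<beta> = take i \<alpha> @ drop (i + 2) \<alpha>)"

definition walk_htpy :: "'a graph \<Rightarrow> 'a \<Rightarrow> 'a \<Rightarrow> 'a list \<Rightarrow> 'a list \<Rightarrow> bool" where
  "walk_htpy G v w \<alpha> \<beta> \<longleftrightarrow>
     (\<exists>n m. length \<alpha> = n + 1 \<and> length \<beta> = n + 1 \<and>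
        (\<exists>\<Lambda> \<in> gmor (path_graph n \<times>\<^sub>g Iloop m) G.
           (\<forall>i \<le> n. \<Lambda> (i, 0) = \<alpha> ! i \<and> \<Lambda> (i, m) = \<beta> ! i) \<and>
           (\<forall>j \<le> m. \<Lambda> (0, j) = v \<and> \<Lambda> (n, j) = w)))"

definition walk_rel :: "'a graph \<Rightarrow> 'a \<Rightarrow> 'a \<Rightarrow> ('a list \<times> 'a list) set" where
  "walk_rel G v w = {(\<alpha>, \<beta>).
     equivclp (\<lambda>\<alpha> \<beta>. \<alpha> \<in> walks G v w \<and> \<beta> \<in> walks G v w \<and> (prune \<alpha> \<beta> \<or> walk_htpy G v w \<alpha> \<beta>)) \<alpha> \<beta>}"

type_synonym 'a walk_arrow = "('a, 'a list set) arrow"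

definition fund_groupoid :: "'a graph \<Rightarrow> ('a, 'a walk_arrow) cat" where
  "fund_groupoid G = \<lparr>
     Ob = verts G,
     Arr = {Arrow v c w | v c w. v \<in> verts G \<and> w \<in> verts G \<and> c \<in> walks G v w // walk_rel G v w},
     Dom = src,
     Cod = tgt,
     Ide = (\<lambda>v. Arrow v (walk_rel G v v `` {[v]}) v),
     Comp = (\<lambda>b a. Arrow (src a)
              (\<Union>\<alpha> \<in> body a. \<Union>\<beta> \<in> body b. walk_rel G (src a) (tgt b) `` {\<alpha> @ tl \<beta>}) (tgt b)) \<rparr>"

definition induced_functor ::
  "'a graph \<Rightarrow> ('a \<Rightarrow> 'a) \<Rightarrow> 'a graph \<Rightarrow> ('a \<Rightarrow> 'a) \<times> ('a walk_arrow \<Rightarrow> 'a walk_arrow)" where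
  "induced_functor G \<phi> H =
     (\<lambda>v \<in> verts G. \<phi> v,
      \<lambda>a \<in> Arr (fund_groupoid G). Arrow (\<phi> (src a))
        (\<Union>\<alpha> \<in> body a. walk_rel H (\<phi> (src a)) (\<phi> (tgt a)) `` {map \<phi> \<alpha>}) (\<phi> (tgt a)))"

definition fund_groupoid_map :: "'a graph_arrow \<Rightarrow> ('a, 'a walk_arrow) functor_arrow" where
  "fund_groupoid_map f =
     Arrow (fund_groupoid (src f)) (induced_functor (src f) (body f) (tgt f))
       (fund_groupoid (tgt f))"

end

theory Submission
  imports Defs
begin

text \<open>
  A homotopy of length \<open>n\<close> is a walk \<open>f\<^sub>0, \<dots>, f\<^sub>n\<close> in the graph of morphisms, where \<open>f\<close> and \<open>g\<close> are
  adjacent if \<open>v \<sim> w\<close> implies \<open>f v \<sim> g w\<close>. Choosing a neighbour \<open>w\<close> of \<open>v\<close>, which exists as \<open>v\<close> is not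
  isolated, turns it into the walk \<open>f\<^sub>0 v, f\<^sub>0 w, f\<^sub>1 v, f\<^sub>1 w, \<dots>, f\<^sub>n v\<close>, whose class is the component at
  \<open>v\<close> of the natural transformation. Each property of it that involves homotopies is an instance of
  one fact: two walks \<open>a\<close>, \<open>b\<close> of equal length with the same ends are homotopic as soon as
  \<open>a\<^sub>i \<sim> b\<^sub>i\<^sub>+\<^sub>1\<close> and \<open>b\<^sub>i \<sim> a\<^sub>i\<^sub>+\<^sub>1\<close> for all \<open>i\<close>. This gives independence of \<open>w\<close>, invariance under homotopy
  rel endpoints and naturality along a single edge.
\<close>

section \<open>Quotient categories\<close>

text \<open>The detour through \<open>w\<close> is forced: \<open>v\<close> need not carry a loop,
  so for adjacent morphisms \<open>f\<close> and \<open>g\<close> the values \<open>f v\<close> and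
  \<open>g v\<close> need not be adjacent, and the values at \<open>v\<close> alone do not form a
  walk. Independence of \<open>w\<close> is more than a matter of well-definedness: a morphism does
  not respect chosen neighbours, so already the component of a horizontal composite is computed with
  a neighbour other than the chosen one, and naturality along a walk changes the neighbour at every
  vertex. That graphs form a 2-category has to be proved as well. On representatives its unit and
  associativity laws are equalities of lists of morphisms; interchange alone needs a genuine
  homotopy. Homotopies of different lengths are never identified, so both sides of interchange must
  have the same length; they do, as each runs through the same pieces in another order. The passage
  to homotopy classes then costs little, because a natural transformation into a groupoid is a
  natural isomorphism.\<close>

definition quot_cat :: "'o set \<Rightarrow> ('o \<Rightarrow> 'o \<Rightarrow> 'm set) \<Rightarrow> ('o \<Rightarrow> 'o \<Rightarrow> ('m \<times> 'm) set) \<Rightarrow> ('o \<Rightarrow> 'm) \<Rightarrow>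
    ('o \<Rightarrow> 'm \<Rightarrow> 'm \<Rightarrow> 'm) \<Rightarrow> ('o, ('o, 'm set) arrow) cat" where
  "quot_cat Obs A R one mul = \<lparr>
     Ob = Obs,
     Arr = {Arrow x c y | x c y. x \<in> Obs \<and> y \<in> Obs \<and> c \<in> A x y // R x y},
     Dom = src,
     Cod = tgt,
     Ide = (\<lambda>x. Arrow x (R x x `` {one x}) x),
     Comp = (\<lambda>b a. Arrow (src a)
       (\<Union>f \<in> body a. \<Union>g \<in> body b. R (src a) (tgt b) `` {mul (src a) f g}) (tgt b)) \<rparr>"

definition cls :: "('o \<Rightarrow> 'o \<Rightarrow> ('m \<times> 'm) set) \<Rightarrow> 'o \<Rightarrow> 'o \<Rightarrow> 'm \<Rightarrow> ('o, 'm set) arrow" where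
  "cls R x y f = Arrow x (R x y `` {f}) y"

lemma src_cls [simp]: "src (cls R x y f) = x"
  and tgt_cls [simp]: "tgt (cls R x y f) = y"
  and body_cls: "body (cls R x y f) = R x y `` {f}"
  by (simp_all add: cls_def)

text \<open>A function on classes is evaluated at a representative picked by \<open>SOME\<close>.
  The lemma of the same name in \<open>quotient_data\<close> removes the choice as soon as
  \<open>\<Phi>\<close> is constant on the class.\<close>

definition lift_cls :: "('o \<Rightarrow> 'o \<Rightarrow> 'm \<Rightarrow> 'c) \<Rightarrow> ('o, 'm set) arrow \<Rightarrow> 'c" where
  "lift_cls \<Phi> a = \<Phi> (src a) (tgt a) (SOME f. f \<in> body a)"

text \<open>Four categories below have this shape: fundamental groupoids, homotopies under vertical
  composition, graphs up to homotopy, groupoids up to natural isomorphism. The axioms on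
  \<open>R\<close> are restricted to members of \<open>A x y\<close>, because \<open>R\<close> may
  relate other things too: \<open>walk_rel\<close> relates every list to itself.\<close>

locale quotient_data =
  fixes Obs :: "'o set" and A :: "'o \<Rightarrow> 'o \<Rightarrow> 'm set" and R :: "'o \<Rightarrow> 'o \<Rightarrow> ('m \<times> 'm) set"
    and one :: "'o \<Rightarrow> 'm" and mul :: "'o \<Rightarrow> 'm \<Rightarrow> 'm \<Rightarrow> 'm"
  assumes R_refl: "\<lbrakk>x \<in> Obs; y \<in> Obs; f \<in> A x y\<rbrakk> \<Longrightarrow> (f, f) \<in> R x y"
    and R_closed: "\<lbrakk>x \<in> Obs; y \<in> Obs; f \<in> A x y; (f, g) \<in> R x y\<rbrakk> \<Longrightarrow> g \<in> A x y"
    and R_sym: "\<lbrakk>x \<in> Obs; y \<in> Obs; f \<in> A x y; (f, g) \<in> R x y\<rbrakk> \<Longrightarrow> (g, f) \<in> R x y"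
    and R_trans: "\<lbrakk>x \<in> Obs; y \<in> Obs; f \<in> A x y; (f, g) \<in> R x y; (g, h) \<in> R x y\<rbrakk> \<Longrightarrow> (f, h) \<in> R x y"
    and one_in: "x \<in> Obs \<Longrightarrow> one x \<in> A x x"
    and mul_in: "\<lbrakk>x \<in> Obs; y \<in> Obs; z \<in> Obs; f \<in> A x y; g \<in> A y z\<rbrakk> \<Longrightarrow> mul x f g \<in> A x z"
    and mul_cong: "\<lbrakk>x \<in> Obs; y \<in> Obs; z \<in> Obs; f \<in> A x y; g \<in> A y z; (f, f') \<in> R x y; (g, g') \<in> R y z\<rbrakk>
      \<Longrightarrow> (mul x f g, mul x f' g') \<in> R x z"
    and one_mul: "\<lbrakk>x \<in> Obs; y \<in> Obs; f \<in> A x y\<rbrakk> \<Longrightarrow> (mul x (one x) f, f) \<in> R x y"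
    and mul_one: "\<lbrakk>x \<in> Obs; y \<in> Obs; f \<in> A x y\<rbrakk> \<Longrightarrow> (mul x f (one y), f) \<in> R x y"
    and mul_assoc: "\<lbrakk>x \<in> Obs; y \<in> Obs; z \<in> Obs; w \<in> Obs; f \<in> A x y; g \<in> A y z; h \<in> A z w\<rbrakk>
      \<Longrightarrow> (mul x (mul x f g) h, mul x f (mul y g h)) \<in> R x w"
begin

abbreviation Q :: "('o, ('o, 'm set) arrow) cat" where
  "Q \<equiv> quot_cat Obs A R one mul"

lemma class_eqI:
  assumes "x \<in> Obs" "y \<in> Obs" "f \<in> A x y" "(f, g) \<in> R x y"
  shows "R x y `` {f} = R x y `` {g}"
  using assms R_closed R_sym R_trans by blast

lemma cls_eqI: "\<lbrakk>x \<in> Obs; y \<in> Obs; f \<in> A x y; (f, g) \<in> R x y\<rbrakk> \<Longrightarrow> cls R x y f = cls R x y g"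
  by (simp add: cls_def class_eqI)

lemma cls_in: "\<lbrakk>x \<in> Obs; y \<in> Obs; f \<in> A x y\<rbrakk> \<Longrightarrow> cls R x y f \<in> Arr Q"
  by (auto simp: quot_cat_def cls_def quotient_def)

lemma ArrE:
  assumes "a \<in> Arr Q"
  obtains x y f where "x \<in> Obs" "y \<in> Obs" "f \<in> A x y" "a = cls R x y f"
  using assms by (auto simp: quot_cat_def cls_def quotient_def)

lemma lift_cls:
  assumes "x \<in> Obs" "y \<in> Obs" "f \<in> A x y" "\<And>g. (f, g) \<in> R x y \<Longrightarrow> \<Phi> x y f = \<Phi> x y g"
  shows "lift_cls \<Phi> (cls R x y f) = \<Phi> x y f"
proof -
  have "(f, SOME g. g \<in> R x y `` {f}) \<in> R x y"
    using R_refl[OF assms(1-3)] by (metis Image_singleton_iff someI)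
  then show ?thesis
    using assms(4) by (simp add: lift_cls_def body_cls)
qed

text \<open>By \<open>mul_cong\<close> all members of the union are the same class, and by
  reflexivity the union is not empty. This is what makes composition by unions over representatives
  computable.\<close>

lemma union_classes:
  assumes "x \<in> Obs" "y \<in> Obs" "z \<in> Obs" "f \<in> A x y" "g \<in> A y z"
  shows "(\<Union>f' \<in> R x y `` {f}. \<Union>g' \<in> R y z `` {g}. R x z `` {mul x f' g'}) = R x z `` {mul x f g}"
proof -
  have "R x z `` {mul x f' g'} = R x z `` {mul x f g}" if "(f, f') \<in> R x y" "(g, g') \<in> R y z" for f' g'
    using class_eqI[OF assms(1,3) mul_in[OF assms] mul_cong[OF assms that]] by simp
  moreover have "f \<in> R x y `` {f}" "g \<in> R y z `` {g}"
    using R_refl assms by auto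
  ultimately show ?thesis by blast
qed

lemma Comp_cls:
  assumes "x \<in> Obs" "y \<in> Obs" "z \<in> Obs" "f \<in> A x y" "g \<in> A y z"
  shows "Comp Q (cls R y z g) (cls R x y f) = cls R x z (mul x f g)"
  using union_classes[OF assms] by (simp add: quot_cat_def cls_def)

lemma Q_simps [simp]: "Ob Q = Obs" "Dom Q = src" "Cod Q = tgt" "Ide Q x = cls R x x (one x)"
  by (simp_all add: quot_cat_def cls_def)

lemma category: "category Q"
proof
  fix a b c
  assume "a \<in> Arr Q" "b \<in> Arr Q" "Cod Q a = Dom Q b"
  then show "Comp Q b a \<in> Arr Q" "Dom Q (Comp Q b a) = Dom Q a" "Cod Q (Comp Q b a) = Cod Q b"
    by (auto elim!: ArrE simp: Comp_cls intro!: cls_in mul_in)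
next
  fix a b c
  assume *: "a \<in> Arr Q" "b \<in> Arr Q" "c \<in> Arr Q" "Cod Q a = Dom Q b" "Cod Q b = Dom Q c"
  obtain x y f where a: "x \<in> Obs" "y \<in> Obs" "f \<in> A x y" "a = cls R x y f"
    using *(1) ArrE by blast
  obtain z g where b: "z \<in> Obs" "g \<in> A y z" "b = cls R y z g"
    using *(2,4) a ArrE by (metis Q_simps(2,3) src_cls tgt_cls)
  obtain w h where c: "w \<in> Obs" "h \<in> A z w" "c = cls R z w h"
    using *(3,5) b ArrE by (metis Q_simps(2,3) src_cls tgt_cls)
  show "Comp Q c (Comp Q b a) = Comp Q (Comp Q c b) a"
    using a b c mul_in[of x y z f g] mul_in[of y z w g h]
    by (simp add: Comp_cls cls_eqI mul_assoc mul_in)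
next
  fix a
  assume "a \<in> Arr Q"
  then obtain x y f where a: "x \<in> Obs" "y \<in> Obs" "f \<in> A x y" "a = cls R x y f"
    using ArrE by blast
  show "Comp Q a (Ide Q (Dom Q a)) = a" "Comp Q (Ide Q (Cod Q a)) a = a"
    using a one_in by (simp_all add: Comp_cls cls_eqI mul_in one_mul mul_one)
  show "Dom Q a \<in> Ob Q" "Cod Q a \<in> Ob Q"
    using a by simp_all
qed (auto simp: one_in cls_in)

text \<open>Every arrow of \<open>Q\<close> is the class of some representative and composition is
  computed on representatives, so the functor laws only have to be tested there.\<close>

lemma functorI:
  assumes "category D"
    and "\<And>x. x \<in> Obs \<Longrightarrow> F0 x \<in> Ob D"
    and "\<And>x y f. \<lbrakk>x \<in> Obs; y \<in> Obs; f \<in> A x y\<rbrakk> \<Longrightarrow> F1 (cls R x y f) \<in> Arr D \<and>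
      Dom D (F1 (cls R x y f)) = F0 x \<and> Cod D (F1 (cls R x y f)) = F0 y"
    and "\<And>x. x \<in> Obs \<Longrightarrow> F1 (cls R x x (one x)) = Ide D (F0 x)"
    and "\<And>x y z f g. \<lbrakk>x \<in> Obs; y \<in> Obs; z \<in> Obs; f \<in> A x y; g \<in> A y z\<rbrakk> \<Longrightarrow>
      F1 (cls R x z (mul x f g)) = Comp D (F1 (cls R y z g)) (F1 (cls R x y f))"
  shows "cat_functor Q D F0 F1"
proof -
  interpret Q: category Q by (rule category)
  interpret D: category D by fact
  show ?thesis
  proof
    fix a b
    assume *: "a \<in> Arr Q" "b \<in> Arr Q" "Cod Q a = Dom Q b"
    obtain x y f where a: "x \<in> Obs" "y \<in> Obs" "f \<in> A x y" "a = cls R x y f"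
      using *(1) ArrE by blast
    obtain z g where b: "z \<in> Obs" "g \<in> A y z" "b = cls R y z g"
      using *(2,3) a ArrE by (metis Q_simps(2,3) src_cls tgt_cls)
    show "F1 (Comp Q b a) = Comp D (F1 b) (F1 a)"
      using a b by (simp add: Comp_cls assms(5))
  qed (use assms(2-4) in \<open>auto elim!: ArrE\<close>)
qed

lemma groupoidI:
  assumes "\<And>x y f. \<lbrakk>x \<in> Obs; y \<in> Obs; f \<in> A x y\<rbrakk> \<Longrightarrow>
    \<exists>g \<in> A y x. (mul x f g, one x) \<in> R x x \<and> (mul y g f, one y) \<in> R y y"
  shows "groupoid Q"
proof -
  interpret Q: category Q by (rule category)
  show ?thesis
  proof
    fix a
    assume "a \<in> Arr Q"
    then obtain x y f where a: "x \<in> Obs" "y \<in> Obs" "f \<in> A x y" "a = cls R x y f"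
      using ArrE by blast
    then obtain g where g: "g \<in> A y x" "(mul x f g, one x) \<in> R x x" "(mul y g f, one y) \<in> R y y"
      using assms by blast
    show "cat_iso Q a"
      unfolding cat_iso_def
    proof (intro conjI bexI)
      show "cls R y x g \<in> Arr Q"
        using a g by (simp add: cls_in)
    qed (use a g \<open>a \<in> Arr Q\<close> in \<open>simp_all add: Comp_cls cls_eqI mul_in\<close>)
  qed
qed

end

section \<open>Functors and natural transformations\<close>

lemma functors_iff: "F \<in> functors C D \<longleftrightarrow> cat_functor C D (fst F) (snd F) \<and>
    fst F \<in> extensional (Ob C) \<and> snd F \<in> extensional (Arr C)"
  by (auto simp: functors_def)

lemma functorsD:
  assumes "F \<in> functors C D"
  shows "cat_functor C D (fst F) (snd F)"
  using assms by (simp add: functors_iff)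

lemma functors_ext:
  assumes "F \<in> functors C D" "G \<in> functors C D"
    and "\<And>x. x \<in> Ob C \<Longrightarrow> fst F x = fst G x" "\<And>a. a \<in> Arr C \<Longrightarrow> snd F a = snd G a"
  shows "F = G"
  using assms by (auto simp: functors_iff prod_eq_iff intro: extensionalityI)

lemma id_functor_in: "category C \<Longrightarrow> id_functor C \<in> functors C C"
  by (auto simp: functors_iff id_functor_def cat_functor_def cat_functor_axioms_def category_def)

lemma comp_functor_in:
  assumes "F \<in> functors C D" "G \<in> functors D E"
  shows "comp_functor C G F \<in> functors C E"
proof -
  interpret F: cat_functor C D "fst F" "snd F" using assms functorsD by blast
  interpret G: cat_functor D E "fst G" "snd G" using assms functorsD by blast
  have "cat_functor C E (compose (Ob C) (fst G) (fst F)) (compose (Arr C) (snd G) (snd F))"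
    by unfold_locales
      (auto simp: compose_def F.Ob_map F.Arr_map F.Dom_map F.Cod_map F.Ide_map F.Comp_map
        G.Ob_map G.Arr_map G.Dom_map G.Cod_map G.Ide_map G.Comp_map F.source.Comp_in
        F.source.Dom_in F.source.Cod_in F.source.Ide_in)
  then show ?thesis
    by (simp add: functors_iff comp_functor_def compose_def)
qed

lemma fst_comp_functor: "x \<in> Ob C \<Longrightarrow> fst (comp_functor C G F) x = fst G (fst F x)"
  and snd_comp_functor: "a \<in> Arr C \<Longrightarrow> snd (comp_functor C G F) a = snd G (snd F a)"
  by (simp_all add: comp_functor_def compose_def)

lemma comp_functor_id:
  assumes "F \<in> functors C D"
  shows "comp_functor C F (id_functor C) = F" "comp_functor C (id_functor D) F = F"
proof -
  interpret F: cat_functor C D "fst F" "snd F" using assms functorsD by blast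
  have C: "id_functor C \<in> functors C C" and D: "id_functor D \<in> functors D D"
    by (auto intro: id_functor_in F.source.category_axioms F.target.category_axioms)
  show "comp_functor C F (id_functor C) = F"
    by (rule functors_ext[OF comp_functor_in[OF C assms] assms])
      (simp_all add: fst_comp_functor snd_comp_functor id_functor_def)
  show "comp_functor C (id_functor D) F = F"
    by (rule functors_ext[OF comp_functor_in[OF assms D] assms])
      (simp_all add: fst_comp_functor snd_comp_functor id_functor_def F.Ob_map F.Arr_map)
qed

lemma comp_functor_assoc:
  assumes "F \<in> functors B C" "G \<in> functors C D" "H \<in> functors D E"
  shows "comp_functor B H (comp_functor B G F) = comp_functor B (comp_functor C H G) F"
proof -
  interpret F: cat_functor B C "fst F" "snd F" using assms functorsD by blast
  show ?thesis
    by (rule functors_ext[of _ B E])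
      (simp_all add: fst_comp_functor snd_comp_functor F.Ob_map F.Arr_map
        comp_functor_in[OF assms(1) comp_functor_in[OF assms(2,3)]]
        comp_functor_in[OF comp_functor_in[OF assms(1,2)] assms(3)])
qed

section \<open>The 2-category of groupoids\<close>

lemma groupoid_category: "groupoid C \<Longrightarrow> category C"
  by (simp add: groupoid_def)

lemma Grpd1_simps [simp]: "Ob Grpd1 = {C. groupoid C}" "Dom Grpd1 = src" "Cod Grpd1 = tgt"
  "Ide Grpd1 C = Arrow C (id_functor C) C"
  "Comp Grpd1 g f = Arrow (src f) (comp_functor (src f) (body g) (body f)) (tgt g)"
  by (simp_all add: Grpd1_def)

lemma Arr_Grpd1: "f \<in> Arr Grpd1 \<longleftrightarrow>
    groupoid (src f) \<and> groupoid (tgt f) \<and> body f \<in> functors (src f) (tgt f)"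
  by (cases f; cases "body f") (simp add: Grpd1_def)

lemma category_Grpd1: "category Grpd1"
  by unfold_locales
    (auto simp: Arr_Grpd1 id_functor_in groupoid_category comp_functor_in comp_functor_id
      comp_functor_assoc)

lemma nat_transI:
  assumes "\<And>x. x \<in> Ob C \<Longrightarrow> \<eta> x \<in> Arr D \<and> Dom D (\<eta> x) = fst F x \<and> Cod D (\<eta> x) = fst G x"
    and "\<And>a. a \<in> Arr C \<Longrightarrow> Comp D (\<eta> (Cod C a)) (snd F a) = Comp D (snd G a) (\<eta> (Dom C a))"
    and "\<eta> \<in> extensional (Ob C)"
  shows "\<eta> \<in> nat_trans C D F G"
  using assms by (auto simp: nat_trans_def PiE_def)

lemma nat_transD:
  assumes "\<eta> \<in> nat_trans C D F G"
  shows "x \<in> Ob C \<Longrightarrow> \<eta> x \<in> Arr D" "x \<in> Ob C \<Longrightarrow> Dom D (\<eta> x) = fst F x"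
    "x \<in> Ob C \<Longrightarrow> Cod D (\<eta> x) = fst G x"
    "a \<in> Arr C \<Longrightarrow> Comp D (\<eta> (Cod C a)) (snd F a) = Comp D (snd G a) (\<eta> (Dom C a))"
    "\<eta> \<in> extensional (Ob C)"
  using assms by (auto simp: nat_trans_def PiE_def)

text \<open>This and the next two definitions are the operations of \<open>Grpd\<close> on bare
  families of components, without the tags that its arrows carry; naturality can thus be proved for
  arbitrary categories.\<close>

definition id_trans :: "('o, 'm) cat \<Rightarrow> ('p, 'n) cat \<Rightarrow> ('o \<Rightarrow> 'p) \<times> ('m \<Rightarrow> 'n) \<Rightarrow> 'o \<Rightarrow> 'n" where
  "id_trans C D F = (\<lambda>x \<in> Ob C. Ide D (fst F x))"

definition vcomp :: "('o, 'm) cat \<Rightarrow> ('p, 'n) cat \<Rightarrow> ('o \<Rightarrow> 'n) \<Rightarrow> ('o \<Rightarrow> 'n) \<Rightarrow> 'o \<Rightarrow> 'n" where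
  "vcomp C D \<theta> \<eta> = (\<lambda>x \<in> Ob C. Comp D (\<theta> x) (\<eta> x))"

definition hcomp :: "('o, 'm) cat \<Rightarrow> ('q, 'k) cat \<Rightarrow> ('o \<Rightarrow> 'p) \<times> ('m \<Rightarrow> 'n) \<Rightarrow> ('p \<Rightarrow> 'q) \<times> ('n \<Rightarrow> 'k)
    \<Rightarrow> ('p \<Rightarrow> 'k) \<Rightarrow> ('o \<Rightarrow> 'n) \<Rightarrow> 'o \<Rightarrow> 'k" where
  "hcomp C E F' G \<theta> \<eta> = (\<lambda>x \<in> Ob C. Comp E (\<theta> (fst F' x)) (snd G (\<eta> x)))"

lemma id_trans_in:
  assumes "F \<in> functors C D"
  shows "id_trans C D F \<in> nat_trans C D F F"
proof -
  interpret F: cat_functor C D "fst F" "snd F" using assms functorsD by blast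
  show ?thesis
  proof (rule nat_transI)
    fix a assume a: "a \<in> Arr C"
    show "Comp D (id_trans C D F (Cod C a)) (snd F a) = Comp D (snd F a) (id_trans C D F (Dom C a))"
      using a F.target.Comp_Ide[OF F.Arr_map[OF a]] F.target.Ide_Comp[OF F.Arr_map[OF a]]
      by (simp add: id_trans_def F.source.Dom_in F.source.Cod_in F.Dom_map F.Cod_map)
  qed (auto simp: id_trans_def F.Ob_map F.target.Ide_in F.target.Dom_Ide F.target.Cod_Ide)
qed

lemma vcomp_in:
  assumes "F \<in> functors C D" "G \<in> functors C D" "H \<in> functors C D"
    and \<eta>: "\<eta> \<in> nat_trans C D F G" and \<theta>: "\<theta> \<in> nat_trans C D G H"
  shows "vcomp C D \<theta> \<eta> \<in> nat_trans C D F H"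
proof -
  interpret F: cat_functor C D "fst F" "snd F" using assms functorsD by blast
  interpret G: cat_functor C D "fst G" "snd G" using assms functorsD by blast
  interpret H: cat_functor C D "fst H" "snd H" using assms functorsD by blast
  note \<eta>D = nat_transD[OF \<eta>] and \<theta>D = nat_transD[OF \<theta>]
  show ?thesis
  proof (rule nat_transI)
    fix a assume a: "a \<in> Arr C"
    let ?x = "Dom C a" and ?y = "Cod C a"
    have xy: "?x \<in> Ob C" "?y \<in> Ob C"
      using a F.source.Dom_in F.source.Cod_in by auto
    note s = a xy \<eta>D(1-3) \<theta>D(1-3) F.Arr_map F.Dom_map F.Cod_map G.Arr_map G.Dom_map G.Cod_map
      H.Arr_map H.Dom_map H.Cod_map
    have "Comp D (Comp D (\<theta> ?y) (\<eta> ?y)) (snd F a) = Comp D (\<theta> ?y) (Comp D (\<eta> ?y) (snd F a))"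
      by (subst F.target.Comp_assoc) (simp_all add: s)
    also have "\<dots> = Comp D (Comp D (\<theta> ?y) (snd G a)) (\<eta> ?x)"
      unfolding \<eta>D(4)[OF a] by (subst F.target.Comp_assoc) (simp_all add: s)
    also have "\<dots> = Comp D (snd H a) (Comp D (\<theta> ?x) (\<eta> ?x))"
      unfolding \<theta>D(4)[OF a] by (subst F.target.Comp_assoc) (simp_all add: s)
    finally show "Comp D (vcomp C D \<theta> \<eta> ?y) (snd F a) = Comp D (snd H a) (vcomp C D \<theta> \<eta> ?x)"
      using xy by (simp add: vcomp_def)
  qed (auto simp: vcomp_def \<eta>D(1-3) \<theta>D(1-3) F.target.Comp_in F.target.Dom_Comp F.target.Cod_Comp)
qed

lemma hcomp_in:
  assumes "F \<in> functors C D" "F' \<in> functors C D" "G \<in> functors D E" "G' \<in> functors D E"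
    and \<eta>: "\<eta> \<in> nat_trans C D F F'" and \<theta>: "\<theta> \<in> nat_trans D E G G'"
  shows "hcomp C E F' G \<theta> \<eta> \<in> nat_trans C E (comp_functor C G F) (comp_functor C G' F')"
proof -
  interpret F: cat_functor C D "fst F" "snd F" using assms functorsD by blast
  interpret F': cat_functor C D "fst F'" "snd F'" using assms functorsD by blast
  interpret G: cat_functor D E "fst G" "snd G" using assms functorsD by blast
  interpret G': cat_functor D E "fst G'" "snd G'" using assms functorsD by blast
  note \<eta>D = nat_transD[OF \<eta>] and \<theta>D = nat_transD[OF \<theta>]
  show ?thesis
  proof (rule nat_transI)
    fix a assume a: "a \<in> Arr C"
    let ?x = "Dom C a" and ?y = "Cod C a"
    have xy: "?x \<in> Ob C" "?y \<in> Ob C"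
      using a F.source.Dom_in F.source.Cod_in by auto
    note s = a xy \<eta>D(1-3) \<theta>D(1-3) F.Arr_map F.Dom_map F.Cod_map G.Arr_map G.Dom_map G.Cod_map
      F'.Arr_map F'.Dom_map F'.Cod_map G'.Arr_map G'.Dom_map G'.Cod_map F.Ob_map F'.Ob_map
    have "Comp E (Comp E (\<theta> (fst F' ?y)) (snd G (\<eta> ?y))) (snd G (snd F a))
        = Comp E (\<theta> (fst F' ?y)) (snd G (Comp D (\<eta> ?y) (snd F a)))"
      by (subst G.target.Comp_assoc[symmetric]) (simp_all add: s G.Comp_map)
    also have "\<dots> = Comp E (Comp E (\<theta> (fst F' ?y)) (snd G (snd F' a))) (snd G (\<eta> ?x))"
      unfolding \<eta>D(4)[OF a] by (subst G.target.Comp_assoc[symmetric]) (simp_all add: s G.Comp_map)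
    \<comment> \<open>The square of \<open>\<eta>\<close> has been transported by \<open>G\<close>;
      now naturality of \<open>\<theta>\<close> is used at the arrow \<open>F' a\<close>.\<close>
    also have "Comp E (\<theta> (fst F' ?y)) (snd G (snd F' a)) = Comp E (snd G' (snd F' a)) (\<theta> (fst F' ?x))"
      using \<theta>D(4)[OF F'.Arr_map[OF a]] a by (simp add: F'.Dom_map F'.Cod_map)
    also have "Comp E \<dots> (snd G (\<eta> ?x)) = Comp E (snd G' (snd F' a)) (Comp E (\<theta> (fst F' ?x)) (snd G (\<eta> ?x)))"
      by (subst G.target.Comp_assoc) (simp_all add: s)
    finally show "Comp E (hcomp C E F' G \<theta> \<eta> ?y) (snd (comp_functor C G F) a) =
        Comp E (snd (comp_functor C G' F') a) (hcomp C E F' G \<theta> \<eta> ?x)"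
      using xy a by (simp add: hcomp_def snd_comp_functor)
  qed (auto simp: hcomp_def \<eta>D(1-3) \<theta>D(1-3) F'.Ob_map G.Arr_map G.Dom_map G.Cod_map G.target.Comp_in
      G.target.Dom_Comp G.target.Cod_Comp fst_comp_functor)
qed

lemma Grpd_vert_simps [simp]: "Ob Grpd_vert = Arr Grpd1" "Dom Grpd_vert = src" "Cod Grpd_vert = tgt"
  "Ide Grpd_vert f = Arrow f (id_trans (src f) (tgt f) (body f)) f"
  "Comp Grpd_vert \<beta> \<alpha> = Arrow (src \<alpha>) (vcomp (src (src \<alpha>)) (tgt (src \<alpha>)) (body \<beta>) (body \<alpha>)) (tgt \<beta>)"
  by (simp_all add: Grpd_vert_def id_trans_def vcomp_def)

lemma Arr_Grpd_vert: "\<alpha> \<in> Arr Grpd_vert \<longleftrightarrow> src \<alpha> \<in> Arr Grpd1 \<and> tgt \<alpha> \<in> Arr Grpd1 \<and>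
    src (src \<alpha>) = src (tgt \<alpha>) \<and> tgt (src \<alpha>) = tgt (tgt \<alpha>) \<and>
    body \<alpha> \<in> nat_trans (src (src \<alpha>)) (tgt (src \<alpha>)) (body (src \<alpha>)) (body (tgt \<alpha>))"
  by (cases \<alpha>) (simp add: Grpd_vert_def)

lemma Grpd_horz_simps [simp]: "Ob Grpd_horz = {C. groupoid C}" "Arr Grpd_horz = Arr Grpd_vert"
  "Dom Grpd_horz \<alpha> = src (src \<alpha>)" "Cod Grpd_horz \<alpha> = tgt (src \<alpha>)"
  "Ide Grpd_horz C = Ide Grpd_vert (Ide Grpd1 C)"
  "Comp Grpd_horz \<beta> \<alpha> = Arrow (Comp Grpd1 (src \<beta>) (src \<alpha>))
    (hcomp (src (src \<alpha>)) (tgt (src \<beta>)) (body (tgt \<alpha>)) (body (src \<beta>)) (body \<beta>) (body \<alpha>))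
    (Comp Grpd1 (tgt \<beta>) (tgt \<alpha>))"
  by (simp_all add: Grpd_horz_def hcomp_def)

lemma category_Grpd_vert: "category Grpd_vert"
proof
  fix \<alpha> :: "('a, 'b) nat_trans_arrow"
  assume \<alpha>: "\<alpha> \<in> Arr Grpd_vert"
  let ?C = "src (src \<alpha>)" and ?D = "tgt (src \<alpha>)"
  interpret D: category ?D
    using \<alpha> by (simp add: Arr_Grpd_vert Arr_Grpd1 groupoid_category)
  have n: "body \<alpha> \<in> nat_trans ?C ?D (body (src \<alpha>)) (body (tgt \<alpha>))"
    using \<alpha> unfolding Arr_Grpd_vert by blast
  have "vcomp ?C ?D (body \<alpha>) (id_trans ?C ?D (body (src \<alpha>))) x = body \<alpha> x"
    "vcomp ?C ?D (id_trans ?C ?D (body (tgt \<alpha>))) (body \<alpha>) x = body \<alpha> x" for x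
    using nat_transD(1-3)[OF n, of x] nat_transD(5)[OF n] D.Comp_Ide[of "body \<alpha> x"] D.Ide_Comp[of "body \<alpha> x"]
    by (auto simp: vcomp_def id_trans_def extensional_def restrict_def)
  then have "vcomp ?C ?D (body \<alpha>) (id_trans ?C ?D (body (src \<alpha>))) = body \<alpha>"
    "vcomp ?C ?D (id_trans ?C ?D (body (tgt \<alpha>))) (body \<alpha>) = body \<alpha>"
    by auto
  then show "Comp Grpd_vert \<alpha> (Ide Grpd_vert (Dom Grpd_vert \<alpha>)) = \<alpha>"
    "Comp Grpd_vert (Ide Grpd_vert (Cod Grpd_vert \<alpha>)) \<alpha> = \<alpha>"
    using \<alpha> by (auto simp: Arr_Grpd_vert arrow.expand)
next
  fix \<alpha> \<beta> \<gamma> :: "('a, 'b) nat_trans_arrow"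
  assume *: "\<alpha> \<in> Arr Grpd_vert" "\<beta> \<in> Arr Grpd_vert" "\<gamma> \<in> Arr Grpd_vert"
    "Cod Grpd_vert \<alpha> = Dom Grpd_vert \<beta>" "Cod Grpd_vert \<beta> = Dom Grpd_vert \<gamma>"
  let ?C = "src (src \<alpha>)" and ?D = "tgt (src \<alpha>)"
  interpret D: category ?D
    using * by (simp add: Arr_Grpd_vert Arr_Grpd1 groupoid_category)
  have n: "body \<alpha> \<in> nat_trans ?C ?D (body (src \<alpha>)) (body (tgt \<alpha>))"
    "body \<beta> \<in> nat_trans ?C ?D (body (tgt \<alpha>)) (body (tgt \<beta>))"
    "body \<gamma> \<in> nat_trans ?C ?D (body (tgt \<beta>)) (body (tgt \<gamma>))"
    using * by (auto simp: Arr_Grpd_vert)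
  have "vcomp ?C ?D (body \<gamma>) (vcomp ?C ?D (body \<beta>) (body \<alpha>)) =
      vcomp ?C ?D (vcomp ?C ?D (body \<gamma>) (body \<beta>)) (body \<alpha>)"
    unfolding vcomp_def using nat_transD(1-3)[OF n(1)] nat_transD(1-3)[OF n(2)] nat_transD(1-3)[OF n(3)]
    by (auto simp: D.Comp_assoc)
  then show "Comp Grpd_vert \<gamma> (Comp Grpd_vert \<beta> \<alpha>) = Comp Grpd_vert (Comp Grpd_vert \<gamma> \<beta>) \<alpha>"
    using * by (auto simp: Arr_Grpd_vert)
next
  fix \<alpha> \<beta> :: "('a, 'b) nat_trans_arrow"
  assume *: "\<alpha> \<in> Arr Grpd_vert" "\<beta> \<in> Arr Grpd_vert" "Cod Grpd_vert \<alpha> = Dom Grpd_vert \<beta>"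
  then show "Comp Grpd_vert \<beta> \<alpha> \<in> Arr Grpd_vert"
    using vcomp_in[of "body (src \<alpha>)" "src (src \<alpha>)" "tgt (src \<alpha>)" "body (tgt \<alpha>)" "body (tgt \<beta>)"]
    by (auto simp: Arr_Grpd_vert Arr_Grpd1)
qed (auto simp: Arr_Grpd_vert Arr_Grpd1 id_trans_in)

lemma category_Grpd_horz: "category Grpd_horz"
proof
  fix \<alpha> :: "('a, 'b) nat_trans_arrow"
  assume \<alpha>: "\<alpha> \<in> Arr Grpd_horz"
  let ?C = "src (src \<alpha>)" and ?D = "tgt (src \<alpha>)"
  have f: "body (src \<alpha>) \<in> functors ?C ?D" "body (tgt \<alpha>) \<in> functors ?C ?D"
    using \<alpha> by (auto simp: Arr_Grpd_vert Arr_Grpd1)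
  interpret F: cat_functor ?C ?D "fst (body (src \<alpha>))" "snd (body (src \<alpha>))"
    using f functorsD by blast
  interpret F': cat_functor ?C ?D "fst (body (tgt \<alpha>))" "snd (body (tgt \<alpha>))"
    using f functorsD by blast
  have n: "body \<alpha> \<in> nat_trans ?C ?D (body (src \<alpha>)) (body (tgt \<alpha>))"
    using \<alpha> unfolding Grpd_horz_simps Arr_Grpd_vert by blast
  have "hcomp ?C ?D (id_functor ?C) (body (src \<alpha>)) (body \<alpha>) (id_trans ?C ?C (id_functor ?C)) x = body \<alpha> x"
    "hcomp ?C ?D (body (tgt \<alpha>)) (id_functor ?D) (id_trans ?D ?D (id_functor ?D)) (body \<alpha>) x = body \<alpha> x" for x
    using nat_transD(1-3)[OF n, of x] nat_transD(5)[OF n] F.target.Comp_Ide[of "body \<alpha> x"] F.target.Ide_Comp[of "body \<alpha> x"]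
    by (auto simp: hcomp_def id_trans_def id_functor_def extensional_def restrict_def F.Ide_map
        F.Ob_map F'.Ob_map)
  then have "hcomp ?C ?D (id_functor ?C) (body (src \<alpha>)) (body \<alpha>) (id_trans ?C ?C (id_functor ?C)) = body \<alpha>"
    "hcomp ?C ?D (body (tgt \<alpha>)) (id_functor ?D) (id_trans ?D ?D (id_functor ?D)) (body \<alpha>) = body \<alpha>"
    by auto
  then show "Comp Grpd_horz \<alpha> (Ide Grpd_horz (Dom Grpd_horz \<alpha>)) = \<alpha>"
    "Comp Grpd_horz (Ide Grpd_horz (Cod Grpd_horz \<alpha>)) \<alpha> = \<alpha>"
    using \<alpha> comp_functor_id[OF f(1)] comp_functor_id[OF f(2)]
    by (auto simp: Arr_Grpd_vert arrow.expand)
next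
  fix \<alpha> \<beta> \<gamma> :: "('a, 'b) nat_trans_arrow"
  assume *: "\<alpha> \<in> Arr Grpd_horz" "\<beta> \<in> Arr Grpd_horz" "\<gamma> \<in> Arr Grpd_horz"
    "Cod Grpd_horz \<alpha> = Dom Grpd_horz \<beta>" "Cod Grpd_horz \<beta> = Dom Grpd_horz \<gamma>"
  let ?B = "src (src \<alpha>)" and ?C = "tgt (src \<alpha>)" and ?D = "tgt (src \<beta>)" and ?E = "tgt (src \<gamma>)"
  have f: "body (src \<alpha>) \<in> functors ?B ?C" "body (tgt \<alpha>) \<in> functors ?B ?C"
    "body (src \<beta>) \<in> functors ?C ?D" "body (tgt \<beta>) \<in> functors ?C ?D"
    "body (src \<gamma>) \<in> functors ?D ?E" "body (tgt \<gamma>) \<in> functors ?D ?E"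
    using * by (auto simp: Arr_Grpd_vert Arr_Grpd1)
  interpret F': cat_functor ?B ?C "fst (body (tgt \<alpha>))" "snd (body (tgt \<alpha>))" using f functorsD by blast
  interpret G: cat_functor ?C ?D "fst (body (src \<beta>))" "snd (body (src \<beta>))" using f functorsD by blast
  interpret G': cat_functor ?C ?D "fst (body (tgt \<beta>))" "snd (body (tgt \<beta>))" using f functorsD by blast
  interpret H: cat_functor ?D ?E "fst (body (src \<gamma>))" "snd (body (src \<gamma>))" using f functorsD by blast
  have n: "body \<alpha> \<in> nat_trans ?B ?C (body (src \<alpha>)) (body (tgt \<alpha>))"
    "body \<beta> \<in> nat_trans ?C ?D (body (src \<beta>)) (body (tgt \<beta>))"
    "body \<gamma> \<in> nat_trans ?D ?E (body (src \<gamma>)) (body (tgt \<gamma>))"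
    using * by (auto simp: Arr_Grpd_vert)
  note s = nat_transD(1-3)[OF n(1)] nat_transD(1-3)[OF n(2)] nat_transD(1-3)[OF n(3)]
    F'.Ob_map G.Ob_map G'.Ob_map G.Arr_map G.Dom_map G.Cod_map H.Arr_map H.Dom_map H.Cod_map H.Ob_map
  have "hcomp ?B ?E (comp_functor ?B (body (tgt \<beta>)) (body (tgt \<alpha>))) (body (src \<gamma>)) (body \<gamma>)
        (hcomp ?B ?D (body (tgt \<alpha>)) (body (src \<beta>)) (body \<beta>) (body \<alpha>)) =
      hcomp ?B ?E (body (tgt \<alpha>)) (comp_functor ?C (body (src \<gamma>)) (body (src \<beta>)))
        (hcomp ?C ?E (body (tgt \<beta>)) (body (src \<gamma>)) (body \<gamma>) (body \<beta>)) (body \<alpha>)"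
    unfolding hcomp_def
    by (rule restrict_ext) (simp add: fst_comp_functor snd_comp_functor s H.Comp_map H.target.Comp_assoc)
  then show "Comp Grpd_horz \<gamma> (Comp Grpd_horz \<beta> \<alpha>) = Comp Grpd_horz (Comp Grpd_horz \<gamma> \<beta>) \<alpha>"
    using * f by (auto simp: Arr_Grpd_vert comp_functor_assoc)
next
  fix \<alpha> \<beta> :: "('a, 'b) nat_trans_arrow"
  assume *: "\<alpha> \<in> Arr Grpd_horz" "\<beta> \<in> Arr Grpd_horz" "Cod Grpd_horz \<alpha> = Dom Grpd_horz \<beta>"
  then show "Comp Grpd_horz \<beta> \<alpha> \<in> Arr Grpd_horz"
    using hcomp_in[of "body (src \<alpha>)" "src (src \<alpha>)" "tgt (src \<alpha>)" "body (tgt \<alpha>)"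
        "body (src \<beta>)" "tgt (src \<beta>)" "body (tgt \<beta>)"]
    by (auto simp: Arr_Grpd_vert Arr_Grpd1 intro: comp_functor_in)
qed (auto simp: Arr_Grpd_vert Arr_Grpd1 id_functor_in groupoid_category id_trans_in)

lemma two_category_Grpd:
  "two_category (Grpd :: (('a, 'b) cat, ('a, 'b) functor_arrow, ('a, 'b) nat_trans_arrow) two_cat)"
proof -
  have interchange: "Comp Grpd_horz (Comp Grpd_vert \<beta>' \<beta>) (Comp Grpd_vert \<alpha>' \<alpha>) =
      Comp Grpd_vert (Comp Grpd_horz \<beta>' \<alpha>') (Comp Grpd_horz \<beta> \<alpha>)"
    if *: "\<alpha> \<in> Arr Grpd_vert" "\<alpha>' \<in> Arr Grpd_vert" "\<beta> \<in> Arr Grpd_vert" "\<beta>' \<in> Arr Grpd_vert"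
      "tgt \<alpha> = src \<alpha>'" "tgt \<beta> = src \<beta>'" "tgt (src \<alpha>) = src (src \<beta>)"
    for \<alpha> \<alpha>' \<beta> \<beta>' :: "('a, 'b) nat_trans_arrow"
  proof -
    let ?C = "src (src \<alpha>)" and ?D = "tgt (src \<alpha>)" and ?E = "tgt (src \<beta>)"
    let ?F = "body (src \<alpha>)" and ?F' = "body (tgt \<alpha>)" and ?F'' = "body (tgt \<alpha>')"
    let ?G = "body (src \<beta>)" and ?G' = "body (tgt \<beta>)" and ?G'' = "body (tgt \<beta>')"
    have f: "?F' \<in> functors ?C ?D" "?F'' \<in> functors ?C ?D" "?G \<in> functors ?D ?E" "?G' \<in> functors ?D ?E"
      using * by (auto simp: Arr_Grpd_vert Arr_Grpd1)
    interpret F': cat_functor ?C ?D "fst ?F'" "snd ?F'" using f functorsD by blast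
    interpret F'': cat_functor ?C ?D "fst ?F''" "snd ?F''" using f functorsD by blast
    interpret G: cat_functor ?D ?E "fst ?G" "snd ?G" using f functorsD by blast
    interpret G': cat_functor ?D ?E "fst ?G'" "snd ?G'" using f functorsD by blast
    have n: "body \<alpha> \<in> nat_trans ?C ?D ?F ?F'" "body \<alpha>' \<in> nat_trans ?C ?D ?F' ?F''"
      "body \<beta> \<in> nat_trans ?D ?E ?G ?G'" "body \<beta>' \<in> nat_trans ?D ?E ?G' ?G''"
      using * by (auto simp: Arr_Grpd_vert)
    note s = nat_transD(1-3)[OF n(1)] nat_transD(1-3)[OF n(2)] nat_transD(1-3)[OF n(3)]
      nat_transD(1-3)[OF n(4)] F'.Ob_map F''.Ob_map G.Arr_map G.Dom_map G.Cod_map G'.Arr_map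
      G'.Dom_map G'.Cod_map G.target.Comp_in G.target.Dom_Comp G.target.Cod_Comp
    have "hcomp ?C ?E ?F'' ?G (vcomp ?D ?E (body \<beta>') (body \<beta>)) (vcomp ?C ?D (body \<alpha>') (body \<alpha>)) =
        vcomp ?C ?E (hcomp ?C ?E ?F'' ?G' (body \<beta>') (body \<alpha>')) (hcomp ?C ?E ?F' ?G (body \<beta>) (body \<alpha>))"
      unfolding hcomp_def vcomp_def
    proof (rule restrict_ext)
      fix x assume x: "x \<in> Ob ?C"
      let ?a = "body \<alpha> x" and ?a' = "body \<alpha>' x"
      let ?b = "body \<beta> (fst ?F'' x)" and ?b' = "body \<beta>' (fst ?F'' x)"
      have "Comp ?E (Comp ?E ?b' ?b) (snd ?G (Comp ?D ?a' ?a)) =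
          Comp ?E ?b' (Comp ?E (Comp ?E ?b (snd ?G ?a')) (snd ?G ?a))"
        using x by (simp add: s G.Comp_map G.target.Comp_assoc[symmetric])
      \<comment> \<open>The heart of interchange: naturality of \<open>\<beta>\<close> at the
        component of \<open>\<alpha>'\<close> exchanges the two middle factors.\<close>
      also have "Comp ?E ?b (snd ?G ?a') = Comp ?E (snd ?G' ?a') (body \<beta> (fst ?F' x))"
        using x nat_transD(4)[OF n(3), of ?a'] by (simp add: s)
      also have "Comp ?E ?b' (Comp ?E \<dots> (snd ?G ?a)) =
          Comp ?E (Comp ?E ?b' (snd ?G' ?a')) (Comp ?E (body \<beta> (fst ?F' x)) (snd ?G ?a))"
        using x by (simp add: s G.target.Comp_assoc[symmetric])
      finally show "Comp ?E ((\<lambda>x\<in>Ob ?D. Comp ?E (body \<beta>' x) (body \<beta> x)) (fst ?F'' x))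
          (snd ?G ((\<lambda>x\<in>Ob ?C. Comp ?D (body \<alpha>' x) (body \<alpha> x)) x)) =
        Comp ?E ((\<lambda>x\<in>Ob ?C. Comp ?E (body \<beta>' (fst ?F'' x)) (snd ?G' (body \<alpha>' x))) x)
          ((\<lambda>x\<in>Ob ?C. Comp ?E (body \<beta> (fst ?F' x)) (snd ?G (body \<alpha> x))) x)"
        using x by (simp add: F''.Ob_map)
    qed
    then show ?thesis
      using * by (auto simp: Arr_Grpd_vert)
  qed
  have hcomp_Ide: "hcomp (src f) (tgt g) (body f) (body g) (id_trans (src g) (tgt g) (body g))
      (id_trans (src f) (tgt f) (body f)) = id_trans (src f) (tgt g) (comp_functor (src f) (body g) (body f))"
    if *: "f \<in> Arr Grpd1" "g \<in> Arr Grpd1" "tgt f = src g" for f g :: "('a, 'b) functor_arrow"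
  proof -
    interpret f: cat_functor "src f" "tgt f" "fst (body f)" "snd (body f)"
      using * by (auto simp: Arr_Grpd1 functorsD)
    interpret g: cat_functor "tgt f" "tgt g" "fst (body g)" "snd (body g)"
      using * by (auto simp: Arr_Grpd1 functorsD)
    have "Comp (tgt g) (Ide (tgt g) y) (Ide (tgt g) y) = Ide (tgt g) y" if "y \<in> Ob (tgt g)" for y
      using that g.target.Comp_Ide[OF g.target.Ide_in[OF that]] by (simp add: g.target.Dom_Ide)
    then show ?thesis
      unfolding hcomp_def id_trans_def *(3)[symmetric]
      by (intro restrict_ext) (simp add: fst_comp_functor f.Ob_map g.Ob_map g.Ide_map)
  qed
  show ?thesis
  proof (rule two_category.intro)
    show "category (cells1 Grpd)" "category (vert Grpd)" "category (horz Grpd)"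
      by (simp_all add: Grpd_def category_Grpd1 category_Grpd_vert category_Grpd_horz)
  next
    fix f g :: "('a, 'b) functor_arrow"
    assume "f \<in> Arr (cells1 Grpd)" "g \<in> Arr (cells1 Grpd)"
      "Cod (cells1 Grpd) f = Dom (cells1 Grpd) g"
    then show "Comp (horz Grpd) (Ide (vert Grpd) g) (Ide (vert Grpd) f) =
        Ide (vert Grpd) (Comp (cells1 Grpd) g f)"
      using hcomp_Ide[of f g] by (simp add: Grpd_def)
  next
    fix \<alpha> \<alpha>' \<beta> \<beta>' :: "('a, 'b) nat_trans_arrow"
    assume "\<alpha> \<in> Arr (vert Grpd)" "\<alpha>' \<in> Arr (vert Grpd)" "\<beta> \<in> Arr (vert Grpd)" "\<beta>' \<in> Arr (vert Grpd)"
      "Cod (vert Grpd) \<alpha> = Dom (vert Grpd) \<alpha>'" "Cod (vert Grpd) \<beta> = Dom (vert Grpd) \<beta>'"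
      "Cod (horz Grpd) \<alpha> = Dom (horz Grpd) \<beta>"
    then show "Comp (horz Grpd) (Comp (vert Grpd) \<beta>' \<beta>) (Comp (vert Grpd) \<alpha>' \<alpha>) =
        Comp (vert Grpd) (Comp (horz Grpd) \<beta>' \<alpha>') (Comp (horz Grpd) \<beta> \<alpha>)"
      using interchange[of \<alpha> \<alpha>' \<beta> \<beta>'] by (simp add: Grpd_def)
  qed (simp_all add: Grpd_def Arr_Grpd_vert)
qed

text \<open>Into a groupoid every natural transformation is invertible.\<close>

lemma nat_iso_rel_iff:
  assumes "groupoid D"
  shows "(F, G) \<in> nat_iso_rel C D \<longleftrightarrow> F \<in> functors C D \<and> G \<in> functors C D \<and> nat_trans C D F G \<noteq> {}"
  using groupoid.iso[OF assms] by (fastforce simp: nat_iso_rel_def dest: nat_transD(1))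

lemma nat_trans_inverse:
  assumes "groupoid D" "F \<in> functors C D" "G \<in> functors C D" "\<eta> \<in> nat_trans C D F G"
  shows "nat_trans C D G F \<noteq> {}"
proof -
  interpret D: groupoid D by fact
  interpret F: cat_functor C D "fst F" "snd F" using assms functorsD by blast
  interpret G: cat_functor C D "fst G" "snd G" using assms functorsD by blast
  note \<eta>D = nat_transD[OF assms(4)]
  have "\<exists>b. b \<in> Arr D \<and> Dom D b = fst G x \<and> Cod D b = fst F x \<and>
      Comp D b (\<eta> x) = Ide D (fst F x) \<and> Comp D (\<eta> x) b = Ide D (fst G x)" if "x \<in> Ob C" for x
    using D.iso[OF \<eta>D(1)[OF that]] \<eta>D(2,3)[OF that] by (auto simp: cat_iso_def)
  then obtain \<theta> where \<theta>: "\<theta> x \<in> Arr D" "Dom D (\<theta> x) = fst G x" "Cod D (\<theta> x) = fst F x"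
      "Comp D (\<theta> x) (\<eta> x) = Ide D (fst F x)" "Comp D (\<eta> x) (\<theta> x) = Ide D (fst G x)"
    if "x \<in> Ob C" for x
    by metis
  have "restrict \<theta> (Ob C) \<in> nat_trans C D G F"
  proof (rule nat_transI)
    fix a assume a: "a \<in> Arr C"
    let ?x = "Dom C a" and ?y = "Cod C a"
    have xy: "?x \<in> Ob C" "?y \<in> Ob C"
      using a F.source.Dom_in F.source.Cod_in by auto
    note s = a xy \<eta>D(1-3) \<theta>(1-3) F.Arr_map F.Dom_map F.Cod_map G.Arr_map G.Dom_map G.Cod_map
      D.Comp_in D.Dom_Comp D.Cod_Comp
    \<comment> \<open>The identity at \<open>G x\<close> is inserted as \<open>\<eta>\<close> after
      \<open>\<theta>\<close>, which brings \<open>\<eta>\<close> next to \<open>G a\<close>, where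
      its naturality applies.\<close>
    have "Comp D (\<theta> ?y) (snd G a) = Comp D (\<theta> ?y) (Comp D (snd G a) (Comp D (\<eta> ?x) (\<theta> ?x)))"
      using D.Comp_Ide[OF G.Arr_map[OF a]] a xy by (simp add: \<theta>(5) G.Dom_map)
    also have "\<dots> = Comp D (\<theta> ?y) (Comp D (Comp D (snd G a) (\<eta> ?x)) (\<theta> ?x))"
      by (subst D.Comp_assoc[of "\<theta> ?x"]) (simp_all add: s)
    also have "Comp D (snd G a) (\<eta> ?x) = Comp D (\<eta> ?y) (snd F a)"
      using \<eta>D(4)[OF a] by simp
    also have "Comp D (\<theta> ?y) (Comp D \<dots> (\<theta> ?x)) =
        Comp D (Comp D (\<theta> ?y) (\<eta> ?y)) (Comp D (snd F a) (\<theta> ?x))"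
      by (simp add: s D.Comp_assoc)
    also have "\<dots> = Comp D (snd F a) (\<theta> ?x)"
      using D.Ide_Comp[of "Comp D (snd F a) (\<theta> ?x)"] by (simp add: s \<theta>(4))
    finally show "Comp D (restrict \<theta> (Ob C) ?y) (snd G a) = Comp D (snd F a) (restrict \<theta> (Ob C) ?x)"
      using xy by simp
  qed (auto simp: \<theta>)
  then show ?thesis by blast
qed

section \<open>Groupoids and functors up to natural isomorphism\<close>

lemma hGrpd_quot: "hGrpd = quot_cat {C. groupoid C} functors nat_iso_rel id_functor
    (\<lambda>C F G. comp_functor C G F)"
  by (simp add: hGrpd_def quot_cat_def)

text \<open>Congruence is horizontal composition of natural transformations, transitivity is
  vertical composition and symmetry is the pointwise inverse. The unit and associativity laws are
  equalities of functors and enter through reflexivity.\<close>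

lemma quotient_hGrpd: "quotient_data {C. groupoid C} functors nat_iso_rel id_functor
    (\<lambda>C F G. comp_functor C G F)"
proof
  fix C D E F F' G G'
  assume C: "C \<in> {C. groupoid C}" and D: "D \<in> {C. groupoid C}" and E: "E \<in> {C. groupoid C}"
    and F: "F \<in> functors C D" and G: "G \<in> functors D E"
  show "(comp_functor C G F, comp_functor C G' F') \<in> nat_iso_rel C E"
    if "(F, F') \<in> nat_iso_rel C D" "(G, G') \<in> nat_iso_rel D E"
  proof -
    have f: "F' \<in> functors C D" "G' \<in> functors D E"
      and "nat_trans C D F F' \<noteq> {}" "nat_trans D E G G' \<noteq> {}"
      using that D E by (simp_all add: nat_iso_rel_iff)
    then obtain \<eta> \<theta> where "\<eta> \<in> nat_trans C D F F'" "\<theta> \<in> nat_trans D E G G'"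
      by blast
    with f have "hcomp C E F' G \<theta> \<eta> \<in> nat_trans C E (comp_functor C G F) (comp_functor C G' F')"
      using hcomp_in[OF F _ G] by blast
    then show ?thesis
      using E comp_functor_in[OF F G] comp_functor_in[OF f] by (auto simp: nat_iso_rel_iff)
  qed
  show "comp_functor C G F \<in> functors C E"
    using F G by (rule comp_functor_in)
next
  fix C D F G H
  assume CD: "C \<in> {C. groupoid C}" "D \<in> {C. groupoid C}"
  show "(F, F) \<in> nat_iso_rel C D" if "F \<in> functors C D" for F
    using that CD id_trans_in[OF that] by (auto simp: nat_iso_rel_iff)
  then show "(comp_functor C F (id_functor C), F) \<in> nat_iso_rel C D"
    "(comp_functor C (id_functor D) F, F) \<in> nat_iso_rel C D" if "F \<in> functors C D"
    using that by (simp_all add: comp_functor_id[OF that])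
  show "G \<in> functors C D" if "(F, G) \<in> nat_iso_rel C D"
    using that by (simp add: nat_iso_rel_def)
  show "(G, F) \<in> nat_iso_rel C D" if "(F, G) \<in> nat_iso_rel C D"
    using that CD nat_trans_inverse[of D F C G] by (auto simp: nat_iso_rel_iff)
  show "(F, H) \<in> nat_iso_rel C D" if "(F, G) \<in> nat_iso_rel C D" "(G, H) \<in> nat_iso_rel C D"
  proof -
    have f: "F \<in> functors C D" "G \<in> functors C D" "H \<in> functors C D"
      and "nat_trans C D F G \<noteq> {}" "nat_trans C D G H \<noteq> {}"
      using that CD by (simp_all add: nat_iso_rel_iff)
    then obtain \<eta> \<theta> where "\<eta> \<in> nat_trans C D F G" "\<theta> \<in> nat_trans C D G H"
      by blast
    with f have "vcomp C D \<theta> \<eta> \<in> nat_trans C D F H"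
      by (rule vcomp_in)
    then show ?thesis
      using CD f by (auto simp: nat_iso_rel_iff)
  qed
next
  fix B C D E F G H
  assume *: "B \<in> {C. groupoid C}" "E \<in> {C. groupoid C}"
    "F \<in> functors B C" "G \<in> functors C D" "H \<in> functors D E"
  have "comp_functor B H (comp_functor B G F) \<in> functors B E"
    using * by (blast intro: comp_functor_in)
  from this id_trans_in[OF this] show "(comp_functor B H (comp_functor B G F), comp_functor B (comp_functor C H G) F) \<in> nat_iso_rel B E"
    using * by (auto simp: nat_iso_rel_iff comp_functor_assoc)
qed (simp add: id_functor_in groupoid_category)

section \<open>Walks and their elementary moves\<close>

text \<open>The adjacency \<open>E\<close> is a parameter because the same lemmas serve twice: for
  walks of vertices in a graph, and for homotopies seen as walks of morphisms.\<close>

definition is_walk :: "('a \<Rightarrow> 'a \<Rightarrow> bool) \<Rightarrow> 'a \<Rightarrow> 'a \<Rightarrow> 'a list \<Rightarrow> bool" where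
  "is_walk E x y \<alpha> \<longleftrightarrow> \<alpha> \<noteq> [] \<and> hd \<alpha> = x \<and> last \<alpha> = y \<and> successively E \<alpha>"

text \<open>
  Relating the walk \<open>zip \<alpha> \<beta>\<close> of pairs by \<open>cross E\<close> says that \<open>\<alpha>\<close> and \<open>\<beta>\<close> are the two ends of a
  homotopy of length 1.
\<close>

definition step :: "('a \<times> 'a \<Rightarrow> 'a \<times> 'a \<Rightarrow> bool) \<Rightarrow> 'a list \<Rightarrow> 'a list \<Rightarrow> bool" where
  "step P \<alpha> \<beta> \<longleftrightarrow> length \<alpha> = length \<beta> \<and> \<alpha> \<noteq> [] \<and> hd \<alpha> = hd \<beta> \<and> last \<alpha> = last \<beta> \<and>
     successively P (zip \<alpha> \<beta>)"

definition cross :: "('a \<Rightarrow> 'a \<Rightarrow> bool) \<Rightarrow> 'a \<times> 'a \<Rightarrow> 'a \<times> 'a \<Rightarrow> bool" where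
  "cross E p q \<longleftrightarrow> E (fst p) (fst q) \<and> E (fst p) (snd q) \<and> E (snd p) (fst q) \<and> E (snd p) (snd q)"

lemma successively_glue:
  assumes "successively P \<alpha>" "successively P \<beta>" "\<alpha> \<noteq> []" "last \<alpha> = hd \<beta>"
  shows "successively P (\<alpha> @ tl \<beta>)"
  using assms by (cases \<beta>) (auto simp: successively_append_iff successively_Cons)

lemma last_glue: "\<alpha> \<noteq> [] \<Longrightarrow> \<beta> \<noteq> [] \<Longrightarrow> last \<alpha> = hd \<beta> \<Longrightarrow> last (\<alpha> @ tl \<beta>) = last \<beta>"
  by (cases \<beta>) (auto simp: last_append)

lemma glue_eq_butlast: "\<alpha> \<noteq> [] \<Longrightarrow> \<beta> \<noteq> [] \<Longrightarrow> last \<alpha> = hd \<beta> \<Longrightarrow> \<alpha> @ tl \<beta> = butlast \<alpha> @ \<beta>"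
  by (metis append.assoc append_Cons append_Nil append_butlast_last_id list.collapse)

lemma glue_assoc: "\<beta> \<noteq> [] \<Longrightarrow> (\<alpha> @ tl \<beta>) @ tl \<gamma> = \<alpha> @ tl (\<beta> @ tl \<gamma>)"
  by (simp add: tl_append2)

lemma is_walk_glue:
  "is_walk E x y \<alpha> \<Longrightarrow> is_walk E y z \<beta> \<Longrightarrow> is_walk E x z (\<alpha> @ tl \<beta>)"
  by (auto simp: is_walk_def successively_glue last_glue)

lemma is_walk_rev:
  assumes "is_walk E x y \<alpha>" "symp E"
  shows "is_walk E y x (rev \<alpha>)"
  using assms by (auto simp: is_walk_def hd_rev last_rev sympD elim: successively_mono)

lemma is_walk_map:
  assumes "is_walk E x y \<alpha>" "\<And>a b. E a b \<Longrightarrow> E' (f a) (f b)"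
  shows "is_walk E' (f x) (f y) (map f \<alpha>)"
  using assms by (auto simp: is_walk_def hd_map last_map successively_map elim: successively_mono)

text \<open>Zipping commutes with concatenation, since \<open>\<alpha>\<close> and
  \<open>\<alpha>'\<close> have equal length. A step is a walk of pairs, and the two walks of pairs
  meet because the ends of the components agree.\<close>

lemma step_glue:
  assumes "step P \<alpha> \<alpha>'" "step P \<beta> \<beta>'" "last \<alpha> = hd \<beta>"
  shows "step P (\<alpha> @ tl \<beta>) (\<alpha>' @ tl \<beta>')"
proof -
  have "zip (\<alpha> @ tl \<beta>) (\<alpha>' @ tl \<beta>') = zip \<alpha> \<alpha>' @ tl (zip \<beta> \<beta>')"
    using assms by (cases \<beta>; cases \<beta>') (auto simp: step_def)
  moreover have "last (zip \<alpha> \<alpha>') = hd (zip \<beta> \<beta>')"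
    using assms last_zip[of \<alpha> \<alpha>'] by (cases \<beta>; cases \<beta>') (force simp: step_def)+
  moreover have "zip \<alpha> \<alpha>' \<noteq> []"
    using assms by (auto simp: step_def)
  ultimately have "successively P (zip (\<alpha> @ tl \<beta>) (\<alpha>' @ tl \<beta>'))"
    using assms by (auto simp: step_def successively_glue)
  moreover have "\<beta>' \<noteq> []" "\<alpha>' \<noteq> []" "last \<alpha>' = hd \<beta>'"
    using assms by (auto simp: step_def)
  ultimately show ?thesis
    using assms by (auto simp: step_def last_glue)
qed

lemma step_map:
  assumes "step P \<alpha> \<beta>" "\<And>p q. P p q \<Longrightarrow> P' (map_prod f f p) (map_prod f f q)"
  shows "step P' (map f \<alpha>) (map f \<beta>)"
proof -
  have "zip (map f \<alpha>) (map f \<beta>) = map (map_prod f f) (zip \<alpha> \<beta>)"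
    by (simp add: zip_map1 zip_map2 map_prod_def case_prod_beta comp_def)
  moreover have "\<beta> \<noteq> []"
    using assms by (auto simp: step_def)
  ultimately show ?thesis
    using assms by (auto simp: step_def hd_map last_map successively_map elim: successively_mono)
qed

lemma step_sym:
  assumes "step P \<alpha> \<beta>" "\<And>p q. P p q \<Longrightarrow> P (prod.swap p) (prod.swap q)"
  shows "step P \<beta> \<alpha>"
proof -
  have "zip \<beta> \<alpha> = map prod.swap (zip \<alpha> \<beta>)"
    using zip_commute[of \<beta> \<alpha>] by (simp add: prod.swap_def case_prod_beta)
  then show ?thesis
    using assms by (auto simp: step_def successively_map elim: successively_mono)
qed

lemma step_refl: "step P \<alpha> \<alpha> \<longleftrightarrow> \<alpha> \<noteq> [] \<and> successively (\<lambda>a b. P (a, a) (b, b)) \<alpha>"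
  by (auto simp: step_def zip_same_conv_map successively_map)

lemma step_cross_refl: "is_walk E x y \<alpha> \<Longrightarrow> step (cross E) \<alpha> \<alpha>"
  by (simp add: step_refl cross_def is_walk_def)

lemma step_nth: "step P \<alpha> \<beta> \<longleftrightarrow> length \<alpha> = length \<beta> \<and> \<alpha> \<noteq> [] \<and> hd \<alpha> = hd \<beta> \<and> last \<alpha> = last \<beta> \<and>
    (\<forall>i. Suc i < length \<alpha> \<longrightarrow> P (\<alpha> ! i, \<beta> ! i) (\<alpha> ! Suc i, \<beta> ! Suc i))"
  by (auto simp: step_def successively_conv_nth)

text \<open>A generator may go to a chain of generators: a homotopy of walks of length
  \<open>m\<close> turns into \<open>m\<close> elementary moves.\<close>

lemma equivclp_map:
  assumes "equivclp R x y" "\<And>x y. R x y \<Longrightarrow> equivclp S (f x) (f y)"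
  shows "equivclp S (f x) (f y)"
  using assms(1)
proof (induction rule: equivclp_induct)
  case (step y z)
  then have "equivclp S (f y) (f z)"
    by (metis assms(2) equivclp_sym)
  with step.IH show ?case
    by (rule equivclp_trans)
qed simp

text \<open>The pattern form replaces index arithmetic, so that closure of prunes under
  concatenation and under maps can be read off.\<close>

lemma prune_iff: "prune \<alpha> \<beta> \<longleftrightarrow> (\<exists>p a b q. \<alpha> = p @ a # b # a # q \<and> \<beta> = p @ a # q)"
proof
  assume "prune \<alpha> \<beta>"
  then obtain i where i: "i + 2 < length \<alpha>" "\<alpha> ! i = \<alpha> ! (i + 2)" "\<beta> = take i \<alpha> @ drop (i + 2) \<alpha>"
    by (auto simp: prune_def)
  have "drop i \<alpha> = \<alpha> ! i # \<alpha> ! (i + 1) # drop (i + 2) \<alpha>"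
    "drop (i + 2) \<alpha> = \<alpha> ! i # drop (i + 3) \<alpha>"
    using i Cons_nth_drop_Suc[of i \<alpha>] Cons_nth_drop_Suc[of "i + 1" \<alpha>] Cons_nth_drop_Suc[of "i + 2" \<alpha>]
    by (simp_all add: numeral_3_eq_3)
  then show "\<exists>p a b q. \<alpha> = p @ a # b # a # q \<and> \<beta> = p @ a # q"
    using i(3) append_take_drop_id[of i \<alpha>] by metis
next
  assume "\<exists>p a b q. \<alpha> = p @ a # b # a # q \<and> \<beta> = p @ a # q"
  then obtain p a b q where "\<alpha> = p @ a # b # a # q" "\<beta> = p @ a # q" by blast
  then show "prune \<alpha> \<beta>"
    by (auto simp: prune_def nth_append intro!: exI[of _ "length p"])
qed

lemma pruneI: "prune (p @ a # b # a # q) (p @ a # q)"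
  unfolding prune_iff by (intro exI[of _ p] exI[of _ a] exI[of _ b] exI[of _ q] conjI refl)

text \<open>If \<open>p\<close> is empty, \<open>tl\<close> removes the first entry of the pattern
  \<open>a # b # a\<close>. The shared vertex is therefore dropped from the end of
  \<open>\<gamma>\<close> instead, which leaves the pattern intact.\<close>

lemma prune_glue_left:
  assumes "prune \<alpha> \<beta>" "\<gamma> \<noteq> []" "last \<gamma> = hd \<alpha>"
  shows "prune (\<gamma> @ tl \<alpha>) (\<gamma> @ tl \<beta>)"
proof -
  obtain p a b q where *: "\<alpha> = p @ a # b # a # q" "\<beta> = p @ a # q"
    using assms(1) unfolding prune_iff by blast
  have ne: "\<alpha> \<noteq> []" "\<beta> \<noteq> []" and hd: "hd \<alpha> = hd \<beta>"
    by (simp_all add: * hd_append)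
  have "\<gamma> @ tl \<alpha> = butlast \<gamma> @ \<alpha>"
    using assms(2) ne(1) assms(3) by (rule glue_eq_butlast)
  moreover have "\<gamma> @ tl \<beta> = butlast \<gamma> @ \<beta>"
    using assms(2) ne(2) assms(3)[unfolded hd] by (rule glue_eq_butlast)
  ultimately have "\<gamma> @ tl \<alpha> = (butlast \<gamma> @ p) @ a # b # a # q" "\<gamma> @ tl \<beta> = (butlast \<gamma> @ p) @ a # q"
    unfolding * by (simp_all only: append_assoc)
  then show ?thesis
    by (simp only: pruneI)
qed

lemma prune_glue_right:
  assumes "prune \<alpha> \<beta>"
  shows "prune (\<alpha> @ tl \<gamma>) (\<beta> @ tl \<gamma>)"
proof -
  obtain p a b q where "\<alpha> = p @ a # b # a # q" "\<beta> = p @ a # q"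
    using assms unfolding prune_iff by blast
  then have "\<alpha> @ tl \<gamma> = p @ a # b # a # (q @ tl \<gamma>)" "\<beta> @ tl \<gamma> = p @ a # (q @ tl \<gamma>)"
    by simp_all
  then show ?thesis
    by (simp only: pruneI)
qed

lemma prune_map:
  assumes "prune \<alpha> \<beta>"
  shows "prune (map f \<alpha>) (map f \<beta>)"
proof -
  obtain p a b q where "\<alpha> = p @ a # b # a # q" "\<beta> = p @ a # q"
    using assms unfolding prune_iff by blast
  then have "map f \<alpha> = map f p @ f a # f b # f a # map f q" "map f \<beta> = map f p @ f a # map f q"
    by simp_all
  then show ?thesis
    by (simp only: pruneI)
qed

section \<open>Walks in a graph and the moves that generate their equivalence\<close>

abbreviation adj :: "'a graph \<Rightarrow> 'a \<Rightarrow> 'a \<Rightarrow> bool" where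
  "adj G v w \<equiv> (v, w) \<in> edges G"

lemma symp_adj: "is_graph G \<Longrightarrow> symp (adj G)"
  unfolding is_graph_def by (blast intro: sympI dest: symD)

lemma adj_sym: "is_graph G \<Longrightarrow> adj G v w \<Longrightarrow> adj G w v"
  unfolding is_graph_def by (blast dest: symD)

lemma adj_commute: "is_graph G \<Longrightarrow> adj G v w \<longleftrightarrow> adj G w v"
  unfolding is_graph_def by (blast dest: symD)

lemma adj_verts: "is_graph G \<Longrightarrow> adj G v w \<Longrightarrow> v \<in> verts G \<and> w \<in> verts G"
  by (auto simp: is_graph_def)

text \<open>The vertex hypothesis is for walks of length 0. In longer walks every entry lies on an
  edge and is a vertex for that reason.\<close>

lemma walks_iff:
  assumes "is_graph G" "v \<in> verts G"
  shows "\<alpha> \<in> walks G v w \<longleftrightarrow> is_walk (adj G) v w \<alpha>"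
proof (cases "\<alpha> = []")
  case False
  then have len: "i \<le> length \<alpha> - Suc 0 \<longleftrightarrow> i < length \<alpha>" for i
    by (cases \<alpha>) auto
  have gmor: "(\<lambda>i \<in> {0..length \<alpha> - 1}. \<alpha> ! i) \<in> gmor (path_graph (length \<alpha> - 1)) G \<longleftrightarrow>
      (\<forall>i<length \<alpha>. \<alpha> ! i \<in> verts G) \<and> successively (adj G) \<alpha>" (is "?L \<longleftrightarrow> ?R")
  proof
    assume ?L
    then have "\<alpha> ! i \<in> verts G" if "i < length \<alpha>" for i
      using that by (auto simp: gmor_def path_graph_def len)
    moreover have "adj G (\<alpha> ! i) (\<alpha> ! Suc i)" if "Suc i < length \<alpha>" for i
    proof -
      have "(i, Suc i) \<in> edges (path_graph (length \<alpha> - 1))"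
        using that by (auto simp: path_graph_def)
      then have "adj G (restrict ((!) \<alpha>) {0..length \<alpha> - 1} i) (restrict ((!) \<alpha>) {0..length \<alpha> - 1} (Suc i))"
        using \<open>?L\<close> unfolding gmor_def by blast
      then show ?thesis
        using that by (auto simp: len)
    qed
    ultimately show ?R
      by (simp add: successively_conv_nth)
  next
    assume ?R
    then show ?L
      by (auto simp: gmor_def path_graph_def len successively_conv_nth adj_commute[OF assms(1)])
  qed
  have "\<alpha> ! i \<in> verts G" if "successively (adj G) \<alpha>" "hd \<alpha> = v" "i < length \<alpha>" for i
    using that assms adj_verts[OF assms(1)] False
    by (cases i) (auto simp: hd_conv_nth successively_conv_nth)
  then show ?thesis
    using False gmor by (auto simp: walks_def is_walk_def)
qed (simp add: walks_def is_walk_def)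

lemma walks_in_verts: "\<alpha> \<in> walks G v w \<Longrightarrow> v \<in> verts G \<and> w \<in> verts G"
  by (auto simp: walks_def gmor_def path_graph_def PiE_def Pi_def hd_conv_nth last_conv_nth)

lemma walks_verts:
  assumes "is_graph G" "v \<in> verts G" "is_walk (adj G) v w \<alpha>" "a \<in> set \<alpha>"
  shows "a \<in> verts G"
proof -
  have "a \<in> verts G" if "successively (adj G) \<alpha>" "hd \<alpha> \<in> verts G" "a \<in> set \<alpha>" for \<alpha>
    using that by (induction \<alpha>) (auto simp: successively_Cons dest: adj_verts[OF assms(1)])
  then show ?thesis
    using assms by (auto simp: is_walk_def)
qed

text \<open>The generators of \<open>walk_rel\<close> with homotopies cut down to length 1, so that
  only two neighbouring time levels ever have to be considered.\<close>

definition walk_move :: "'a graph \<Rightarrow> 'a \<Rightarrow> 'a \<Rightarrow> 'a list \<Rightarrow> 'a list \<Rightarrow> bool" where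
  "walk_move G v w \<alpha> \<beta> \<longleftrightarrow> \<alpha> \<in> walks G v w \<and> \<beta> \<in> walks G v w \<and> (prune \<alpha> \<beta> \<or> step (cross (adj G)) \<alpha> \<beta>)"

text \<open>The edges of \<open>path_graph n \<times>\<^sub>g Iloop 1\<close> from column
  \<open>i\<close> to column \<open>Suc i\<close> join both levels to both levels; these are the
  four adjacencies of \<open>cross\<close>. There is no edge inside a column, as the path has no
  loops.\<close>

lemma step_imp_walk_htpy:
  assumes G: "is_graph G" "v \<in> verts G" and \<alpha>: "\<alpha> \<in> walks G v w" and \<beta>: "\<beta> \<in> walks G v w"
    and s: "step (cross (adj G)) \<alpha> \<beta>"
  shows "walk_htpy G v w \<alpha> \<beta>"
proof -
  define n where "n = length \<alpha> - 1"
  have w: "is_walk (adj G) v w \<alpha>" "is_walk (adj G) v w \<beta>"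
    using walks_iff[OF G] \<alpha> \<beta> by auto
  have len: "length \<alpha> = n + 1" "length \<beta> = n + 1"
    using w s by (auto simp: is_walk_def step_def n_def Suc_diff_1)
  let ?\<Lambda> = "\<lambda>(i, j) \<in> {0..n} \<times> {0..1}. if j = (0::nat) then \<alpha> ! i else \<beta> ! i"
  have v: "\<alpha> ! i \<in> verts G" "\<beta> ! i \<in> verts G" if "i \<le> n" for i
    using that len w walks_verts[OF G] nth_mem[of i] by auto
  have e: "adj G (\<alpha> ! i) (\<alpha> ! Suc i)" "adj G (\<alpha> ! i) (\<beta> ! Suc i)" "adj G (\<beta> ! i) (\<alpha> ! Suc i)"
    "adj G (\<beta> ! i) (\<beta> ! Suc i)" if "Suc i \<le> n" for i
    using s that len by (auto simp: step_nth cross_def)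
  have "?\<Lambda> \<in> gmor (path_graph n \<times>\<^sub>g Iloop 1) G"
    using v e
    by (auto simp: adj_commute[OF G(1)] gmor_def gprod_def path_graph_def Iloop_def)
  moreover have "?\<Lambda> (0, j) = v \<and> ?\<Lambda> (n, j) = w" if "j \<le> 1" for j
    using that w len by (auto simp: is_walk_def hd_conv_nth last_conv_nth)
  ultimately show ?thesis
    unfolding walk_htpy_def using len
    by (intro exI[of _ n] exI[of _ 1] conjI bexI[of _ ?\<Lambda>]) auto
qed

text \<open>The homotopy is cut into its time slices \<open>S j\<close>. Columns \<open>i\<close>
  and \<open>Suc i\<close> are adjacent at times that differ by at most 1, so consecutive slices
  form a step.\<close>

lemma walk_htpy_imp_moves:
  assumes G: "is_graph G" "v \<in> verts G" and \<alpha>: "\<alpha> \<in> walks G v w" and h: "walk_htpy G v w \<alpha> \<beta>"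
  shows "equivclp (walk_move G v w) \<alpha> \<beta>"
proof -
  obtain n m \<Lambda> where len: "length \<alpha> = n + 1" "length \<beta> = n + 1"
    and \<Lambda>: "\<Lambda> \<in> gmor (path_graph n \<times>\<^sub>g Iloop m) G"
    and ab: "\<And>i. i \<le> n \<Longrightarrow> \<Lambda> (i, 0) = \<alpha> ! i \<and> \<Lambda> (i, m) = \<beta> ! i"
    and ends: "\<And>j. j \<le> m \<Longrightarrow> \<Lambda> (0, j) = v \<and> \<Lambda> (n, j) = w"
    using h by (auto simp: walk_htpy_def)
  define S where "S j = map (\<lambda>i. \<Lambda> (i, j)) [0..<n + 1]" for j
  have e: "adj G (\<Lambda> (i, j)) (\<Lambda> (Suc i, j'))" if "Suc i \<le> n" "j \<le> m" "j' \<le> m" "j \<le> j' + 1" "j' \<le> j + 1" for i j j'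
  proof -
    have "((i, j), (Suc i, j')) \<in> edges (path_graph n \<times>\<^sub>g Iloop m)"
      using that by (auto simp: gprod_def path_graph_def Iloop_def)
    then show ?thesis
      using \<Lambda> by (auto simp: gmor_def)
  qed
  have n: "S j \<noteq> []" "length (S j) = n + 1" "hd (S j) = \<Lambda> (0, j)" "last (S j) = \<Lambda> (n, j)"
    "i < n + 1 \<Longrightarrow> S j ! i = \<Lambda> (i, j)" for i j
    by (auto simp: S_def hd_map last_map hd_conv_nth last_conv_nth nth_append simp del: upt_Suc)
  have w: "S j \<in> walks G v w" if "j \<le> m" for j
    using that ends e[of _ j j] by (auto simp: walks_iff[OF G] is_walk_def n successively_conv_nth)
  have "step (cross (adj G)) (S j) (S (Suc j))" if "Suc j \<le> m" for j
    using that ends e by (auto simp: step_nth n cross_def)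
  then have "walk_move G v w (S j) (S (Suc j))" if "Suc j \<le> m" for j
    using that w by (auto simp: walk_move_def)
  then have "equivclp (walk_move G v w) (S 0) (S j)" if "j \<le> m" for j
    using that by (induction j) (auto intro: equivclp_into_equivclp)
  moreover have "S 0 = \<alpha>" "S m = \<beta>"
    using ab len by (auto simp: S_def intro!: nth_equalityI simp del: upt_Suc)
  ultimately show ?thesis by auto
qed

lemma walk_rel_iff:
  assumes G: "is_graph G" "v \<in> verts G"
  shows "(\<alpha>, \<beta>) \<in> walk_rel G v w \<longleftrightarrow> equivclp (walk_move G v w) \<alpha> \<beta>"
proof
  let ?R = "\<lambda>\<alpha> \<beta>. \<alpha> \<in> walks G v w \<and> \<beta> \<in> walks G v w \<and> (prune \<alpha> \<beta> \<or> walk_htpy G v w \<alpha> \<beta>)"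
  show "equivclp (walk_move G v w) \<alpha> \<beta>" if "(\<alpha>, \<beta>) \<in> walk_rel G v w"
  proof (rule equivclp_map[where f = "\<lambda>x. x"])
    show "equivclp ?R \<alpha> \<beta>"
      using that by (simp add: walk_rel_def)
    show "equivclp (walk_move G v w) x y" if "?R x y" for x y
      using that walk_htpy_imp_moves[OF G] by (auto simp: walk_move_def)
  qed
  show "(\<alpha>, \<beta>) \<in> walk_rel G v w" if "equivclp (walk_move G v w) \<alpha> \<beta>"
    unfolding walk_rel_def mem_Collect_eq case_prod_conv
    using that by (rule equivclp_map[where f = "\<lambda>x. x"])
      (auto simp: walk_move_def dest: step_imp_walk_htpy[OF G])
qed

section \<open>The fundamental groupoid\<close>

lemma walk_rel_trans: "(\<alpha>, \<beta>) \<in> walk_rel G v w \<Longrightarrow> (\<beta>, \<gamma>) \<in> walk_rel G v w \<Longrightarrow> (\<alpha>, \<gamma>) \<in> walk_rel G v w"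
  unfolding walk_rel_def mem_Collect_eq case_prod_conv by (rule equivclp_trans)

lemma walk_rel_sym: "(\<alpha>, \<beta>) \<in> walk_rel G v w \<Longrightarrow> (\<beta>, \<alpha>) \<in> walk_rel G v w"
  unfolding walk_rel_def mem_Collect_eq case_prod_conv by (rule equivclp_sym)

lemma walk_rel_refl: "(\<alpha>, \<alpha>) \<in> walk_rel G v w"
  by (simp add: walk_rel_def)

lemma walk_rel_step:
  assumes "is_graph G" "v \<in> verts G" "\<alpha> \<in> walks G v w" "\<beta> \<in> walks G v w" "step (cross (adj G)) \<alpha> \<beta>"
  shows "(\<alpha>, \<beta>) \<in> walk_rel G v w"
  using assms by (simp add: walk_rel_iff walk_move_def r_into_equivclp)

lemma walk_rel_prune:
  assumes "is_graph G" "v \<in> verts G" "\<alpha> \<in> walks G v w" "\<beta> \<in> walks G v w" "prune \<alpha> \<beta>"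
  shows "(\<alpha>, \<beta>) \<in> walk_rel G v w"
  using assms by (simp add: walk_rel_iff walk_move_def r_into_equivclp)

lemma walks_ne: "\<alpha> \<in> walks G v w \<Longrightarrow> \<alpha> \<noteq> [] \<and> hd \<alpha> = v \<and> last \<alpha> = w"
  by (simp add: walks_def)

lemma walks_glue:
  assumes "is_graph G" "\<alpha> \<in> walks G u v" "\<beta> \<in> walks G v w"
  shows "\<alpha> @ tl \<beta> \<in> walks G u w"
  using assms walks_in_verts[OF assms(2)] is_walk_glue[of "adj G" u v \<alpha> w \<beta>] by (simp add: walks_iff)

lemma walks_single: "is_graph G \<Longrightarrow> v \<in> verts G \<Longrightarrow> [v] \<in> walks G v v"
  by (simp add: walks_iff is_walk_def)

lemma walks_edge:
  assumes "is_graph G" "adj G v w"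
  shows "[v, w] \<in> walks G v w"
  using assms adj_verts[OF assms] by (simp add: walks_iff is_walk_def)

lemma walk_rel_walks:
  assumes "is_graph G" "\<alpha> \<in> walks G v w" "(\<alpha>, \<beta>) \<in> walk_rel G v w"
  shows "\<beta> \<in> walks G v w"
proof -
  have "equivclp (walk_move G v w) \<alpha> \<beta>"
    using assms(3) walk_rel_iff[OF assms(1) conjunct1[OF walks_in_verts[OF assms(2)]]] by simp
  then show ?thesis
    by (induction rule: equivclp_induct) (auto simp: walk_move_def assms(2))
qed

text \<open>One factor is changed at a time. A move in one factor is a move of the concatenation: a
  prune stays a prune, and a step is glued with the trivial step of the other factor.\<close>

lemma walk_rel_glue:
  assumes G: "is_graph G" and \<alpha>: "\<alpha> \<in> walks G u v" and \<beta>: "\<beta> \<in> walks G v w"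
    and \<alpha>': "(\<alpha>, \<alpha>') \<in> walk_rel G u v" and \<beta>': "(\<beta>, \<beta>') \<in> walk_rel G v w"
  shows "(\<alpha> @ tl \<beta>, \<alpha>' @ tl \<beta>') \<in> walk_rel G u w"
proof -
  have u: "u \<in> verts G" and v: "v \<in> verts G"
    using walks_in_verts[OF \<alpha>] by auto
  have refl: "step (cross (adj G)) \<gamma> \<gamma>" if "\<gamma> \<in> walks G x y" for \<gamma> x y
    using that walks_in_verts[OF that] by (auto simp: walks_iff[OF G] intro: step_cross_refl)
  have 1: "equivclp (walk_move G u w) (\<alpha> @ tl \<beta>) (\<alpha> @ tl \<beta>')"
  proof (rule equivclp_map[where f = "\<lambda>\<beta>. \<alpha> @ tl \<beta>" and R = "walk_move G v w"])
    show "equivclp (walk_move G v w) \<beta> \<beta>'"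
      using \<beta>' walk_rel_iff[OF G v] by blast
    fix \<gamma> \<delta> assume *: "walk_move G v w \<gamma> \<delta>"
    then have "last \<alpha> = hd \<gamma>" "\<alpha> \<noteq> []"
      using \<alpha> by (auto simp: walk_move_def walks_def)
    then have "walk_move G u w (\<alpha> @ tl \<gamma>) (\<alpha> @ tl \<delta>)"
      using * walks_glue[OF G \<alpha>, of \<gamma> w] walks_glue[OF G \<alpha>, of \<delta> w] prune_glue_left[of \<gamma> \<delta> \<alpha>]
        step_glue[OF refl[OF \<alpha>], of \<gamma> \<delta>]
      by (auto simp: walk_move_def)
    then show "equivclp (walk_move G u w) (\<alpha> @ tl \<gamma>) (\<alpha> @ tl \<delta>)"
      by (rule r_into_equivclp)
  qed
  have \<beta>'w: "\<beta>' \<in> walks G v w"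
    using walk_rel_walks[OF G \<beta> \<beta>'] .
  have 2: "equivclp (walk_move G u w) (\<alpha> @ tl \<beta>') (\<alpha>' @ tl \<beta>')"
  proof (rule equivclp_map[where f = "\<lambda>\<alpha>. \<alpha> @ tl \<beta>'" and R = "walk_move G u v"])
    show "equivclp (walk_move G u v) \<alpha> \<alpha>'"
      using \<alpha>' walk_rel_iff[OF G u] by blast
    fix \<gamma> \<delta> assume *: "walk_move G u v \<gamma> \<delta>"
    then have "last \<gamma> = hd \<beta>'"
      using \<beta>'w by (auto simp: walk_move_def walks_def)
    then have "walk_move G u w (\<gamma> @ tl \<beta>') (\<delta> @ tl \<beta>')"
      using * walks_glue[OF G _ \<beta>'w, of \<gamma> u] walks_glue[OF G _ \<beta>'w, of \<delta> u]
        prune_glue_right[of \<gamma> \<delta> \<beta>'] step_glue[OF _ refl[OF \<beta>'w], of \<gamma> \<delta>] walks_ne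
      by (auto simp: walk_move_def)
    then show "equivclp (walk_move G u w) (\<gamma> @ tl \<beta>') (\<delta> @ tl \<beta>')"
      by (rule r_into_equivclp)
  qed
  show ?thesis
    unfolding walk_rel_iff[OF G u] using 1 2 by (rule equivclp_trans)
qed

lemma walks_rev:
  assumes "is_graph G" "\<alpha> \<in> walks G v w"
  shows "rev \<alpha> \<in> walks G w v"
  using assms walks_in_verts[OF assms(2)] is_walk_rev[OF _ symp_adj, of G v w \<alpha>] by (simp add: walks_iff)

lemma walks_Cons_iff:
  assumes "is_graph G" "\<alpha> \<noteq> []"
  shows "a # \<alpha> \<in> walks G v w \<longleftrightarrow> a = v \<and> adj G v (hd \<alpha>) \<and> \<alpha> \<in> walks G (hd \<alpha>) w"
proof (cases "v \<in> verts G")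
  case True
  then show ?thesis
    using assms adj_verts[OF assms(1)] by (auto simp: walks_iff is_walk_def successively_Cons)
next
  case False
  then show ?thesis
    using adj_verts[OF assms(1), of v "hd \<alpha>"] walks_in_verts[of "a # \<alpha>" G v w] by auto
qed

text \<open>A walk followed by its reverse collapses from the middle: the part after the first edge
  contracts by induction, then the first edge and its return are pruned.\<close>

lemma walk_rel_rev:
  assumes G: "is_graph G"
  shows "\<alpha> \<in> walks G v w \<Longrightarrow> (\<alpha> @ tl (rev \<alpha>), [v]) \<in> walk_rel G v v"
proof (induction \<alpha> arbitrary: v)
  case Nil
  then show ?case by (simp add: walks_def)
next
  case (Cons a \<alpha>)
  show ?case
  proof (cases "\<alpha> = []")
    case True
    then show ?thesis
      using Cons.prems by (auto simp: walks_def walk_rel_refl)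
  next
    case False
    define u where "u = hd \<alpha>"
    have a: "a = v" "adj G v u" and \<alpha>: "\<alpha> \<in> walks G u w"
      using Cons.prems walks_Cons_iff[OF G False] by (auto simp: u_def)
    have e: "[v, u] \<in> walks G v u" "[u, v] \<in> walks G u v"
      using walks_edge[OF G] a adj_sym[OF G] by auto
    have r: "\<alpha> @ tl (rev \<alpha>) \<in> walks G u u"
      using walks_glue[OF G \<alpha> walks_rev[OF G \<alpha>]] .
    have uv: "v \<in> verts G" "u \<in> verts G"
      using adj_verts[OF G a(2)] by auto
    \<comment> \<open>The walk is bracketed as the first edge, the loop at \<open>u\<close> to which
      the induction hypothesis applies, and the edge back.\<close>
    have "(([v, u] @ tl (\<alpha> @ tl (rev \<alpha>))) @ tl [u, v], ([v, u] @ tl [u]) @ tl [u, v]) \<in> walk_rel G v v"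
      using walk_rel_glue[OF G walks_glue[OF G e(1) r] e(2)
          walk_rel_glue[OF G e(1) r walk_rel_refl Cons.IH[OF \<alpha>]] walk_rel_refl] .
    moreover have "([v, u] @ tl (\<alpha> @ tl (rev \<alpha>))) @ tl [u, v] = (a # \<alpha>) @ tl (rev (a # \<alpha>))"
      using False a(1) unfolding u_def by (cases \<alpha>) (auto simp: tl_append split: list.split)
    moreover have "([v, u, v], [v]) \<in> walk_rel G v v"
      using walk_rel_prune[OF G uv(1) walks_glue[OF G e] walks_single[OF G uv(1)]] pruneI[of "[]" v u "[]"]
      by simp
    ultimately show ?thesis
      using walk_rel_trans by fastforce
  qed
qed

lemma fund_groupoid_quot: "fund_groupoid G =
    quot_cat (verts G) (walks G) (walk_rel G) (\<lambda>v. [v]) (\<lambda>_ \<alpha> \<beta>. \<alpha> @ tl \<beta>)"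
  by (simp add: fund_groupoid_def quot_cat_def)

lemma fund_groupoid_simps [simp]: "Ob (fund_groupoid G) = verts G" "Dom (fund_groupoid G) = src"
  "Cod (fund_groupoid G) = tgt" "Ide (fund_groupoid G) v = cls (walk_rel G) v v [v]"
  by (simp_all add: fund_groupoid_def cls_def)

lemma quotient_fund_groupoid:
  assumes G: "is_graph G"
  shows "quotient_data (verts G) (walks G) (walk_rel G) (\<lambda>v. [v]) (\<lambda>_ \<alpha> \<beta>. \<alpha> @ tl \<beta>)"
proof
  show "(\<alpha> @ tl \<beta>, \<alpha>' @ tl \<beta>') \<in> walk_rel G u w"
    if "\<alpha> \<in> walks G u v" "\<beta> \<in> walks G v w" "(\<alpha>, \<alpha>') \<in> walk_rel G u v" "(\<beta>, \<beta>') \<in> walk_rel G v w"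
    for u v w \<alpha> \<alpha>' \<beta> \<beta>'
    using walk_rel_glue[OF G that] .
  show "([u] @ tl \<alpha>, \<alpha>) \<in> walk_rel G u v" if "\<alpha> \<in> walks G u v" for u v \<alpha>
    using walks_ne[OF that] walk_rel_refl by (cases \<alpha>) auto
  show "((\<alpha> @ tl \<beta>) @ tl \<gamma>, \<alpha> @ tl (\<beta> @ tl \<gamma>)) \<in> walk_rel G u x"
    if "\<beta> \<in> walks G v w" for u v w x \<alpha> \<beta> \<gamma>
    using walks_ne[OF that] by (simp add: glue_assoc walk_rel_refl)
qed (auto simp: walk_rel_refl walks_single[OF G] intro: walk_rel_sym walk_rel_trans walks_glue[OF G] walk_rel_walks[OF G])

lemma groupoid_fund_groupoid:
  assumes G: "is_graph G"
  shows "groupoid (fund_groupoid G)"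
proof -
  interpret quotient_data "verts G" "walks G" "walk_rel G" "\<lambda>v. [v]" "\<lambda>_ \<alpha> \<beta>. \<alpha> @ tl \<beta>"
    by (rule quotient_fund_groupoid[OF G])
  show ?thesis
    unfolding fund_groupoid_quot
  proof (rule groupoidI)
    fix v w \<alpha> assume "\<alpha> \<in> walks G v w"
    \<comment> \<open>The inverse is the reversed walk; the second equation is the first one for the
      reversed walk.\<close>
    then show "\<exists>\<beta>\<in>walks G w v. (\<alpha> @ tl \<beta>, [v]) \<in> walk_rel G v v \<and> (\<beta> @ tl \<alpha>, [w]) \<in> walk_rel G w w"
      using walk_rel_rev[OF G] walks_rev[OF G] by (metis rev_rev_ident)
  qed
qed

section \<open>The functor induced by a graph morphism\<close>

lemma gmor_verts: "f \<in> gmor G H \<Longrightarrow> v \<in> verts G \<Longrightarrow> f v \<in> verts H"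
  by (auto simp: gmor_def)

lemma gmor_edge: "f \<in> gmor G H \<Longrightarrow> adj G v w \<Longrightarrow> adj H (f v) (f w)"
  by (auto simp: gmor_def)

context
  fixes G :: "'a graph" and H :: "'a graph" and \<phi>
  assumes G: "is_graph G" and H: "is_graph H" and \<phi>: "\<phi> \<in> gmor G H"
begin

lemma walks_map:
  assumes "\<alpha> \<in> walks G v w"
  shows "map \<phi> \<alpha> \<in> walks H (\<phi> v) (\<phi> w)"
  using assms walks_in_verts[OF assms] gmor_verts[OF \<phi>] is_walk_map[of "adj G" v w \<alpha> "adj H" \<phi>] gmor_edge[OF \<phi>]
  by (simp add: walks_iff G H)

lemma walk_rel_map:
  assumes "v \<in> verts G" "(\<alpha>, \<beta>) \<in> walk_rel G v w"
  shows "(map \<phi> \<alpha>, map \<phi> \<beta>) \<in> walk_rel H (\<phi> v) (\<phi> w)"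
  unfolding walk_rel_iff[OF H gmor_verts[OF \<phi>, OF assms(1)]]
proof (rule equivclp_map[where f = "map \<phi>"])
  show "equivclp (walk_move G v w) \<alpha> \<beta>"
    using assms walk_rel_iff[OF G] by blast
  fix \<gamma> \<delta> assume *: "walk_move G v w \<gamma> \<delta>"
  have "step (cross (adj H)) (map \<phi> \<gamma>) (map \<phi> \<delta>)" if "step (cross (adj G)) \<gamma> \<delta>"
    using that by (rule step_map) (auto simp: cross_def gmor_edge[OF \<phi>])
  then have "walk_move H (\<phi> v) (\<phi> w) (map \<phi> \<gamma>) (map \<phi> \<delta>)"
    using * walks_map prune_map by (auto simp: walk_move_def)
  then show "equivclp (walk_move H (\<phi> v) (\<phi> w)) (map \<phi> \<gamma>) (map \<phi> \<delta>)"
    by (rule r_into_equivclp)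
qed

interpretation dom: quotient_data "verts G" "walks G" "walk_rel G" "\<lambda>v. [v]" "\<lambda>_ \<alpha> \<beta>. \<alpha> @ tl \<beta>"
  by (rule quotient_fund_groupoid[OF G])

interpretation cod: quotient_data "verts H" "walks H" "walk_rel H" "\<lambda>v. [v]" "\<lambda>_ \<alpha> \<beta>. \<alpha> @ tl \<beta>"
  by (rule quotient_fund_groupoid[OF H])

lemma fst_induced_functor: "v \<in> verts G \<Longrightarrow> fst (induced_functor G \<phi> H) v = \<phi> v"
  by (simp add: induced_functor_def)

text \<open>By \<open>walk_rel_map\<close> all representatives of the class contribute the same
  class in \<open>H\<close>, so the union in the definition collapses to one of them.\<close>

lemma snd_induced_functor:
  assumes "\<alpha> \<in> walks G v w"
  shows "snd (induced_functor G \<phi> H) (cls (walk_rel G) v w \<alpha>) = cls (walk_rel H) (\<phi> v) (\<phi> w) (map \<phi> \<alpha>)"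
proof -
  have vw: "v \<in> verts G" "w \<in> verts G"
    using walks_in_verts[OF assms] by auto
  have "walk_rel H (\<phi> v) (\<phi> w) `` {map \<phi> \<beta>} = walk_rel H (\<phi> v) (\<phi> w) `` {map \<phi> \<alpha>}"
    if "(\<alpha>, \<beta>) \<in> walk_rel G v w" for \<beta>
    using cod.class_eqI[OF _ _ walks_map[OF assms] walk_rel_map[OF vw(1) that]] vw by (simp add: gmor_verts[OF \<phi>])
  then have "(\<Union>\<beta> \<in> walk_rel G v w `` {\<alpha>}. walk_rel H (\<phi> v) (\<phi> w) `` {map \<phi> \<beta>}) =
      walk_rel H (\<phi> v) (\<phi> w) `` {map \<phi> \<alpha>}"
    using walk_rel_refl[of \<alpha> G v w] by blast
  moreover have "cls (walk_rel G) v w \<alpha> \<in> Arr (fund_groupoid G)"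
    using dom.cls_in[OF vw assms] by (simp add: fund_groupoid_quot)
  ultimately show ?thesis
    by (simp add: induced_functor_def cls_def)
qed

lemma induced_functor_in: "induced_functor G \<phi> H \<in> functors (fund_groupoid G) (fund_groupoid H)"
proof -
  have "cat_functor (fund_groupoid G) (fund_groupoid H)
      (fst (induced_functor G \<phi> H)) (snd (induced_functor G \<phi> H))"
    unfolding fund_groupoid_quot[of G]
  proof (rule dom.functorI)
    show "category (fund_groupoid H)"
      using cod.category by (simp add: fund_groupoid_quot)
  next
    fix u v w \<alpha> \<beta>
    assume \<alpha>: "\<alpha> \<in> walks G u v" and \<beta>: "\<beta> \<in> walks G v w" and "u \<in> verts G" "v \<in> verts G" "w \<in> verts G"
    then show "snd (induced_functor G \<phi> H) (cls (walk_rel G) u w (\<alpha> @ tl \<beta>)) =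
        Comp (fund_groupoid H) (snd (induced_functor G \<phi> H) (cls (walk_rel G) v w \<beta>))
          (snd (induced_functor G \<phi> H) (cls (walk_rel G) u v \<alpha>))"
      using cod.Comp_cls[of "\<phi> u" "\<phi> v" "\<phi> w" "map \<phi> \<alpha>" "map \<phi> \<beta>"]
      by (simp add: snd_induced_functor walks_glue[OF G] fund_groupoid_quot walks_map gmor_verts[OF \<phi>] map_tl)
  qed (auto simp: fund_groupoid_quot fst_induced_functor gmor_verts[OF \<phi>] snd_induced_functor walks_map
      walks_single[OF G] intro: cod.cls_in)
  then show ?thesis
    by (simp add: functors_iff induced_functor_def fund_groupoid_def)
qed

end

section \<open>Homotopies as walks of morphisms\<close>

text \<open>Adjacency in the exponential graph of maps from \<open>G\<close> to \<open>H\<close>,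
  restricted to its looped vertices, which are the morphisms. Reflexivity on morphisms is thus built
  in, and it mirrors the loops of the interval.\<close>

definition hadj :: "'a graph \<Rightarrow> 'b graph \<Rightarrow> ('a \<Rightarrow> 'b) \<Rightarrow> ('a \<Rightarrow> 'b) \<Rightarrow> bool" where
  "hadj G H f g \<longleftrightarrow> f \<in> gmor G H \<and> g \<in> gmor G H \<and> (\<forall>v w. adj G v w \<longrightarrow> adj H (f v) (g w))"

text \<open>Unlike for walks, the pairs themselves have to be adjacent, as the interval has loops.\<close>

definition hcross :: "'a graph \<Rightarrow> 'b graph \<Rightarrow> ('a \<Rightarrow> 'b) \<times> ('a \<Rightarrow> 'b) \<Rightarrow> ('a \<Rightarrow> 'b) \<times> ('a \<Rightarrow> 'b) \<Rightarrow> bool" where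
  "hcross G H p q \<longleftrightarrow> cross (hadj G H) p q \<and> hadj G H (fst p) (snd p) \<and> hadj G H (fst q) (snd q)"

text \<open>The number of steps is the length \<open>m\<close> of the homotopy rel endpoints between
  the two homotopies. In contrast to walks nothing is ever pruned, and symmetry comes from symmetry
  of a single step.\<close>

definition hrel :: "'a graph \<Rightarrow> 'b graph \<Rightarrow> ('a \<Rightarrow> 'b) list \<Rightarrow> ('a \<Rightarrow> 'b) list \<Rightarrow> bool" where
  "hrel G H = (step (hcross G H))\<^sup>*\<^sup>*"

lemma hadj_refl: "hadj G H f f \<longleftrightarrow> f \<in> gmor G H"
  by (auto simp: hadj_def gmor_def)

lemma hadj_gmor: "hadj G H f g \<Longrightarrow> f \<in> gmor G H \<and> g \<in> gmor G H"
  by (simp add: hadj_def)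

lemma hadj_sym:
  assumes "is_graph G" "is_graph H" "hadj G H f g"
  shows "hadj G H g f"
  using assms by (auto simp: hadj_def adj_commute[OF assms(1)] adj_commute[OF assms(2)])

lemma gmor_ext: "f \<in> gmor G H \<Longrightarrow> f \<in> extensional (verts G)"
  by (auto simp: gmor_def PiE_def)

lemma gmorI:
  assumes "\<And>v. v \<in> verts G \<Longrightarrow> f v \<in> verts H" "\<And>v w. adj G v w \<Longrightarrow> adj H (f v) (f w)"
    and "f \<in> extensional (verts G)"
  shows "f \<in> gmor G H"
  using assms by (auto simp: gmor_def PiE_def)

lemma compose_gmor:
  assumes "is_graph G" "f \<in> gmor G H" "g \<in> gmor H K"
  shows "compose (verts G) g f \<in> gmor G K"
proof (rule gmorI)
  fix v w assume "adj G v w"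
  then show "adj K (compose (verts G) g f v) (compose (verts G) g f w)"
    using adj_verts[OF assms(1)] gmor_edge[OF assms(3) gmor_edge[OF assms(2)]] by (auto simp: compose_def)
qed (use gmor_verts[OF assms(2)] gmor_verts[OF assms(3)] in \<open>auto simp: compose_def\<close>)

lemma hadj_compose:
  assumes "is_graph G" "hadj G H f f'" "hadj H K g g'"
  shows "hadj G K (compose (verts G) g f) (compose (verts G) g' f')"
  using assms(2,3) adj_verts[OF assms(1)] compose_gmor[OF assms(1)]
  by (auto simp: hadj_def compose_def)

lemma compose_id_right: "f \<in> gmor G H \<Longrightarrow> compose (verts G) f (\<lambda>v\<in>verts G. v) = f"
  by (auto simp: compose_def gmor_def PiE_def extensional_def restrict_def)

lemma compose_id_left: "f \<in> gmor G H \<Longrightarrow> compose (verts G) (\<lambda>v\<in>verts H. v) f = f"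
  using gmor_verts[of f G H] gmor_ext[of f G H]
  by (auto simp: compose_def extensional_def restrict_def)

lemma compose_gmor_assoc:
  assumes "f \<in> gmor G H"
  shows "compose (verts G) h (compose (verts G) g f) = compose (verts G) (compose (verts H) h g) f"
  using gmor_verts[OF assms] by (auto simp: compose_def)

lemma id_gmor: "is_graph G \<Longrightarrow> (\<lambda>v\<in>verts G. v) \<in> gmor G G"
  by (rule gmorI) (auto dest: adj_verts)

text \<open>The time slices of a homotopy. On extensional homotopies nothing is lost, and
  concatenation, whiskering and constant homotopies become operations on lists. The restriction
  makes every slice comparable with members of \<open>gmor\<close>.\<close>

definition frames :: "'a graph \<Rightarrow> nat \<times> ('a \<times> nat \<Rightarrow> 'b) \<Rightarrow> ('a \<Rightarrow> 'b) list" where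
  "frames G x = map (\<lambda>i. \<lambda>v\<in>verts G. snd x (v, i)) [0..<Suc (fst x)]"

lemma length_frames: "length (frames G x) = Suc (fst x)"
  and frames_ne: "frames G x \<noteq> []"
  and nth_frames: "i \<le> fst x \<Longrightarrow> frames G x ! i = (\<lambda>v\<in>verts G. snd x (v, i))"
  by (auto simp: frames_def nth_append less_Suc_eq_le simp del: upt_Suc)

lemma hd_frames: "hd (frames G x) = (\<lambda>v\<in>verts G. snd x (v, 0))"
  and last_frames: "last (frames G x) = (\<lambda>v\<in>verts G. snd x (v, fst x))"
  by (simp_all add: hd_conv_nth last_conv_nth frames_ne nth_frames length_frames)

lemma frames_hconcat: "frames G (hconcat G x y) = frames G x @ tl (frames G y)"
proof (cases x; cases y)
  fix n \<Lambda> m \<Lambda>' assume xy: "x = (n, \<Lambda>)" "y = (m, \<Lambda>')"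
  show ?thesis
  proof (rule nth_equalityI)
    show "length (frames G (hconcat G x y)) = length (frames G x @ tl (frames G y))"
      using xy by (simp add: length_frames)
    fix i assume "i < length (frames G (hconcat G x y))"
    then have i: "i \<le> n + m"
      using xy by (simp add: length_frames)
    show "frames G (hconcat G x y) ! i = (frames G x @ tl (frames G y)) ! i"
    proof (cases "i \<le> n")
      case True
      with xy i show ?thesis
        by (auto simp: nth_frames nth_append length_frames gprod_def Iloop_def)
    next
      case False
      \<comment> \<open>Frame \<open>n\<close> comes from the first homotopy, so frame 0 of the
        second is dropped: index \<open>n + Suc k\<close> is entry \<open>Suc k\<close> of the
        second list and entry \<open>k\<close> of its tail.\<close>
      then obtain k where "i = n + Suc k"
        using less_iff_Suc_add[of n i] by auto
      with xy i show ?thesis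
        by (auto simp: nth_frames nth_append length_frames nth_tl gprod_def Iloop_def)
    qed
  qed
qed

lemma frames_const:
  assumes "f \<in> extensional (verts G)"
  shows "frames G (const_htpy G f) = [f]"
proof -
  have "(\<lambda>v\<in>verts G. snd (const_htpy G f) (v, 0)) = f"
    using assms by (auto simp: const_htpy_def gprod_def Iloop_def extensional_def restrict_def)
  then show ?thesis
    by (simp add: frames_def const_htpy_def)
qed

lemma frames_post: "frames G (post_htpy G g x) = map (compose (verts G) g) (frames G x)"
  by (cases x) (auto simp: frames_def compose_def gprod_def Iloop_def simp del: upt_Suc intro!: restrict_ext)

lemma frames_pre:
  assumes "\<And>v. v \<in> verts G \<Longrightarrow> f v \<in> verts H"
  shows "frames G (pre_htpy G y f) = map (\<lambda>h. compose (verts G) h f) (frames H y)"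
  using assms
  by (cases y) (auto simp: frames_def compose_def gprod_def Iloop_def simp del: upt_Suc intro!: restrict_ext)

text \<open>Currying: the edges of the product inside one time level say that each frame is a
  morphism, the edges between successive levels that successive frames are adjacent.\<close>

lemma gmor_Iloop_iff:
  assumes G: "is_graph G" and H: "is_graph H"
  shows "\<Lambda> \<in> gmor (G \<times>\<^sub>g Iloop n) H \<longleftrightarrow> \<Lambda> \<in> extensional (verts (G \<times>\<^sub>g Iloop n)) \<and>
    frames G (n, \<Lambda>) ! 0 \<in> gmor G H \<and> successively (hadj G H) (frames G (n, \<Lambda>))" (is "?L \<longleftrightarrow> ?R")
proof
  assume L: ?L
  have a: "adj H (\<Lambda> (v, i)) (\<Lambda> (w, j))" if "adj G v w" "i \<le> n" "j \<le> n" "i \<le> j + 1" "j \<le> i + 1" for v w i j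
  proof -
    have "((v, i), (w, j)) \<in> edges (G \<times>\<^sub>g Iloop n)"
      using that by (auto simp: gprod_def Iloop_def)
    then show ?thesis
      using L by (auto simp: gmor_def)
  qed
  have "\<Lambda> (v, i) \<in> verts H" if "v \<in> verts G" "i \<le> n" for v i
    using L that by (auto simp: gmor_def gprod_def Iloop_def)
  then have m: "(\<lambda>v\<in>verts G. \<Lambda> (v, i)) \<in> gmor G H" if "i \<le> n" for i
    using that a adj_verts[OF G] by (intro gmorI) auto
  have "hadj G H (\<lambda>v\<in>verts G. \<Lambda> (v, i)) (\<lambda>v\<in>verts G. \<Lambda> (v, Suc i))" if "i < n" for i
    using that m a adj_verts[OF G] by (simp add: hadj_def)
  then show ?R
    using m[of 0] gmor_ext[OF L] by (simp add: successively_conv_nth length_frames nth_frames)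
next
  assume R: ?R
  have s: "hadj G H (\<lambda>v\<in>verts G. \<Lambda> (v, i)) (\<lambda>v\<in>verts G. \<Lambda> (v, Suc i))" if "i < n" for i
    using R that by (simp add: successively_conv_nth length_frames nth_frames)
  \<comment> \<open>For \<open>n = 0\<close> no adjacency is available and frame 0 is a morphism by
    assumption; every later frame is one by its adjacency to the previous frame.\<close>
  have m: "(\<lambda>v\<in>verts G. \<Lambda> (v, i)) \<in> gmor G H" if "i \<le> n" for i
    using R that hadj_gmor[OF s] by (cases i) (auto simp: nth_frames)
  have "\<Lambda> (v, i) \<in> verts H" if "v \<in> verts G" "i \<le> n" for v i
    using gmor_verts[OF m[OF that(2)] that(1)] that by simp
  moreover have "adj H (\<Lambda> (v, i)) (\<Lambda> (w, i))" if "adj G v w" "i \<le> n" for v w i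
    using gmor_edge[OF m[OF that(2)] that(1)] adj_verts[OF G that(1)] by simp
  moreover have "adj H (\<Lambda> (v, i)) (\<Lambda> (w, Suc i))" if "adj G v w" "Suc i \<le> n" for v w i
    using s[of i] that adj_verts[OF G that(1)] by (auto simp: hadj_def split: if_splits)
  moreover have "adj H (\<Lambda> (w, Suc i)) (\<Lambda> (v, i))" if "adj G w v" "Suc i \<le> n" for v w i
    using calculation(3)[OF adj_sym[OF G that(1)] that(2)] by (rule adj_sym[OF H])
  ultimately show ?L
    unfolding gmor_def PiE_def using R by (auto simp: gprod_def Iloop_def)
qed

lemma htpies_iff:
  assumes G: "is_graph G" and H: "is_graph H" and f: "f \<in> gmor G H" and g: "g \<in> gmor G H"
  shows "x \<in> htpies G H f g \<longleftrightarrow> snd x \<in> extensional (verts (G \<times>\<^sub>g Iloop (fst x))) \<and>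
    is_walk (hadj G H) f g (frames G x)"
proof -
  have "(\<forall>v \<in> verts G. snd x (v, i) = h v) \<longleftrightarrow> (\<lambda>v\<in>verts G. snd x (v, i)) = h" if "h \<in> gmor G H" for i h
    using gmor_ext[OF that] by (auto simp: extensional_def restrict_def fun_eq_iff)
  then show ?thesis
    using f g unfolding htpies_def is_walk_def hd_frames last_frames
    by (cases x) (auto simp: gmor_Iloop_iff[OF G H] frames_ne nth_frames)
qed

lemma is_walk_gmor:
  assumes "is_walk (hadj G H) f g L" "f \<in> gmor G H"
  shows "g \<in> gmor G H" and "h \<in> set L \<Longrightarrow> h \<in> gmor G H"
proof -
  have *: "h \<in> gmor G H" if "successively (hadj G H) L" "hd L \<in> gmor G H" "h \<in> set L" for L h
    using that by (induction L) (auto simp: successively_Cons dest: hadj_gmor)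
  show "h \<in> gmor G H" if "h \<in> set L"
    using * that assms by (auto simp: is_walk_def)
  show "g \<in> gmor G H"
    using *[of L g] assms by (auto simp: is_walk_def)
qed

text \<open>The way back from lists to homotopies; with it, being homotopic becomes the existence of
  a walk of morphisms.\<close>

lemma ex_frames:
  assumes "is_graph G" "is_graph H" "is_walk (hadj G H) f g L" "f \<in> gmor G H"
  shows "\<exists>x \<in> htpies G H f g. frames G x = L"
proof -
  let ?x = "(length L - 1, \<lambda>(v, i) \<in> verts (G \<times>\<^sub>g Iloop (length L - 1)). (L ! i) v)"
  have L: "L \<noteq> []" "\<And>i. i < length L \<Longrightarrow> L ! i \<in> gmor G H"
    using assms is_walk_gmor(2)[OF assms(3,4)] by (auto simp: is_walk_def)
  have "frames G ?x = L"
  proof (rule nth_equalityI)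
    show "length (frames G ?x) = length L"
      using L by (simp add: length_frames)
    fix i assume "i < length (frames G ?x)"
    then have i: "i < length L" "i \<le> length L - 1"
      using L by (auto simp: length_frames)
    then show "frames G ?x ! i = L ! i"
      using gmor_ext[OF L(2)[OF i(1)]]
      by (auto simp: nth_frames gprod_def Iloop_def extensional_def restrict_def)
  qed
  moreover have "g \<in> gmor G H"
    using is_walk_gmor(1)[OF assms(3,4)] .
  ultimately have "?x \<in> htpies G H f g"
    using assms by (simp add: htpies_iff)
  with \<open>frames G ?x = L\<close> show ?thesis by blast
qed

text \<open>The right-hand side lists the adjacencies over pairs of indices at distance at most 1,
  including equal indices, as the product of two looped intervals demands. The hypothesis on the
  head covers lists with a single entry, where \<open>step\<close> imposes no adjacency.\<close>

lemma step_hcross_iff: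
  assumes G: "is_graph G" and H: "is_graph H" and L: "hd L \<in> gmor G H"
  shows "step (hcross G H) L L' \<longleftrightarrow> length L = length L' \<and> L \<noteq> [] \<and> hd L = hd L' \<and> last L = last L' \<and>
    (\<forall>i j. i < length L \<and> j < length L \<and> i \<le> j + 1 \<and> j \<le> i + 1 \<longrightarrow>
       hadj G H (L ! i) (L ! j) \<and> hadj G H (L ! i) (L' ! j) \<and> hadj G H (L' ! i) (L' ! j))"
    (is "?l \<longleftrightarrow> ?r")
proof
  assume l: ?l
  have s: "hcross G H (L ! i, L' ! i) (L ! Suc i, L' ! Suc i)" if "Suc i < length L" for i
    using l that by (simp add: step_nth)
  have ne: "L \<noteq> []" "L' \<noteq> []" "hd L = hd L'" "length L' = length L"
    using l by (auto simp: step_def)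
  have e: "hadj G H (L ! i) (L' ! i)" if "i < length L" for i
  proof (cases i)
    \<comment> \<open>At index 0 the two lists agree, so this is reflexivity of
      \<open>hadj\<close>.\<close>
    case 0
    then show ?thesis
      using L ne by (simp add: hd_conv_nth hadj_refl)
  next
    case (Suc k)
    then show ?thesis
      using s[of k] that by (simp add: hcross_def)
  qed
  have "hadj G H (L ! i) (L ! j) \<and> hadj G H (L ! i) (L' ! j) \<and> hadj G H (L' ! i) (L' ! j)"
    if ij: "i < length L" "j < length L" "i \<le> j + 1" "j \<le> i + 1" for i j
  proof -
    consider "i = j" | "j = Suc i" | "i = Suc j"
      using ij by linarith
    then show ?thesis
    proof cases
      case 1
      then show ?thesis
        using e[OF ij(1)] hadj_gmor[OF e[OF ij(1)]] by (simp add: hadj_refl)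
    next
      case 2
      then show ?thesis
        using s[of i] ij by (simp add: hcross_def cross_def)
    next
      case 3
      then show ?thesis
        using s[of j] ij hadj_sym[OF G H, of "L ! j" "L ! i"] hadj_sym[OF G H, of "L' ! j" "L ! i"]
          hadj_sym[OF G H, of "L' ! j" "L' ! i"]
        by (simp add: hcross_def cross_def)
    qed
  qed
  then show ?r
    using l by (auto simp: step_def)
next
  assume r: ?r
  then have h: "hadj G H (L ! i) (L ! j) \<and> hadj G H (L ! i) (L' ! j) \<and> hadj G H (L' ! i) (L' ! j)"
    if "i < length L" "j < length L" "i \<le> j + 1" "j \<le> i + 1" for i j
    using that by blast
  have "hcross G H (L ! i, L' ! i) (L ! Suc i, L' ! Suc i)" if "Suc i < length L" for i
    using that h[of i "Suc i"] h[of i i] h[of "Suc i" "Suc i"]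
      hadj_sym[OF G H, of "L ! Suc i" "L' ! i"] h[of "Suc i" i]
    by (simp add: hcross_def cross_def)
  then show ?l
    using r by (auto simp: step_nth)
qed

lemma step_hcross_is_walk:
  assumes "is_graph G" "is_graph H" "f \<in> gmor G H" "is_walk (hadj G H) f g L" "step (hcross G H) L L'"
  shows "is_walk (hadj G H) f g L'"
  using assms step_hcross_iff[OF assms(1,2), of L L']
  by (auto simp: is_walk_def successively_conv_nth)

lemma hrel_is_walk:
  assumes "is_graph G" "is_graph H" "f \<in> gmor G H" "is_walk (hadj G H) f g L" "hrel G H L L'"
  shows "is_walk (hadj G H) f g L'"
  using assms(5) unfolding hrel_def
  by (induction rule: rtranclp_induct) (use assms step_hcross_is_walk in auto)

lemma step_hcross_refl:
  assumes "is_walk (hadj G H) f g L"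
  shows "step (hcross G H) L L"
  using assms
  by (auto simp: step_refl is_walk_def hcross_def cross_def hadj_refl dest: hadj_gmor elim!: successively_mono)

lemma hrel_refl: "hrel G H L L"
  by (simp add: hrel_def)

lemma hrel_trans: "hrel G H L L' \<Longrightarrow> hrel G H L' L'' \<Longrightarrow> hrel G H L L''"
  by (simp add: hrel_def)

lemma hrel_step: "step (hcross G H) L L' \<Longrightarrow> hrel G H L L'"
  by (simp add: hrel_def)

lemma hrel_sym:
  assumes G: "is_graph G" and H: "is_graph H" and "hrel G H L L'"
  shows "hrel G H L' L"
proof -
  have "hcross G H (prod.swap p) (prod.swap q)" if "hcross G H p q" for p q
    using that hadj_sym[OF G H] by (simp add: hcross_def cross_def)
  then have "symp (step (hcross G H))"
    by (blast intro: sympI step_sym)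
  then show ?thesis
    using assms(3) unfolding hrel_def by (blast dest: symp_rtranclp sympD)
qed

lemma hrel_map:
  assumes "hrel G H L L'" "\<And>p q. hcross G H p q \<Longrightarrow> hcross G' H' (map_prod F F p) (map_prod F F q)"
  shows "hrel G' H' (map F L) (map F L')"
  using assms(1) unfolding hrel_def
  by (induction rule: rtranclp_induct) (auto intro: rtranclp.rtrancl_into_rtrancl step_map assms(2))

text \<open>As for walks, one factor is changed at a time. The inductions carry along that every
  intermediate list is a walk with the same ends, since only then do the steps fit together.\<close>

lemma hrel_glue:
  assumes G: "is_graph G" and H: "is_graph H" and f: "f \<in> gmor G H" and g: "g \<in> gmor G H"
    and L: "is_walk (hadj G H) f g L" and M: "is_walk (hadj G H) g h M"
    and L': "hrel G H L L'" and M': "hrel G H M M'"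
  shows "hrel G H (L @ tl M) (L' @ tl M')"
proof (rule hrel_trans)
  have 1: "is_walk (hadj G H) g h M1 \<and> hrel G H (L @ tl M) (L @ tl M1)" if "hrel G H M M1" for M1
    using that unfolding hrel_def
  proof (induction rule: rtranclp_induct)
    case base
    then show ?case using M by simp
  next
    case (step y z)
    then have "step (hcross G H) (L @ tl y) (L @ tl z)"
      using L by (intro step_glue step_hcross_refl[OF L]) (auto simp: is_walk_def)
    then show ?case
      using step step_hcross_is_walk[OF G H g] by auto
  qed
  show "hrel G H (L @ tl M) (L @ tl M')"
    using 1[OF M'] by simp
  have w: "is_walk (hadj G H) g h M'"
    using 1[OF M'] by simp
  have "is_walk (hadj G H) f g L1 \<and> hrel G H (L @ tl M') (L1 @ tl M')" if "hrel G H L L1" for L1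
    using that unfolding hrel_def
  proof (induction rule: rtranclp_induct)
    case base
    then show ?case using L by simp
  next
    case (step y z)
    then have "step (hcross G H) (y @ tl M') (z @ tl M')"
      using w by (intro step_glue step_hcross_refl[OF w]) (auto simp: is_walk_def)
    then show ?case
      using step step_hcross_is_walk[OF G H f] by auto
  qed
  then show "hrel G H (L @ tl M') (L' @ tl M')"
    using L' by simp
qed

text \<open>The layers of \<open>\<Theta>\<close> at fixed \<open>j\<close> are homotopies;
  consecutive layers form a step because \<open>Iloop n\<close> and \<open>Iloop m\<close> both have
  loops, so all index pairs at distance at most 1 are adjacent.\<close>

lemma htpy_rel_imp_hrel:
  assumes G: "is_graph G" and H: "is_graph H" and f: "f \<in> gmor G H"
    and x: "(x, y) \<in> htpy_rel G H f g"
  shows "hrel G H (frames G x) (frames G y)"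
proof -
  obtain n \<Lambda> \<Lambda>' m \<Theta> where xy: "x = (n, \<Lambda>)" "y = (n, \<Lambda>')"
    and \<Theta>: "\<Theta> \<in> gmor (G \<times>\<^sub>g Iloop n \<times>\<^sub>g Iloop m) H"
    and ends: "\<And>p. p \<in> verts (G \<times>\<^sub>g Iloop n) \<Longrightarrow> \<Theta> (p, 0) = \<Lambda> p \<and> \<Theta> (p, m) = \<Lambda>' p"
    and sides: "\<And>v j. v \<in> verts G \<Longrightarrow> j \<le> m \<Longrightarrow> \<Theta> ((v, 0), j) = f v \<and> \<Theta> ((v, n), j) = g v"
    using x by (auto simp: htpy_rel_def)
  define S where "S j = frames G (n, \<lambda>p. \<Theta> (p, j))" for j
  have S: "length (S j) = Suc n" "S j \<noteq> []" "i \<le> n \<Longrightarrow> S j ! i = (\<lambda>v\<in>verts G. \<Theta> ((v, i), j))"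
    "hd (S j) = (\<lambda>v\<in>verts G. \<Theta> ((v, 0), j))" "last (S j) = (\<lambda>v\<in>verts G. \<Theta> ((v, n), j))" for i j
    by (simp_all add: S_def length_frames frames_ne nth_frames hd_frames last_frames)
  have a: "adj H (\<Theta> ((v, i), j)) (\<Theta> ((v', i'), j'))"
    if "adj G v v'" "i \<le> n" "i' \<le> n" "j \<le> m" "j' \<le> m" "i \<le> i' + 1" "i' \<le> i + 1" "j \<le> j' + 1" "j' \<le> j + 1"
    for v v' i i' j j'
  proof -
    have "(((v, i), j), ((v', i'), j')) \<in> edges (G \<times>\<^sub>g Iloop n \<times>\<^sub>g Iloop m)"
      using that by (auto simp: gprod_def Iloop_def)
    then show ?thesis
      using \<Theta> by (auto simp: gmor_def)
  qed
  have "\<Theta> ((v, i), j) \<in> verts H" if "v \<in> verts G" "i \<le> n" "j \<le> m" for v i j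
    using \<Theta> that by (auto simp: gmor_def gprod_def Iloop_def)
  then have "(\<lambda>v\<in>verts G. \<Theta> ((v, i), j)) \<in> gmor G H" if "i \<le> n" "j \<le> m" for i j
    using that a adj_verts[OF G] by (intro gmorI) auto
  then have h: "hadj G H (S j ! i) (S j' ! i')"
    if "i \<le> n" "i' \<le> n" "j \<le> m" "j' \<le> m" "i \<le> i' + 1" "i' \<le> i + 1" "j \<le> j' + 1" "j' \<le> j + 1" for i i' j j'
    using that a adj_verts[OF G] by (auto simp: hadj_def S)
  have "step (hcross G H) (S j) (S (Suc j))" if "Suc j \<le> m" for j
  proof -
    have "hd (S j) = f" "hd (S (Suc j)) = f" "last (S j) = last (S (Suc j))"
      using that sides gmor_ext[OF f] by (auto simp: S extensional_def restrict_def)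
    then show ?thesis
      using that f h by (subst step_hcross_iff[OF G H]) (auto simp: S(1,2))
  qed
  then have "hrel G H (S 0) (S j)" if "j \<le> m" for j
    using that by (induction j) (auto simp: hrel_def intro: rtranclp.rtrancl_into_rtrancl)
  moreover have "S 0 = frames G x" "S m = frames G y"
    using ends xy by (auto simp: S_def frames_def gprod_def Iloop_def simp del: upt_Suc intro!: restrict_ext)
  ultimately show ?thesis by (metis order_refl)
qed

text \<open>The lists met along the chain of steps are stacked as the layers of one map
  \<open>\<Theta>\<close>, and \<open>m\<close> is the number of steps.\<close>

lemma hrel_imp_htpy_rel:
  assumes G: "is_graph G" and H: "is_graph H" and f: "f \<in> gmor G H" and g: "g \<in> gmor G H"
    and x: "x \<in> htpies G H f g" and y: "y \<in> htpies G H f g" and h: "hrel G H (frames G x) (frames G y)"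
  shows "(x, y) \<in> htpy_rel G H f g"
proof -
  obtain m S where S: "S 0 = frames G x" "S m = frames G y" "\<And>j. j < m \<Longrightarrow> step (hcross G H) (S j) (S (Suc j))"
    using h unfolding hrel_def rtranclp_power relpowp_fun_conv by blast
  define n where "n = fst x"
  have x0: "is_walk (hadj G H) f g (frames G x)"
    using x htpies_iff[OF G H f g] by blast
  have w: "is_walk (hadj G H) f g (S j) \<and> length (S j) = Suc n" if "j \<le> m" for j
    using that
  proof (induction j)
    case 0
    then show ?case using x0 by (simp add: S n_def length_frames)
  next
    case (Suc j)
    then show ?case
      using S(3)[of j] step_hcross_is_walk[OF G H f, of g "S j"] by (auto simp: step_def)
  qed
  \<comment> \<open>The next three facts are the three kinds of edges in the direction of
    \<open>Iloop m\<close>: staying in a layer, moving up and moving down.\<close>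
  have same: "hadj G H (S j ! i) (S j ! i')" if "j \<le> m" "i \<le> n" "i' \<le> n" "i \<le> i' + 1" "i' \<le> i + 1" for i i' j
    using step_hcross_iff[OF G H, of "S j" "S j"] step_hcross_refl[of G H f g "S j"] w[OF that(1)] f that
    by (auto simp: is_walk_def)
  have next1: "hadj G H (S j ! i) (S (Suc j) ! i')" if "Suc j \<le> m" "i \<le> n" "i' \<le> n" "i \<le> i' + 1" "i' \<le> i + 1" for i i' j
    using step_hcross_iff[OF G H, of "S j" "S (Suc j)"] S(3)[of j] w[of j] f that
    by (auto simp: is_walk_def)
  have next2: "hadj G H (S (Suc j) ! i) (S j ! i')" if "Suc j \<le> m" "i \<le> n" "i' \<le> n" "i \<le> i' + 1" "i' \<le> i + 1" for i i' j
    using next1[of j i' i] that hadj_sym[OF G H] by blast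
  have v: "(S j ! i) v \<in> verts H" if "j \<le> m" "i \<le> n" "v \<in> verts G" for i j v
    using same[OF that(1,2,2)] that(3) by (auto simp: hadj_def gmor_verts)
  define \<Theta> where "\<Theta> = (\<lambda>((v, i), j) \<in> verts (G \<times>\<^sub>g Iloop n \<times>\<^sub>g Iloop m). (S j ! i) v)"
  have \<Theta>: "\<Theta> ((v, i), j) = (S j ! i) v" if "v \<in> verts G" "i \<le> n" "j \<le> m" for v i j
    using that by (simp add: \<Theta>_def gprod_def Iloop_def)
  have adjs: "adj H ((S j ! i) v) ((S j' ! i') v')"
    if e: "adj G v v'" and ij: "i \<le> n" "i' \<le> n" "j \<le> m" "j' \<le> m"
      "i' = i \<or> i' = i + 1 \<or> i = i' + 1" "j' = j \<or> j' = j + 1 \<or> j = j' + 1" for v v' i i' j j'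
  proof -
    have "i \<le> i' + 1" "i' \<le> i + 1"
      using ij(5) by auto
    then have "hadj G H (S j ! i) (S j' ! i')"
      using ij(6) same[of j i i'] next1[of j i i'] next2[of j' i i'] ij(1-4) by auto
    then show ?thesis
      using e by (auto simp: hadj_def)
  qed
  have "\<Theta> \<in> gmor (G \<times>\<^sub>g Iloop n \<times>\<^sub>g Iloop m) H"
    unfolding gmor_def
  proof (intro CollectI conjI)
    show "\<Theta> \<in> verts (G \<times>\<^sub>g Iloop n \<times>\<^sub>g Iloop m) \<rightarrow>\<^sub>E verts H"
      using v by (auto simp: \<Theta>_def gprod_def Iloop_def)
    show "\<forall>(p, q) \<in> edges (G \<times>\<^sub>g Iloop n \<times>\<^sub>g Iloop m). adj H (\<Theta> p) (\<Theta> q)"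
    proof (clarify)
      fix v i j v' i' j'
      assume "(((v, i), j), ((v', i'), j')) \<in> edges (G \<times>\<^sub>g Iloop n \<times>\<^sub>g Iloop m)"
      then have e: "adj G v v'" "i \<le> n" "i' \<le> n" "j \<le> m" "j' \<le> m"
        "i' = i \<or> i' = i + 1 \<or> i = i' + 1" "j' = j \<or> j' = j + 1 \<or> j = j' + 1"
        by (auto simp: gprod_def Iloop_def)
      then show "adj H (\<Theta> ((v, i), j)) (\<Theta> ((v', i'), j'))"
        using adjs[OF e] adj_verts[OF G e(1)] by (simp add: \<Theta>)
    qed
  qed
  moreover have "\<Theta> ((v, 0), j) = f v" "\<Theta> ((v, n), j) = g v" if "v \<in> verts G" "j \<le> m" for v j
    using w[OF that(2)] that by (auto simp: \<Theta> is_walk_def hd_conv_nth last_conv_nth)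
  moreover have ny: "fst y = n"
    using w[of m] S(2) by (simp add: length_frames)
  moreover have "\<Theta> (p, 0) = snd x p" "\<Theta> (p, m) = snd y p" if "p \<in> verts (G \<times>\<^sub>g Iloop n)" for p
    using that ny by (auto simp: gprod_def Iloop_def \<Theta> S nth_frames n_def)
  moreover obtain \<Lambda> \<Lambda>' where xy: "x = (n, \<Lambda>)" "y = (n, \<Lambda>')"
    using ny by (metis n_def prod.collapse)
  ultimately show ?thesis
    unfolding htpy_rel_def xy mem_Collect_eq case_prod_conv
    by (intro conjI refl exI[of _ m] bexI[of _ \<Theta>] ballI allI impI) (use x y in \<open>simp_all add: xy\<close>)
qed

lemma htpy_rel_htpies: "(x, y) \<in> htpy_rel G H f g \<Longrightarrow> x \<in> htpies G H f g \<and> y \<in> htpies G H f g"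
  by (auto simp: htpy_rel_def)

lemma htpy_rel_iff:
  assumes "is_graph G" "is_graph H" "f \<in> gmor G H" "g \<in> gmor G H"
  shows "(x, y) \<in> htpy_rel G H f g \<longleftrightarrow>
    x \<in> htpies G H f g \<and> y \<in> htpies G H f g \<and> hrel G H (frames G x) (frames G y)"
  using htpy_rel_imp_hrel[OF assms(1-3)] hrel_imp_htpy_rel[OF assms] htpy_rel_htpies by blast

section \<open>Whiskering and the exchange of two homotopies\<close>

lemma is_walk_post:
  assumes "is_graph G" "is_walk (hadj G H) f f' L" "g \<in> gmor H K"
  shows "is_walk (hadj G K) (compose (verts G) g f) (compose (verts G) g f') (map (compose (verts G) g) L)"
  using assms(2) by (rule is_walk_map) (use assms in \<open>simp add: hadj_compose hadj_refl\<close>)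

lemma is_walk_pre:
  assumes "is_graph G" "is_walk (hadj H K) g g' M" "f \<in> gmor G H"
  shows "is_walk (hadj G K) (compose (verts G) g f) (compose (verts G) g' f)
    (map (\<lambda>h. compose (verts G) h f) M)"
  using assms(2) by (rule is_walk_map) (use assms in \<open>simp add: hadj_compose hadj_refl\<close>)

lemma hrel_post:
  assumes "is_graph G" "g \<in> gmor H K" "hrel G H L L'"
  shows "hrel G K (map (compose (verts G) g) L) (map (compose (verts G) g) L')"
  using assms(3)
  by (rule hrel_map) (use assms in \<open>auto simp: hcross_def cross_def hadj_compose hadj_refl\<close>)

lemma hrel_pre:
  assumes "is_graph G" "f \<in> gmor G H" "hrel H K M M'"
  shows "hrel G K (map (\<lambda>h. compose (verts G) h f) M) (map (\<lambda>h. compose (verts G) h f) M')"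
  using assms(3)
  by (rule hrel_map) (use assms in \<open>auto simp: hcross_def cross_def hadj_compose hadj_refl\<close>)

text \<open>Prefixing \<open>f\<close> means gluing the homotopy \<open>[f, g]\<close> of length 1
  on the left.\<close>

lemma hrel_Cons:
  assumes G: "is_graph G" and H: "is_graph H" and "hadj G H f g" "is_walk (hadj G H) g h L" "hrel G H L L'"
  shows "hrel G H (f # L) (f # L')"
proof -
  have f: "f \<in> gmor G H" "g \<in> gmor G H"
    using assms(3) hadj_gmor by auto
  have L': "is_walk (hadj G H) g h L'"
    using hrel_is_walk[OF G H f(2) assms(4,5)] .
  have "is_walk (hadj G H) f g [f, g]"
    using assms(3) by (simp add: is_walk_def)
  then have "hrel G H ([f, g] @ tl L) ([f, g] @ tl L')"
    using hrel_glue[OF G H f _ assms(4) hrel_refl assms(5)] by blast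
  moreover have "[f, g] @ tl L = f # L" "[f, g] @ tl L' = f # L'"
    using assms(4) L' by (cases L; cases L'; auto simp: is_walk_def)+
  ultimately show ?thesis by simp
qed

lemma is_walk_Cons: "is_walk E x y (a # b # L) \<longleftrightarrow> a = x \<and> E a b \<and> is_walk E b y (b # L)"
  by (auto simp: is_walk_def)

text \<open>
  The exchange law: a homotopy \<open>L\<close> and a homotopy \<open>M\<close> span a grid, and the corner of a path in the
  grid can be flipped in one step, because the two flipped positions are adjacent.
\<close>

lemma hrel_swap1:
  assumes G: "is_graph G" and K: "is_graph K" and H: "is_graph H" and gg': "hadj H K g g'"
  shows "is_walk (hadj G H) f f' L \<Longrightarrow> f \<in> gmor G H \<Longrightarrow>
    hrel G K (map (compose (verts G) g) L @ [compose (verts G) g' f'])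
      (compose (verts G) g f # map (compose (verts G) g') L)"
proof (induction L arbitrary: f)
  case Nil
  then show ?case by (simp add: is_walk_def)
next
  case (Cons a L)
  let ?c = "compose (verts G)"
  show ?case
  proof (cases L)
    case Nil
    then show ?thesis
      using Cons.prems by (auto simp: is_walk_def hrel_refl)
  next
    case (Cons b L')
    have a: "a = f" "hadj G H f b" and L: "is_walk (hadj G H) b f' L"
      using Cons.prems \<open>L = b # L'\<close> by (auto simp: is_walk_Cons)
    have b: "b \<in> gmor G H" and g: "g \<in> gmor H K" "g' \<in> gmor H K"
      using a gg' hadj_gmor by blast+
    have adjs: "hadj G K (?c k p) (?c l q)" if "p \<in> {f, b}" "q \<in> {f, b}" "k \<in> {g, g'}" "l \<in> {g, g'}" for p q k l
    proof (rule hadj_compose[OF G])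
      show "hadj G H p q"
        using that a(2) b Cons.prems(2) hadj_sym[OF G H a(2)] by (auto simp: hadj_refl)
      show "hadj H K k l"
        using that g gg' hadj_sym[OF H K gg'] by (auto simp: hadj_refl)
    qed
    have "is_walk (hadj G K) (?c g f') (?c g' f') [?c g f', ?c g' f']"
      using hadj_compose[OF G _ gg', of f' f'] is_walk_gmor(1)[OF L b] by (simp add: is_walk_def hadj_refl)
    then have w: "is_walk (hadj G K) (?c g b) (?c g' f') (map (?c g) L @ [?c g' f'])"
      using is_walk_glue[OF is_walk_post[OF G L g(1)]] by fastforce
    \<comment> \<open>By induction the edge from \<open>g\<close> to \<open>g'\<close> moves to the
      front of the part after \<open>f\<close>; then it has to pass the edge from \<open>f\<close>
      to \<open>b\<close>.\<close>
    have "hrel G K (?c g f # (map (?c g) L @ [?c g' f'])) (?c g f # ?c g b # map (?c g') L)"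
      using adjs by (intro hrel_Cons[OF G K _ w Cons.IH[OF L b]]) auto
    moreover have "hrel G K (?c g f # ?c g b # map (?c g') L) (?c g f # ?c g' f # map (?c g') L)"
    proof -
      \<comment> \<open>The corner flip. The middle entries are adjacent as \<open>g\<close> is
        adjacent to \<open>g'\<close> and \<open>b\<close> to \<open>f\<close>, which is what
        \<open>hcross\<close> asks of a pair.\<close>
      have "step (hcross G K) [?c g f, ?c g b, ?c g' b] [?c g f, ?c g' f, ?c g' b]"
        using adjs by (simp add: step_def hcross_def cross_def)
      moreover have "step (hcross G K) (map (?c g') L) (map (?c g') L)"
        using step_hcross_refl[OF is_walk_post[OF G L g(2)]] .
      ultimately have "step (hcross G K) ([?c g f, ?c g b, ?c g' b] @ tl (map (?c g') L))
          ([?c g f, ?c g' f, ?c g' b] @ tl (map (?c g') L))"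
        by (rule step_glue) (simp add: \<open>L = b # L'\<close>)
      then show ?thesis
        by (simp add: \<open>L = b # L'\<close> hrel_step)
    qed
    ultimately show ?thesis
      using hrel_trans a(1) by fastforce
  qed
qed

text \<open>Induction over the edges of \<open>M\<close>: \<open>hrel_swap1\<close> carries one edge
  past all of \<open>L\<close>, and the remaining edges follow with the next morphism in place of
  \<open>g\<close>.\<close>

lemma hrel_swap:
  assumes G: "is_graph G" and H: "is_graph H" and K: "is_graph K"
    and L: "is_walk (hadj G H) f f' L" and f: "f \<in> gmor G H"
  shows "is_walk (hadj H K) g g' M \<Longrightarrow> g \<in> gmor H K \<Longrightarrow>
    hrel G K (map (compose (verts G) g) L @ tl (map (\<lambda>h. compose (verts G) h f') M))
      (map (\<lambda>h. compose (verts G) h f) M @ tl (map (compose (verts G) g') L))"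
proof (induction M arbitrary: g)
  case Nil
  then show ?case by (simp add: is_walk_def)
next
  case (Cons a M)
  let ?c = "compose (verts G)"
  have f': "f' \<in> gmor G H"
    using is_walk_gmor(1)[OF L f] .
  show ?case
  proof (cases M)
    case Nil
    then show ?thesis
      using Cons.prems L by (cases L) (auto simp: is_walk_def hrel_refl)
  next
    case (Cons b M')
    have a: "a = g" "hadj H K g b" and M: "is_walk (hadj H K) b g' M"
      using Cons.prems \<open>M = b # M'\<close> by (auto simp: is_walk_Cons)
    have b: "b \<in> gmor H K"
      using a hadj_gmor by blast
    have wL: "is_walk (hadj G K) (?c g f) (?c g f') (map (?c g) L)"
      "is_walk (hadj G K) (?c b f) (?c b f') (map (?c b) L)"
      using is_walk_post[OF G L] Cons.prems(2) b by auto
    have wM: "is_walk (hadj G K) (?c b f') (?c g' f') (map (\<lambda>h. ?c h f') M)"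
      using is_walk_pre[OF G M f'] .
    have e: "hadj G K (?c g f') (?c b f')" "hadj G K (?c g f) (?c b f)"
      using hadj_compose[OF G _ a(2)] f f' by (auto simp: hadj_refl)
    have w1: "is_walk (hadj G K) (?c g f) (?c b f') (map (?c g) L @ [?c b f'])"
      using is_walk_glue[OF wL(1), of "?c b f'" "[?c g f', ?c b f']"] e(1) by (simp add: is_walk_def)
    \<comment> \<open>The first edge of \<open>M\<close> is split off and moved in front of
      \<open>L\<close>; behind it stands the situation of the induction hypothesis at
      \<open>b\<close>.\<close>
    have "hrel G K ((map (?c g) L @ [?c b f']) @ tl (map (\<lambda>h. ?c h f') M))
        ((?c g f # map (?c b) L) @ tl (map (\<lambda>h. ?c h f') M))"
      using hrel_glue[OF G K _ _ w1 wM hrel_swap1[OF G K H a(2) L f] hrel_refl]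
        compose_gmor[OF G] f f' b Cons.prems(2) by blast
    moreover have "hrel G K (?c g f # (map (?c b) L @ tl (map (\<lambda>h. ?c h f') M)))
        (?c g f # (map (\<lambda>h. ?c h f) M @ tl (map (?c g') L)))"
      using hrel_Cons[OF G K e(2) is_walk_glue[OF wL(2) wM] Cons.IH[OF M b]] .
    ultimately have "hrel G K ((map (?c g) L @ [?c b f']) @ tl (map (\<lambda>h. ?c h f') M))
        (?c g f # (map (\<lambda>h. ?c h f) M @ tl (map (?c g') L)))"
      by (auto intro: hrel_trans)
    then show ?thesis
      by (simp add: a(1) \<open>M = b # M'\<close>)
  qed
qed

section \<open>Graphs, and homotopies under vertical composition\<close>

lemma Gph1_simps [simp]: "Ob Gph1 = {G. is_graph G \<and> no_isolated G}" "Dom Gph1 = src" "Cod Gph1 = tgt"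
  "Ide Gph1 G = Arrow G (\<lambda>v \<in> verts G. v) G"
  "Comp Gph1 g f = Arrow (src f) (compose (verts (src f)) (body g) (body f)) (tgt g)"
  by (simp_all add: Gph1_def)

lemma Arr_Gph1: "f \<in> Arr Gph1 \<longleftrightarrow> is_graph (src f) \<and> no_isolated (src f) \<and>
    is_graph (tgt f) \<and> no_isolated (tgt f) \<and> body f \<in> gmor (src f) (tgt f)"
  by (cases f) (simp add: Gph1_def)

lemma category_Gph1: "category Gph1"
  by unfold_locales
    (auto simp: Arr_Gph1 id_gmor compose_gmor compose_id_left compose_id_right compose_gmor_assoc)

text \<open>Empty unless the 1-cells are parallel, so that the family is defined on all pairs of
  1-cells, as \<open>quot_cat\<close> expects.\<close>

definition cells2 :: "'a graph_arrow \<Rightarrow> 'a graph_arrow \<Rightarrow> 'a htpy set" where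
  "cells2 f g = (if src f = src g \<and> tgt f = tgt g then htpies (src f) (tgt f) (body f) (body g) else {})"

definition cells2_rel :: "'a graph_arrow \<Rightarrow> 'a graph_arrow \<Rightarrow> ('a htpy \<times> 'a htpy) set" where
  "cells2_rel f g = htpy_rel (src f) (tgt f) (body f) (body g)"

lemma cells2_iff:
  assumes "f \<in> Arr Gph1" "g \<in> Arr Gph1"
  shows "x \<in> cells2 f g \<longleftrightarrow> src f = src g \<and> tgt f = tgt g \<and>
    snd x \<in> extensional (verts (src f \<times>\<^sub>g Iloop (fst x))) \<and>
    is_walk (hadj (src f) (tgt f)) (body f) (body g) (frames (src f) x)"
  using assms htpies_iff[of "src f" "tgt f" "body f" "body g" x]
  by (auto simp: cells2_def Arr_Gph1)

lemma cells2_rel_iff: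
  assumes "f \<in> Arr Gph1" "g \<in> Arr Gph1" "src f = src g" "tgt f = tgt g"
  shows "(x, y) \<in> cells2_rel f g \<longleftrightarrow>
    x \<in> cells2 f g \<and> y \<in> cells2 f g \<and> hrel (src f) (tgt f) (frames (src f) x) (frames (src f) y)"
  using assms htpy_rel_iff[of "src f" "tgt f" "body f" "body g" x y]
  by (auto simp: cells2_def cells2_rel_def Arr_Gph1)

lemma Gph_vert_quot: "(Gph_vert :: ('a graph_arrow, 'a htpy_arrow) cat) = quot_cat (Arr Gph1) cells2 cells2_rel
    (\<lambda>f. const_htpy (src f) (body f)) (\<lambda>f. hconcat (src f))"
proof -
  \<comment> \<open>For 1-cells that are not parallel both sides fail: the quotient of the empty set
    has no members.\<close>
  have "f \<in> Arr Gph1 \<and> g \<in> Arr Gph1 \<and> src f = src g \<and> tgt f = tgt g \<and>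
      c \<in> htpies (src f) (tgt f) (body f) (body g) // htpy_rel (src f) (tgt f) (body f) (body g) \<longleftrightarrow>
    f \<in> Arr Gph1 \<and> g \<in> Arr Gph1 \<and> c \<in> cells2 f g // cells2_rel f g"
    for f g :: "'a graph_arrow" and c
    by (auto simp: cells2_def cells2_rel_def quotient_def)
  then show ?thesis
    by (simp add: Gph_vert_def quot_cat_def cells2_rel_def)
qed

lemma ext_hconcat: "snd (hconcat G x y) \<in> extensional (verts (G \<times>\<^sub>g Iloop (fst (hconcat G x y))))"
  by (cases x; cases y) simp

lemma ext_const: "snd (const_htpy G f) \<in> extensional (verts (G \<times>\<^sub>g Iloop (fst (const_htpy G f))))"
  by (simp add: const_htpy_def)

lemma cells2_hconcat:
  assumes "f \<in> Arr Gph1" "g \<in> Arr Gph1" "h \<in> Arr Gph1" "x \<in> cells2 f g" "y \<in> cells2 g h"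
  shows "hconcat (src f) x y \<in> cells2 f h"
  using assms by (auto simp: cells2_iff ext_hconcat frames_hconcat intro: is_walk_glue)

text \<open>Unit and associativity laws hold already for the lists of frames; this turns them into
  relations between homotopies.\<close>

lemma cells2_relI:
  assumes "f \<in> Arr Gph1" "g \<in> Arr Gph1" "x \<in> cells2 f g" "y \<in> cells2 f g"
    "frames (src f) x = frames (src f) y"
  shows "(x, y) \<in> cells2_rel f g"
  using assms by (subst cells2_rel_iff) (auto simp: hrel_refl cells2_iff)

lemma cells2_const: "f \<in> Arr Gph1 \<Longrightarrow> const_htpy (src f) (body f) \<in> cells2 f f"
  by (auto simp: cells2_iff ext_const frames_const Arr_Gph1 gmor_ext is_walk_def)

lemma frames_const_Gph1: "f \<in> Arr Gph1 \<Longrightarrow> frames (src f) (const_htpy (src f) (body f)) = [body f]"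
  by (auto simp: frames_const Arr_Gph1 gmor_ext)

lemma quotient_Gph_vert: "quotient_data (Arr (Gph1 :: ('a graph, 'a graph_arrow) cat)) cells2 cells2_rel
    (\<lambda>f. const_htpy (src f) (body f)) (\<lambda>f. hconcat (src f))"
proof
  fix f g :: "'a graph_arrow" and x y z :: "'a htpy"
  assume fg: "f \<in> Arr Gph1" "g \<in> Arr Gph1"
  then have graphs: "is_graph (src f)" "is_graph (tgt f)"
    by (auto simp: Arr_Gph1)
  have par: "src f = src g \<and> tgt f = tgt g" if "x \<in> cells2 f g" for x :: "'a htpy"
    using that by (auto simp: cells2_def split: if_splits)
  show "(x, x) \<in> cells2_rel f g" if "x \<in> cells2 f g"
    using that fg par by (simp add: cells2_relI)
  show "y \<in> cells2 f g" "(y, x) \<in> cells2_rel f g" if "x \<in> cells2 f g" "(x, y) \<in> cells2_rel f g"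
    using that(2) fg par[OF that(1)] hrel_sym[OF graphs, of "frames (src f) x" "frames (src f) y"]
    by (auto simp: cells2_rel_iff)
  show "(x, z) \<in> cells2_rel f g" if "x \<in> cells2 f g" "(x, y) \<in> cells2_rel f g" "(y, z) \<in> cells2_rel f g"
    using that(2,3) fg par[OF that(1)] by (auto simp: cells2_rel_iff intro: hrel_trans)
  show "(hconcat (src f) (const_htpy (src f) (body f)) x, x) \<in> cells2_rel f g" if x: "x \<in> cells2 f g"
  proof (rule cells2_relI[OF fg])
    show "hconcat (src f) (const_htpy (src f) (body f)) x \<in> cells2 f g"
      using cells2_hconcat[OF fg(1,1,2) cells2_const[OF fg(1)] x] .
  next
    have "hd (frames (src f) x) = body f"
      using x fg by (auto simp: cells2_iff is_walk_def)
    then show "frames (src f) (hconcat (src f) (const_htpy (src f) (body f)) x) = frames (src f) x"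
      using fg frames_ne[of "src f" x]
      by (cases "frames (src f) x") (auto simp: frames_hconcat frames_const_Gph1)
  qed (rule x)
  show "(hconcat (src f) x (const_htpy (src g) (body g)), x) \<in> cells2_rel f g" if x: "x \<in> cells2 f g"
  proof (rule cells2_relI[OF fg])
    show "hconcat (src f) x (const_htpy (src g) (body g)) \<in> cells2 f g"
      using cells2_hconcat[OF fg fg(2) x cells2_const[OF fg(2)]] .
    show "frames (src f) (hconcat (src f) x (const_htpy (src g) (body g))) = frames (src f) x"
      using fg par[OF x] frames_const_Gph1[of g] by (simp add: frames_hconcat)
  qed (rule x)
next
  fix f g h x y x' y'
  assume *: "f \<in> Arr Gph1" "g \<in> Arr Gph1" "h \<in> Arr Gph1" "x \<in> cells2 f g" "y \<in> cells2 g h"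
  then show "hconcat (src f) x y \<in> cells2 f h"
    by (rule cells2_hconcat)
  have par: "src f = src g" "tgt f = tgt g" "src g = src h" "tgt g = tgt h"
    using * by (auto simp: cells2_iff)
  show "(hconcat (src f) x y, hconcat (src f) x' y') \<in> cells2_rel f h"
    if xy: "(x, x') \<in> cells2_rel f g" "(y, y') \<in> cells2_rel g h"
  proof -
    have "x' \<in> cells2 f g" "y' \<in> cells2 g h"
      using xy * par by (auto simp: cells2_rel_iff)
    moreover have "hrel (src f) (tgt f) (frames (src f) x @ tl (frames (src f) y))
        (frames (src f) x' @ tl (frames (src f) y'))"
      by (rule hrel_glue[of _ _ "body f" "body g" _ "body h"])
        (use xy * par in \<open>auto simp: cells2_rel_iff cells2_iff Arr_Gph1\<close>)
    ultimately show ?thesis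
      using *(1,3) par cells2_hconcat[OF *] cells2_hconcat[OF *(1-3), of x' y']
      by (simp add: cells2_rel_iff frames_hconcat)
  qed
next
  fix f g h k x y z
  assume *: "f \<in> Arr Gph1" "g \<in> Arr Gph1" "h \<in> Arr Gph1" "k \<in> Arr Gph1"
    "x \<in> cells2 f g" "y \<in> cells2 g h" "z \<in> cells2 h k"
  have par: "src f = src g"
    using * by (auto simp: cells2_iff)
  show "(hconcat (src f) (hconcat (src f) x y) z, hconcat (src f) x (hconcat (src g) y z)) \<in> cells2_rel f k"
  proof (rule cells2_relI)
    show "hconcat (src f) (hconcat (src f) x y) z \<in> cells2 f k"
      "hconcat (src f) x (hconcat (src g) y z) \<in> cells2 f k"
      using * cells2_hconcat by blast+
    show "frames (src f) (hconcat (src f) (hconcat (src f) x y) z) =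
        frames (src f) (hconcat (src f) x (hconcat (src g) y z))"
      using par by (simp add: frames_hconcat glue_assoc frames_ne)
  qed (use * in auto)
qed (rule cells2_const)

section \<open>Horizontal composition of homotopies\<close>

interpretation V: quotient_data "Arr Gph1" cells2 cells2_rel
  "\<lambda>f. const_htpy (src f) (body f)" "\<lambda>f. hconcat (src f)"
  by (rule quotient_Gph_vert)

lemma Gph_vert_simps [simp]: "Ob Gph_vert = Arr Gph1" "Dom Gph_vert = src" "Cod Gph_vert = tgt"
  "Ide Gph_vert f = cls cells2_rel f f (const_htpy (src f) (body f))"
  by (simp_all add: Gph_vert_quot)

lemma cells2_par: "x \<in> cells2 f g \<Longrightarrow> src f = src g \<and> tgt f = tgt g"
  by (auto simp: cells2_def split: if_splits)

lemma Arr_Gph_vertE: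
  assumes "\<alpha> \<in> Arr Gph_vert"
  obtains f g x where "f \<in> Arr Gph1" "g \<in> Arr Gph1" "src f = src g" "tgt f = tgt g"
    "x \<in> cells2 f g" "\<alpha> = cls cells2_rel f g x"
  using assms cells2_par unfolding Gph_vert_quot by (elim V.ArrE) blast

lemma Comp_vert_cls:
  assumes "f \<in> Arr Gph1" "g \<in> Arr Gph1" "h \<in> Arr Gph1" "x \<in> cells2 f g" "y \<in> cells2 g h"
  shows "Comp Gph_vert (cls cells2_rel g h y) (cls cells2_rel f g x) =
    cls cells2_rel f h (hconcat (src f) x y)"
  unfolding Gph_vert_quot by (rule V.Comp_cls[OF assms])

lemma category_Gph_vert: "category Gph_vert"
  unfolding Gph_vert_quot by (rule V.category)

lemma cls_in_Gph_vert:
  assumes "f \<in> Arr Gph1" "g \<in> Arr Gph1" "x \<in> cells2 f g"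
  shows "cls cells2_rel f g x \<in> Arr Gph_vert"
  unfolding Gph_vert_quot by (rule V.cls_in[OF assms])

abbreviation comp1 :: "'a graph_arrow \<Rightarrow> 'a graph_arrow \<Rightarrow> 'a graph_arrow" (infixl "\<odot>" 70) where
  "g \<odot> f \<equiv> Arrow (src f) (compose (verts (src f)) (body g) (body f)) (tgt g)"

lemma comp1_in: "f \<in> Arr Gph1 \<Longrightarrow> g \<in> Arr Gph1 \<Longrightarrow> tgt f = src g \<Longrightarrow> g \<odot> f \<in> Arr Gph1"
  by (auto simp: Arr_Gph1 compose_gmor)

text \<open>The horizontal composite of representatives. Only \<open>f'\<close> and \<open>g\<close>
  enter, because \<open>x\<close> whiskered with \<open>g\<close> ends at \<open>g\<close> after
  \<open>f'\<close>, where \<open>y\<close> whiskered with \<open>f'\<close> starts.\<close>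

definition hmul :: "'a graph_arrow \<Rightarrow> 'a graph_arrow \<Rightarrow> 'a htpy \<Rightarrow> 'a htpy \<Rightarrow> 'a htpy" where
  "hmul f' g x y = hconcat (src f') (post_htpy (src f') (body g) x) (pre_htpy (src f') y (body f'))"

lemma frames_hmul:
  assumes "f' \<in> Arr Gph1" "tgt f' = src g"
  shows "frames (src f') (hmul f' g x y) = map (compose (verts (src f')) (body g)) (frames (src f') x) @
    tl (map (\<lambda>h. compose (verts (src f')) h (body f')) (frames (src g) y))"
proof -
  have "frames (src f') (pre_htpy (src f') y (body f')) =
      map (\<lambda>h. compose (verts (src f')) h (body f')) (frames (src g) y)"
    by (rule frames_pre) (use assms gmor_verts in \<open>auto simp: Arr_Gph1\<close>)
  then show ?thesis
    by (simp add: hmul_def frames_hconcat frames_post)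
qed

text \<open>Representatives of two horizontally composable 2-cells. The laws of the 2-category
  interpret this locale at several such pairs at once.\<close>

locale hcomposable =
  fixes f f' g g' :: "'a graph_arrow" and x y :: "'a htpy"
  assumes f: "f \<in> Arr Gph1" "f' \<in> Arr Gph1" and g: "g \<in> Arr Gph1" "g' \<in> Arr Gph1"
    and fg: "tgt f = src g" and x: "x \<in> cells2 f f'" and y: "y \<in> cells2 g g'"
begin

lemma par: "src f' = src f" "tgt f' = src g" "src g' = src g" "tgt g' = tgt g" "tgt f = src g"
  using cells2_par[OF x] cells2_par[OF y] fg by simp_all

lemma graphs: "is_graph (src f)" "is_graph (src g)" "is_graph (tgt g)"
  using f g by (auto simp: Arr_Gph1)

lemma mors: "body f \<in> gmor (src f) (src g)" "body f' \<in> gmor (src f) (src g)"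
  "body g \<in> gmor (src g) (tgt g)" "body g' \<in> gmor (src g) (tgt g)"
  using f g par by (auto simp: Arr_Gph1)

lemma walk_x: "is_walk (hadj (src f) (src g)) (body f) (body f') (frames (src f) x)"
  and walk_y: "is_walk (hadj (src g) (tgt g)) (body g) (body g') (frames (src g) y)"
  using x y f g par by (auto simp: cells2_iff)

lemma walk_post: "is_walk (hadj (src f) (tgt g)) (compose (verts (src f)) (body g) (body f))
    (compose (verts (src f)) (body g) (body f')) (map (compose (verts (src f)) (body g)) (frames (src f) x))"
  by (rule is_walk_post[OF graphs(1) walk_x mors(3)])

lemma walk_pre: "is_walk (hadj (src f) (tgt g)) (compose (verts (src f)) (body g) (body f'))
    (compose (verts (src f)) (body g') (body f'))
    (map (\<lambda>h. compose (verts (src f)) h (body f')) (frames (src g) y))"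
  by (rule is_walk_pre[OF graphs(1) walk_y mors(2)])

lemma frames_hmul': "frames (src f) (hmul f' g x y) =
    map (compose (verts (src f)) (body g)) (frames (src f) x) @
    tl (map (\<lambda>h. compose (verts (src f)) h (body f')) (frames (src g) y))"
  using frames_hmul[OF f(2) par(2)] par(1) by simp

lemma comp_in: "g \<odot> f \<in> Arr Gph1" "g' \<odot> f' \<in> Arr Gph1" "g \<odot> f' \<in> Arr Gph1"
  using comp1_in[OF f(1) g(1)] comp1_in[OF f(2) g(2)] comp1_in[OF f(2) g(1)] par by simp_all

lemma hmul_in: "hmul f' g x y \<in> cells2 (g \<odot> f) (g' \<odot> f')"
proof -
  have "snd (hmul f' g x y) \<in> extensional (verts (src f \<times>\<^sub>g Iloop (fst (hmul f' g x y))))"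
    using ext_hconcat[of "src f"] par by (simp add: hmul_def)
  then show ?thesis
    unfolding cells2_iff[OF comp_in(1,2)]
    using is_walk_glue[OF walk_post walk_pre] par by (simp add: frames_hmul')
qed

text \<open>Independence of representatives: whiskering preserves \<open>hrel\<close> on both sides,
  and so does gluing the two whiskered lists.\<close>

lemma Comp_horz: "Comp Gph_horz (cls cells2_rel g g' y) (cls cells2_rel f f' x) =
    cls cells2_rel (g \<odot> f) (g' \<odot> f') (hmul f' g x y)"
proof -
  have *: "cells2_rel (g \<odot> f) (g' \<odot> f') `` {hmul f' g x' y'} =
      cells2_rel (g \<odot> f) (g' \<odot> f') `` {hmul f' g x y}"
    if xy: "(x, x') \<in> cells2_rel f f'" "(y, y') \<in> cells2_rel g g'" for x' y'
  proof (rule V.class_eqI[OF comp_in(1,2) hmul_in, symmetric])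
    have x': "x' \<in> cells2 f f'" "hrel (src f) (src g) (frames (src f) x) (frames (src f) x')"
      and y': "y' \<in> cells2 g g'" "hrel (src g) (tgt g) (frames (src g) y) (frames (src g) y')"
      using xy f g par by (auto simp: cells2_rel_iff)
    interpret h': hcomposable f f' g g' x' y'
      by unfold_locales (use f g fg x' y' in auto)
    have "hrel (src f) (tgt g) (frames (src f) (hmul f' g x y)) (frames (src f) (hmul f' g x' y'))"
      unfolding frames_hmul' h'.frames_hmul'
      by (rule hrel_glue[OF graphs(1,3) _ _ walk_post walk_pre])
        (use compose_gmor[OF graphs(1)] mors hrel_post[OF graphs(1) mors(3) x'(2)]
          hrel_pre[OF graphs(1) mors(2) y'(2)] in auto)
    then show "(hmul f' g x y, hmul f' g x' y') \<in> cells2_rel (g \<odot> f) (g' \<odot> f')"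
      using comp_in par hmul_in h'.hmul_in by (simp add: cells2_rel_iff)
  qed
  have refl: "x \<in> cells2_rel f f' `` {x}" "y \<in> cells2_rel g g' `` {y}"
    using V.R_refl[OF f x] V.R_refl[OF g y] by auto
  have "(\<Union>x' \<in> cells2_rel f f' `` {x}. \<Union>y' \<in> cells2_rel g g' `` {y}.
      cells2_rel (g \<odot> f) (g' \<odot> f') `` {hmul f' g x' y'}) =
    cells2_rel (g \<odot> f) (g' \<odot> f') `` {hmul f' g x y}"
    using * refl by blast
  then show ?thesis
    using par by (simp add: Gph_horz_def Let_def cls_def hmul_def cells2_rel_def)
qed

end

section \<open>The category of graphs and homotopies under horizontal composition\<close>

lemma Gph_horz_simps [simp]: "Ob Gph_horz = Ob Gph1" "Arr Gph_horz = Arr Gph_vert"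
  "Dom Gph_horz \<alpha> = src (src \<alpha>)" "Cod Gph_horz \<alpha> = tgt (src \<alpha>)"
  "Ide Gph_horz G = Ide Gph_vert (Ide Gph1 G)"
  by (simp_all add: Gph_horz_def)

lemma hcomposableE:
  assumes "\<alpha> \<in> Arr Gph_vert" "\<beta> \<in> Arr Gph_vert" "tgt (src \<alpha>) = src (src \<beta>)"
  obtains f f' g g' x y where "hcomposable f f' g g' x y"
    "\<alpha> = cls cells2_rel f f' x" "\<beta> = cls cells2_rel g g' y"
proof -
  obtain f f' x where \<alpha>: "f \<in> Arr Gph1" "f' \<in> Arr Gph1" "x \<in> cells2 f f'" "\<alpha> = cls cells2_rel f f' x"
    using Arr_Gph_vertE[OF assms(1)] .
  obtain g g' y where \<beta>: "g \<in> Arr Gph1" "g' \<in> Arr Gph1" "y \<in> cells2 g g'" "\<beta> = cls cells2_rel g g' y"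
    using Arr_Gph_vertE[OF assms(2)] .
  have "hcomposable f f' g g' x y"
    by unfold_locales (use \<alpha> \<beta> assms(3) in auto)
  then show ?thesis
    using that \<alpha> \<beta> by blast
qed

text \<open>Both bracketings have the same frames: the three homotopies run one after the other,
  each whiskered by the 1-cells around it. Only associativity of composition of maps is
  used.\<close>

lemma Comp_Gph_horz_assoc:
  fixes \<alpha> \<beta> \<gamma> :: "'a htpy_arrow"
  assumes *: "\<alpha> \<in> Arr Gph_vert" "\<beta> \<in> Arr Gph_vert" "\<gamma> \<in> Arr Gph_vert"
    "tgt (src \<alpha>) = src (src \<beta>)" "tgt (src \<beta>) = src (src \<gamma>)"
  shows "Comp Gph_horz \<gamma> (Comp Gph_horz \<beta> \<alpha>) = Comp Gph_horz (Comp Gph_horz \<gamma> \<beta>) \<alpha>"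
proof -
  obtain f f' g g' x y where h: "hcomposable f f' g g' x y"
    and eq: "\<alpha> = cls cells2_rel f f' x" "\<beta> = cls cells2_rel g g' y"
    using *(1,2,4) by (rule hcomposableE)
  interpret fg: hcomposable f f' g g' x y by (rule h)
  obtain k k' z where \<gamma>: "k \<in> Arr Gph1" "k' \<in> Arr Gph1" "z \<in> cells2 k k'" "\<gamma> = cls cells2_rel k k' z"
    using *(3) by (rule Arr_Gph_vertE)
  interpret gk: hcomposable g g' k k' y z
    by unfold_locales (use fg.g fg.y \<gamma> *(5) eq in auto)
  interpret fg_k: hcomposable "g \<odot> f" "g' \<odot> f'" k k' "hmul f' g x y" z
    by unfold_locales (use fg.comp_in fg.hmul_in \<gamma> gk.fg in auto)
  interpret f_gk: hcomposable f f' "k \<odot> g" "k' \<odot> g'" x "hmul g' k y z"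
    by unfold_locales (use fg.f gk.comp_in gk.hmul_in fg.x fg.fg in auto)
  let ?c = "compose (verts (src f))"
  have assoc: "k \<odot> (g \<odot> f) = (k \<odot> g) \<odot> f" "k' \<odot> (g' \<odot> f') = (k' \<odot> g') \<odot> f'"
    using compose_gmor_assoc[OF fg.mors(1)] compose_gmor_assoc[OF fg.mors(2)] fg.par by simp_all
  have "frames (src f) (hmul (g' \<odot> f') k (hmul f' g x y) z) = frames (src f) (hmul f' (k \<odot> g) x (hmul g' k y z))"
  proof -
    \<comment> \<open>Associativity of extensional composition needs the innermost map to land in
      the vertices of its target; here that map is a frame, and all frames of a homotopy between
      morphisms are morphisms.\<close>
    have "?c (body k) (?c (body g) h) = ?c (compose (verts (src g)) (body k) (body g)) h"
      if "h \<in> set (frames (src f) x)" for h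
      using compose_gmor_assoc is_walk_gmor(2)[OF fg.walk_x fg.mors(1) that] by blast
    moreover have "?c (body k) (?c h (body f')) = ?c (compose (verts (src g)) (body k) h) (body f')" for h :: "'a \<Rightarrow> 'a"
      using compose_gmor_assoc[OF fg.mors(2)] by blast
    moreover have "?c h (?c (body g') (body f')) = ?c (compose (verts (src g)) h (body g')) (body f')" for h :: "'a \<Rightarrow> 'a"
      using compose_gmor_assoc[OF fg.mors(2)] by blast
    ultimately show ?thesis
      using fg_k.frames_hmul' f_gk.frames_hmul' fg.frames_hmul' gk.frames_hmul' fg.par gk.par
      by (simp add: map_tl comp_def frames_ne tl_append2)
  qed
  then have "(hmul (g' \<odot> f') k (hmul f' g x y) z, hmul f' (k \<odot> g) x (hmul g' k y z)) \<in>
      cells2_rel ((k \<odot> g) \<odot> f) ((k' \<odot> g') \<odot> f')"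
    using fg_k.hmul_in f_gk.hmul_in f_gk.comp_in unfolding assoc by (intro cells2_relI) simp_all
  then have "cls cells2_rel ((k \<odot> g) \<odot> f) ((k' \<odot> g') \<odot> f') (hmul (g' \<odot> f') k (hmul f' g x y) z) =
      cls cells2_rel ((k \<odot> g) \<odot> f) ((k' \<odot> g') \<odot> f') (hmul f' (k \<odot> g) x (hmul g' k y z))"
    using V.cls_eqI[OF f_gk.comp_in(1,2)] fg_k.hmul_in unfolding assoc by blast
  then show ?thesis
    unfolding eq \<gamma>(4) fg.Comp_horz gk.Comp_horz fg_k.Comp_horz f_gk.Comp_horz assoc .
qed

text \<open>Whiskering with an identity fixes every frame, and the constant homotopy contributes a
  single frame that disappears in the concatenation.\<close>

lemma Comp_Gph_horz_units:
  assumes "\<alpha> \<in> Arr Gph_vert"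
  shows "Comp Gph_horz \<alpha> (Ide Gph_horz (src (src \<alpha>))) = \<alpha>"
    and "Comp Gph_horz (Ide Gph_horz (tgt (src \<alpha>))) \<alpha> = \<alpha>"
proof -
  obtain f f' x where f: "f \<in> Arr Gph1" "f' \<in> Arr Gph1" and par: "src f = src f'" "tgt f = tgt f'"
    and x: "x \<in> cells2 f f'" and \<alpha>: "\<alpha> = cls cells2_rel f f' x"
    using assms by (rule Arr_Gph_vertE)
  let ?i = "Ide Gph1 (src f)" and ?j = "Ide Gph1 (tgt f)"
  have ij: "?i \<in> Arr Gph1" "?j \<in> Arr Gph1"
    using f id_gmor by (auto simp: Arr_Gph1)
  have w: "is_walk (hadj (src f) (tgt f)) (body f) (body f') (frames (src f) x)"
    and m: "body f \<in> gmor (src f) (tgt f)" "body f' \<in> gmor (src f) (tgt f)"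
    using f par x by (auto simp: cells2_iff Arr_Gph1)
  have set: "h \<in> gmor (src f) (tgt f)" if "h \<in> set (frames (src f) x)" for h
    using is_walk_gmor(2)[OF w m(1) that] .
  interpret i: hcomposable ?i ?i f f' "const_htpy (src ?i) (body ?i)" x
    by unfold_locales (use f ij x cells2_const[OF ij(1)] in auto)
  interpret j: hcomposable f f' ?j ?j x "const_htpy (src ?j) (body ?j)"
    by unfold_locales (use f ij x cells2_const[OF ij(2)] in auto)
  have e: "f \<odot> ?i = f" "f' \<odot> ?i = f'" "?j \<odot> f = f" "?j \<odot> f' = f'"
    by (intro arrow.expand conjI; simp add: par[symmetric] compose_id_right[OF m(1)]
        compose_id_right[OF m(2)] compose_id_left[OF m(1)] compose_id_left[OF m(2)])+
  have mapid: "map (\<lambda>h. compose (verts (src f)) h (\<lambda>v\<in>verts (src f). v)) (frames (src f) x) = frames (src f) x"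
    "map (compose (verts (src f)) (\<lambda>v\<in>verts (tgt f). v)) (frames (src f) x) = frames (src f) x"
    using compose_id_right[OF set] compose_id_left[OF set] by (auto intro: map_idI)
  have "frames (src f) (hmul ?i f (const_htpy (src ?i) (body ?i)) x) = frames (src f) x"
  proof -
    have "frames (src f) (const_htpy (src f) (\<lambda>v\<in>verts (src f). v)) = [\<lambda>v\<in>verts (src f). v]"
      by (simp add: frames_const)
    moreover have "hd (frames (src f) x) = body f"
      using w by (simp add: is_walk_def)
    ultimately show ?thesis
      using i.frames_hmul' mapid compose_id_right[OF m(1)] frames_ne[of "src f" x]
      by (cases "frames (src f) x") auto
  qed
  then have "(hmul ?i f (const_htpy (src ?i) (body ?i)) x, x) \<in> cells2_rel f f'"
    using f x i.hmul_in unfolding e by (intro cells2_relI)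
  then have "cls cells2_rel f f' (hmul ?i f (const_htpy (src ?i) (body ?i)) x) = cls cells2_rel f f' x"
    using V.cls_eqI[OF f] i.hmul_in unfolding e by blast
  then show "Comp Gph_horz \<alpha> (Ide Gph_horz (src (src \<alpha>))) = \<alpha>"
    using i.Comp_horz unfolding e by (simp add: \<alpha>)
  have "frames (src f) (hmul f' ?j x (const_htpy (src ?j) (body ?j))) = frames (src f) x"
  proof -
    have "frames (tgt f) (const_htpy (tgt f) (\<lambda>v\<in>verts (tgt f). v)) = [\<lambda>v\<in>verts (tgt f). v]"
      by (simp add: frames_const)
    then show ?thesis
      using j.frames_hmul' mapid by simp
  qed
  then have "(hmul f' ?j x (const_htpy (src ?j) (body ?j)), x) \<in> cells2_rel f f'"
    using f x j.hmul_in unfolding e by (intro cells2_relI)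
  then have "cls cells2_rel f f' (hmul f' ?j x (const_htpy (src ?j) (body ?j))) = cls cells2_rel f f' x"
    using V.cls_eqI[OF f] j.hmul_in unfolding e by blast
  then show "Comp Gph_horz (Ide Gph_horz (tgt (src \<alpha>))) \<alpha> = \<alpha>"
    using j.Comp_horz unfolding e by (simp add: \<alpha>)
qed

lemma category_Gph_horz: "category Gph_horz"
proof
  fix \<alpha> \<beta> :: "'a htpy_arrow"
  assume "\<alpha> \<in> Arr Gph_horz" "\<beta> \<in> Arr Gph_horz" "Cod Gph_horz \<alpha> = Dom Gph_horz \<beta>"
  then have "\<alpha> \<in> Arr Gph_vert" "\<beta> \<in> Arr Gph_vert" "tgt (src \<alpha>) = src (src \<beta>)"
    by simp_all
  then obtain f f' g g' x y where h: "hcomposable f f' g g' x y"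
    and eq: "\<alpha> = cls cells2_rel f f' x" "\<beta> = cls cells2_rel g g' y"
    by (rule hcomposableE)
  interpret hcomposable f f' g g' x y by (rule h)
  show "Comp Gph_horz \<beta> \<alpha> \<in> Arr Gph_horz" "Dom Gph_horz (Comp Gph_horz \<beta> \<alpha>) = Dom Gph_horz \<alpha>"
    "Cod Gph_horz (Comp Gph_horz \<beta> \<alpha>) = Cod Gph_horz \<beta>"
    by (simp_all add: eq Comp_horz cls_in_Gph_vert comp_in hmul_in)
next
  fix \<alpha> :: "'a htpy_arrow"
  assume "\<alpha> \<in> Arr Gph_horz"
  then have "\<alpha> \<in> Arr Gph_vert"
    by simp
  then have "src \<alpha> \<in> Arr Gph1"
    by (rule Arr_Gph_vertE) simp
  then show "Dom Gph_horz \<alpha> \<in> Ob Gph_horz" "Cod Gph_horz \<alpha> \<in> Ob Gph_horz"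
    by (simp_all add: Arr_Gph1)
next
  fix G :: "'a graph"
  assume "G \<in> Ob Gph_horz"
  then have "Ide Gph1 G \<in> Arr Gph1"
    by (simp add: Arr_Gph1 id_gmor)
  then show "Ide Gph_horz G \<in> Arr Gph_horz"
    using cls_in_Gph_vert[OF _ _ cells2_const] by (simp del: Gph1_simps)
qed (simp_all del: Gph_horz_simps(5) add: Comp_Gph_horz_assoc Comp_Gph_horz_units, simp_all)


section \<open>The 2-category of graphs and its interchange law\<close>

lemma two_category_Gph: "two_category (Gph :: ('a graph, 'a graph_arrow, 'a htpy_arrow) two_cat)"
proof (rule two_category.intro)
  show "category (cells1 Gph)" "category (vert Gph)" "category (horz Gph)"
    by (simp_all add: Gph_def category_Gph1 category_Gph_vert category_Gph_horz)
next
  fix \<alpha> :: "'a htpy_arrow"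
  assume "\<alpha> \<in> Arr (vert Gph)"
  then have "\<alpha> \<in> Arr Gph_vert"
    by (simp add: Gph_def)
  then have "src (src \<alpha>) = src (tgt \<alpha>) \<and> tgt (src \<alpha>) = tgt (tgt \<alpha>)"
    by (rule Arr_Gph_vertE) simp
  then show "Dom (cells1 Gph) (Dom (vert Gph) \<alpha>) = Dom (horz Gph) \<alpha> \<and>
      Dom (cells1 Gph) (Cod (vert Gph) \<alpha>) = Dom (horz Gph) \<alpha>"
    "Cod (cells1 Gph) (Dom (vert Gph) \<alpha>) = Cod (horz Gph) \<alpha> \<and>
      Cod (cells1 Gph) (Cod (vert Gph) \<alpha>) = Cod (horz Gph) \<alpha>"
    by (simp_all add: Gph_def)
next
  fix f g :: "'a graph_arrow"
  assume "f \<in> Arr (cells1 Gph)" "g \<in> Arr (cells1 Gph)" "Cod (cells1 Gph) f = Dom (cells1 Gph) g"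
  then have fg: "f \<in> Arr Gph1" "g \<in> Arr Gph1" "tgt f = src g"
    by (simp_all add: Gph_def)
  interpret hcomposable f f g g "const_htpy (src f) (body f)" "const_htpy (src g) (body g)"
    by unfold_locales (use fg cells2_const in auto)
  have "frames (src f) (hmul f g (const_htpy (src f) (body f)) (const_htpy (src g) (body g))) =
      frames (src f) (const_htpy (src (g \<odot> f)) (body (g \<odot> f)))"
    using frames_const_Gph1[OF comp_in(1)] frames_const_Gph1[OF f(1)] frames_const_Gph1[OF g(1)]
    by (simp add: frames_hmul')
  then have "(hmul f g (const_htpy (src f) (body f)) (const_htpy (src g) (body g)),
      const_htpy (src (g \<odot> f)) (body (g \<odot> f))) \<in> cells2_rel (g \<odot> f) (g \<odot> f)"
    using hmul_in cells2_const[OF comp_in(1)] comp_in by (intro cells2_relI) simp_all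
  then show "Comp (horz Gph) (Ide (vert Gph) g) (Ide (vert Gph) f) = Ide (vert Gph) (Comp (cells1 Gph) g f)"
    using V.cls_eqI[OF comp_in(1,1) hmul_in] by (simp add: Gph_def Comp_horz)
next
  fix \<alpha> \<alpha>' \<beta> \<beta>' :: "'a htpy_arrow"
  assume "\<alpha> \<in> Arr (vert Gph)" "\<alpha>' \<in> Arr (vert Gph)" "\<beta> \<in> Arr (vert Gph)" "\<beta>' \<in> Arr (vert Gph)"
    "Cod (vert Gph) \<alpha> = Dom (vert Gph) \<alpha>'" "Cod (vert Gph) \<beta> = Dom (vert Gph) \<beta>'"
    "Cod (horz Gph) \<alpha> = Dom (horz Gph) \<beta>"
  then have *: "\<alpha> \<in> Arr Gph_vert" "\<alpha>' \<in> Arr Gph_vert" "\<beta> \<in> Arr Gph_vert" "\<beta>' \<in> Arr Gph_vert"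
    "tgt \<alpha> = src \<alpha>'" "tgt \<beta> = src \<beta>'" "tgt (src \<alpha>) = src (src \<beta>)"
    by (simp_all add: Gph_def)
  obtain f f' g g' x y where h: "hcomposable f f' g g' x y"
    and eq: "\<alpha> = cls cells2_rel f f' x" "\<beta> = cls cells2_rel g g' y"
    using *(1,3,7) by (rule hcomposableE)
  interpret xy: hcomposable f f' g g' x y by (rule h)
  have *: "\<alpha>' \<in> Arr Gph_vert" "\<beta>' \<in> Arr Gph_vert" "src \<alpha>' = f'" "src \<beta>' = g'"
    using * eq by auto
  obtain f'' x' where x': "f'' \<in> Arr Gph1" "x' \<in> cells2 f' f''" "\<alpha>' = cls cells2_rel f' f'' x'"
    using *(1,3) by (auto elim: Arr_Gph_vertE)
  obtain g'' y' where y': "g'' \<in> Arr Gph1" "y' \<in> cells2 g' g''" "\<beta>' = cls cells2_rel g' g'' y'"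
    using *(2,4) by (auto elim: Arr_Gph_vertE)
  interpret x'y': hcomposable f' f'' g' g'' x' y'
    by unfold_locales (use xy.f xy.g x' y' xy.par in auto)
  \<comment> \<open>Both sides of interchange begin with \<open>x\<close> whiskered by
    \<open>g\<close> and end with \<open>y'\<close> whiskered by \<open>f''\<close>. They differ in
    the order of \<open>x'\<close> and \<open>y\<close> in between, which this mixed pair
    describes.\<close>
  interpret x'y: hcomposable f' f'' g g' x' y
    by unfold_locales (use xy.f xy.g x' xy.y xy.par in auto)
  interpret t: hcomposable f f'' g g'' "hconcat (src f) x x'" "hconcat (src g) y y'"
    by unfold_locales (use xy.f xy.g x' y' xy.par cells2_hconcat[OF xy.f x'(1) xy.x x'(2)]
        cells2_hconcat[OF xy.g y'(1) xy.y y'(2)] in auto)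
  let ?c = "compose (verts (src f))"
  let ?X = "map (?c (body g)) (frames (src f) x)" and ?X' = "map (?c (body g)) (frames (src f) x')"
    and ?X'' = "map (?c (body g')) (frames (src f) x')"
    and ?Y = "map (\<lambda>h. ?c h (body f')) (frames (src g) y)" and ?Y' = "map (\<lambda>h. ?c h (body f'')) (frames (src g) y)"
    and ?Y'' = "map (\<lambda>h. ?c h (body f'')) (frames (src g) y')"
  \<comment> \<open>The exchange law in the middle; it is then glued to the common first and last
    pieces.\<close>
  have "hrel (src f) (tgt g) (?X' @ tl ?Y') (?Y @ tl ?X'')"
    using hrel_swap[OF x'y.graphs x'y.walk_x x'y.mors(1) x'y.walk_y x'y.mors(3)] xy.par by simp
  moreover have w: "is_walk (hadj (src f) (tgt g)) (?c (body g) (body f')) (?c (body g') (body f'')) (?X' @ tl ?Y')"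
    using is_walk_glue[OF x'y.walk_post x'y.walk_pre] xy.par by simp
  moreover have m: "?c (body g) (body f) \<in> gmor (src f) (tgt g)" "?c (body g) (body f') \<in> gmor (src f) (tgt g)"
    "?c (body g') (body f'') \<in> gmor (src f) (tgt g)"
    using compose_gmor[OF xy.graphs(1)] xy.mors x'y.mors xy.par by auto
  ultimately have "hrel (src f) (tgt g) (?X @ tl (?X' @ tl ?Y')) (?X @ tl (?Y @ tl ?X''))"
    using hrel_glue[OF xy.graphs(1,3) m(1,2) xy.walk_post w hrel_refl] by blast
  moreover have "is_walk (hadj (src f) (tgt g)) (?c (body g') (body f'')) (?c (body g'') (body f'')) ?Y''"
    using x'y'.walk_pre xy.par by simp
  ultimately have "hrel (src f) (tgt g) ((?X @ tl (?X' @ tl ?Y')) @ tl ?Y'') ((?X @ tl (?Y @ tl ?X'')) @ tl ?Y'')"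
    using hrel_glue[OF xy.graphs(1,3) m(1,3) is_walk_glue[OF xy.walk_post w] _ _ hrel_refl] by blast
  moreover have "frames (src f) (hmul f'' g (hconcat (src f) x x') (hconcat (src g) y y')) =
      (?X @ tl (?X' @ tl ?Y')) @ tl ?Y''"
    using t.frames_hmul' by (simp add: frames_hconcat frames_ne tl_append2 map_tl)
  moreover have "frames (src f) (hconcat (src f) (hmul f' g x y) (hmul f'' g' x' y')) =
      (?X @ tl (?Y @ tl ?X'')) @ tl ?Y''"
    using xy.frames_hmul' x'y'.frames_hmul' xy.par by (simp add: frames_hconcat frames_ne tl_append2 map_tl)
  moreover have in': "hconcat (src f) (hmul f' g x y) (hmul f'' g' x' y') \<in> cells2 (g \<odot> f) (g'' \<odot> f'')"
    using cells2_hconcat[OF xy.comp_in(1,2) x'y'.comp_in(2) xy.hmul_in x'y'.hmul_in] by simp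
  ultimately have "(hmul f'' g (hconcat (src f) x x') (hconcat (src g) y y'),
      hconcat (src f) (hmul f' g x y) (hmul f'' g' x' y')) \<in> cells2_rel (g \<odot> f) (g'' \<odot> f'')"
    using t.hmul_in t.comp_in(1,2) t.par by (simp add: cells2_rel_iff)
  then have e: "cls cells2_rel (g \<odot> f) (g'' \<odot> f'') (hmul f'' g (hconcat (src f) x x') (hconcat (src g) y y')) =
      cls cells2_rel (g \<odot> f) (g'' \<odot> f'') (hconcat (src f) (hmul f' g x y) (hmul f'' g' x' y'))"
    by (rule V.cls_eqI[OF t.comp_in(1,2) t.hmul_in])
  have "Comp Gph_vert \<alpha>' \<alpha> = cls cells2_rel f f'' (hconcat (src f) x x')"
    "Comp Gph_vert \<beta>' \<beta> = cls cells2_rel g g'' (hconcat (src g) y y')"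
    unfolding eq x'(3) y'(3) by (simp_all add: Comp_vert_cls xy.f xy.g xy.x xy.y x' y')
  moreover have "Comp Gph_vert (Comp Gph_horz \<beta>' \<alpha>') (Comp Gph_horz \<beta> \<alpha>) =
      cls cells2_rel (g \<odot> f) (g'' \<odot> f'') (hconcat (src f) (hmul f' g x y) (hmul f'' g' x' y'))"
    unfolding eq x'(3) y'(3) xy.Comp_horz x'y'.Comp_horz
    using Comp_vert_cls[OF xy.comp_in(1,2) x'y'.comp_in(2) xy.hmul_in x'y'.hmul_in] by simp
  ultimately show "Comp (horz Gph) (Comp (vert Gph) \<beta>' \<beta>) (Comp (vert Gph) \<alpha>' \<alpha>) =
      Comp (vert Gph) (Comp (horz Gph) \<beta>' \<alpha>') (Comp (horz Gph) \<beta> \<alpha>)"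
    using t.Comp_horz e by (simp add: Gph_def)
qed (simp_all add: Gph_def Gph_horz_def Let_def)

section \<open>Finite graphs and homotopy classes of morphisms\<close>

lemma htpc_rel_iff:
  assumes "is_graph G" "is_graph H"
  shows "(f, g) \<in> htpc_rel G H \<longleftrightarrow> f \<in> gmor G H \<and> g \<in> gmor G H \<and> (\<exists>L. is_walk (hadj G H) f g L)"
proof
  assume "(f, g) \<in> htpc_rel G H"
  then obtain x where "f \<in> gmor G H" "g \<in> gmor G H" "x \<in> htpies G H f g"
    by (auto simp: htpc_rel_def)
  then show "f \<in> gmor G H \<and> g \<in> gmor G H \<and> (\<exists>L. is_walk (hadj G H) f g L)"
    using htpies_iff[OF assms] by blast
next
  assume "f \<in> gmor G H \<and> g \<in> gmor G H \<and> (\<exists>L. is_walk (hadj G H) f g L)"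
  then show "(f, g) \<in> htpc_rel G H"
    using ex_frames[OF assms] by (fastforce simp: htpc_rel_def)
qed

abbreviation finite_graphs :: "'a graph set" where
  "finite_graphs \<equiv> {G. is_graph G \<and> no_isolated G \<and> finite (verts G)}"

lemma hFGph_quot: "hFGph = quot_cat finite_graphs gmor htpc_rel (\<lambda>G. \<lambda>v\<in>verts G. v)
    (\<lambda>G f g. compose (verts G) g f)"
  by (simp add: hFGph_def quot_cat_def)

text \<open>With homotopies as walks of morphisms, symmetry is reversal and transitivity is
  concatenation. Congruence concatenates the two whiskered walks, as in horizontal
  composition.\<close>

lemma quotient_hFGph: "quotient_data finite_graphs gmor htpc_rel (\<lambda>G. \<lambda>v\<in>verts G. v)
    (\<lambda>G f g. compose (verts G) g f)"
proof
  fix G H :: "'a graph" and f g h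
  assume GH: "G \<in> finite_graphs" "H \<in> finite_graphs"
  then have graphs: "is_graph G" "is_graph H"
    by auto
  note rel = htpc_rel_iff[OF graphs]
  show refl: "(f, f) \<in> htpc_rel G H" if "f \<in> gmor G H" for f
    using that by (auto simp: rel is_walk_def intro!: exI[of _ "[f]"])
  show "(compose (verts G) f (\<lambda>v\<in>verts G. v), f) \<in> htpc_rel G H"
    "(compose (verts G) (\<lambda>v\<in>verts H. v) f, f) \<in> htpc_rel G H" if "f \<in> gmor G H"
    using refl[OF that] compose_id_left[OF that] compose_id_right[OF that] by simp_all
  show "g \<in> gmor G H" if "(f, g) \<in> htpc_rel G H"
    using that by (simp add: rel)
  have "symp (hadj G H)"
    using hadj_sym[OF graphs] by (blast intro: sympI)
  then show "(g, f) \<in> htpc_rel G H" if "(f, g) \<in> htpc_rel G H"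
    using that is_walk_rev[of "hadj G H" f g] unfolding rel by blast
  show "(f, h) \<in> htpc_rel G H" if "(f, g) \<in> htpc_rel G H" "(g, h) \<in> htpc_rel G H"
    using that is_walk_glue[of "hadj G H" f g _ h] unfolding rel by blast
next
  fix G H K :: "'a graph" and f f' g g'
  assume "G \<in> finite_graphs" "H \<in> finite_graphs" "K \<in> finite_graphs"
    and fg: "f \<in> gmor G H" "g \<in> gmor H K"
  then have graphs: "is_graph G" "is_graph H" "is_graph K"
    by auto
  show "compose (verts G) g f \<in> gmor G K"
    by (rule compose_gmor[OF graphs(1) fg])
  show "(compose (verts G) g f, compose (verts G) g' f') \<in> htpc_rel G K"
    if r: "(f, f') \<in> htpc_rel G H" "(g, g') \<in> htpc_rel H K"
  proof -
    obtain L M where *: "f' \<in> gmor G H" "g' \<in> gmor H K" "is_walk (hadj G H) f f' L" "is_walk (hadj H K) g g' M"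
      using r by (auto simp: htpc_rel_iff graphs)
    show ?thesis
      using is_walk_glue[OF is_walk_post[OF graphs(1) *(3) fg(2)] is_walk_pre[OF graphs(1) *(4,1)]]
        compose_gmor[OF graphs(1)] fg * by (auto simp: htpc_rel_iff graphs)
  qed
next
  fix G H K J :: "'a graph" and f g h
  assume "G \<in> finite_graphs" "J \<in> finite_graphs"
    and fgh: "f \<in> gmor G H" "g \<in> gmor H K" "h \<in> gmor K J"
  then have graphs: "is_graph G" "is_graph J"
    by auto
  have "compose (verts G) h (compose (verts G) g f) \<in> gmor G J"
    using compose_gmor[OF graphs(1)] fgh by blast
  moreover have "is_walk (hadj G J) f f [f]" for f
    by (simp add: is_walk_def)
  ultimately show "(compose (verts G) h (compose (verts G) g f), compose (verts G) (compose (verts H) h g) f) \<in> htpc_rel G J"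
    unfolding compose_gmor_assoc[OF fgh(1), symmetric] htpc_rel_iff[OF graphs] by blast
qed (simp add: id_gmor)

section \<open>The natural transformation of a homotopy\<close>

text \<open>The last morphism is evaluated at \<open>v\<close> only, so the constant homotopy of
  length 0 gives the trivial walk and concatenation is respected on the nose.\<close>

fun trace :: "'a \<Rightarrow> 'a \<Rightarrow> ('a \<Rightarrow> 'b) list \<Rightarrow> 'b list" where
  "trace w v [] = []"
| "trace w v [f] = [f v]"
| "trace w v (f # g # L) = f v # f w # trace w v (g # L)"

lemma trace_Cons: "trace w v (f # L) = f v # (if L = [] then [] else f w # trace w v L)"
  by (cases L) simp_all

lemma trace_ne: "L \<noteq> [] \<Longrightarrow> trace w v L \<noteq> []"
  and hd_trace: "L \<noteq> [] \<Longrightarrow> hd (trace w v L) = hd L v"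
  by (cases L; simp add: trace_Cons)+

lemma last_trace: "L \<noteq> [] \<Longrightarrow> last (trace w v L) = last L v"
  by (induction w v L rule: trace.induct) (auto simp: trace_ne)

lemma length_trace: "length L = length L' \<Longrightarrow> length (trace w v L) = length (trace w' v' L')"
  by (induction L L' rule: list_induct2) (auto simp: trace_Cons)

lemma trace_glue: "L \<noteq> [] \<Longrightarrow> M \<noteq> [] \<Longrightarrow> last L = hd M \<Longrightarrow>
    trace w v (L @ tl M) = trace w v L @ tl (trace w v M)"
  by (induction w v L rule: trace.induct) (auto simp: trace_Cons neq_Nil_conv)

text \<open>For precomposition with a morphism \<open>F'\<close>: the original list is traced over
  the images of \<open>v\<close> and \<open>w\<close>. The neighbour \<open>F' w\<close> of
  \<open>F' v\<close> that results need not be a chosen one.\<close>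

lemma trace_map: "trace w v (map F L) = trace (F' w) (F' v) L"
  if "\<And>f. f \<in> set L \<Longrightarrow> F f v = f (F' v) \<and> F f w = f (F' w)"
  using that by (induction L) (auto simp: trace_Cons)

text \<open>For postcomposition with a morphism \<open>p\<close>: the functor induced by
  \<open>p\<close> acts on walks entry by entry.\<close>

lemma map_trace: "trace w v (map F L) = map p (trace w v L)"
  if "\<And>f. f \<in> set L \<Longrightarrow> F f v = p (f v) \<and> F f w = p (f w)"
  using that by (induction L) (auto simp: trace_Cons)

text \<open>Two uses in one statement: \<open>L = L'\<close> gives independence of the neighbour,
  \<open>w = w'\<close> gives invariance under homotopy rel endpoints.\<close>

lemma trace_step:
  assumes G: "is_graph G" and H: "is_graph H" and vw: "adj G v w" "adj G v w'"
    and s: "step (hcross G H) L L'"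
  shows "step (cross (adj H)) (trace w v L) (trace w' v L')"
proof -
  have "successively (cross (adj H)) (zip (trace w v L) (trace w' v L'))"
    if "length L = length L'" "successively (hcross G H) (zip L L')" for L L'
    using that
  proof (induction L L' rule: list_induct2)
    case (Cons f L f' L')
    show ?case
    proof (cases "L = []")
      case True
      with Cons show ?thesis by simp
    next
      case False
      then obtain g M g' M' where L: "L = g # M" "L' = g' # M'"
        using Cons.hyps by (cases L; cases L') auto
      have h: "hcross G H (f, f') (g, g')" and IH: "successively (cross (adj H)) (zip (trace w v L) (trace w' v L'))"
        using Cons.prems Cons.IH L by auto
      have "hadj G H f f" "hadj G H f' f'" "hadj G H f f'" "hadj G H f' f"
        using h hadj_sym[OF G H, of f f'] hadj_gmor[of G H f f'] by (auto simp: hcross_def hadj_refl)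
      \<comment> \<open>A pair inside one frame of the two lists: here the adjacency of
        \<open>f\<close> and \<open>f'\<close> themselves is needed, the additional clause of
        \<open>hcross\<close>. The next fact treats the passage to the following frame, along the
        edge from \<open>w\<close> back to \<open>v\<close>.\<close>
      then have 1: "cross (adj H) (f v, f' v) (f w, f' w')"
        using vw by (simp add: cross_def hadj_def)
      have 2: "cross (adj H) (f w, f' w') (g v, g' v)"
        using h vw adj_sym[OF G] by (auto simp: hcross_def cross_def hadj_def)
      have "hd (zip (trace w v L) (trace w' v L')) = (g v, g' v)"
        using L by (simp add: hd_zip trace_ne hd_trace)
      then show ?thesis
        using 1 2 IH L by (simp add: successively_Cons)
    qed
  qed simp
  moreover have "L' \<noteq> []"
    using s by (auto simp: step_def)
  ultimately show ?thesis
    using s length_trace[of L L' w v w' v] by (auto simp: step_def trace_ne hd_trace last_trace)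
qed

lemma trace_is_walk:
  assumes G: "is_graph G" and H: "is_graph H" and vw: "adj G v w" and L: "is_walk (hadj G H) f g L"
  shows "is_walk (adj H) (f v) (g v) (trace w v L)"
  using trace_step[OF G H vw vw step_hcross_refl[OF L]] L
  by (simp add: step_refl cross_def is_walk_def hd_trace last_trace)

text \<open>With \<open>u\<close> as neighbour of \<open>v\<close> and \<open>v\<close> as neighbour
  of \<open>u\<close>, both walks have the \<open>i\<close>th morphism at \<open>u\<close> in
  position \<open>2 * i + 1\<close>. In the even positions after the first, the right walk lags one
  morphism behind the left one at \<open>v\<close>, and successive morphisms are adjacent.\<close>

lemma trace_edge:
  assumes G: "is_graph G" and H: "is_graph H" and vu: "adj G v u"
    and L: "is_walk (hadj G H) f g L" and f: "f \<in> gmor G H"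
  shows "step (cross (adj H)) (trace u v L @ [g u]) (f v # trace v u L)"
proof -
  \<comment> \<open>In the recursion the entry in front of the right walk is the value at
    \<open>v\<close> of the previous morphism; hence the arbitrary \<open>a\<close>, adjacent to the
    first value at \<open>u\<close>.\<close>
  have *: "successively (cross (adj H)) (zip (trace u v L @ [last L u]) (a # trace v u L))"
    if "L \<noteq> []" "successively (hadj G H) L" "hd L \<in> gmor G H" "adj H a (hd L u)" for L a
    using that
  proof (induction L arbitrary: a)
    case (Cons f L)
    have "hadj G H f f"
      using Cons.prems(3) by (simp add: hadj_refl)
    then have fvu: "adj H (f v) (f u)" "adj H (f u) (f v)"
      using vu adj_sym[OF G vu] by (auto simp: hadj_def)
    show ?case
    proof (cases L)
      case Nil
      then show ?thesis
        using fvu Cons.prems(4) by (simp add: cross_def)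
    next
      case [simp]: (Cons g M)
      have fg: "hadj G H f g"
        using Cons.prems(2) by simp
      then have "adj H (f v) (g u)" "adj H (f u) (g v)"
        using vu adj_sym[OF G vu] by (auto simp: hadj_def)
      moreover have "successively (cross (adj H)) (zip (trace u v L @ [last L u]) (f v # trace v u L))"
        using Cons.IH[of "f v"] Cons.prems(2) hadj_gmor[OF fg] \<open>adj H (f v) (g u)\<close> by simp
      moreover have "trace u v L = g v # tl (trace u v L)"
        by (simp add: trace_Cons)
      ultimately show ?thesis
        using fvu Cons.prems(4)
        by (simp add: successively_Cons cross_def hd_zip) (metis append_Cons list.sel(1) successively.simps(3) zip_Cons_Cons)
    qed
  qed simp
  have "L \<noteq> []" "hd L = f" "last L = g" "successively (hadj G H) L"
    using L by (auto simp: is_walk_def)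
  then show ?thesis
    using *[of L "f v"] gmor_edge[OF f vu] f length_trace[of L L u v v u]
    by (simp add: step_def trace_ne hd_trace last_trace)
qed

text \<open>Induction along \<open>\<alpha>\<close>, one naturality square per edge.
  \<open>trace_edge\<close> needs the two ends of the edge as neighbours of each other, so the
  neighbour is changed at every vertex by \<open>trace_step\<close>; this is why \<open>w\<close> is
  arbitrary in the induction.\<close>

lemma trace_natural:
  fixes G H :: "'a graph"
  assumes G: "is_graph G" and H: "is_graph H"
    and L: "is_walk (hadj G H) f g L" and f: "f \<in> gmor G H" and u: "adj G u w'"
  shows "\<alpha> \<in> walks G v u \<Longrightarrow> adj G v w \<Longrightarrow>
    (map f \<alpha> @ tl (trace w' u L), trace w v L @ tl (map g \<alpha>)) \<in> walk_rel H (f v) (g u)"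
proof (induction \<alpha> arbitrary: v w)
  case Nil
  then show ?case by (simp add: walks_def)
next
  case (Cons a \<alpha>)
  have g: "g \<in> gmor G H"
    using is_walk_gmor(1)[OF L f] .
  have tr: "trace w v L \<in> walks H (f v) (g v)" if "adj G v w" for v w
    using trace_is_walk[OF G H that L] gmor_verts[OF f] adj_verts[OF G that] by (simp add: walks_iff[OF H])
  have ind: "(trace w v L, trace w' v L) \<in> walk_rel H (f v) (g v)" if "adj G v w" "adj G v w'" for v w w'
    using gmor_verts[OF f] adj_verts[OF G that(1)]
    by (intro walk_rel_step[OF H _ tr[OF that(1)] tr[OF that(2)] trace_step[OF G H that step_hcross_refl[OF L]]]) simp
  have v: "v \<in> verts G"
    using adj_verts[OF G Cons.prems(2)] by simp
  show ?case
  proof (cases "\<alpha> = []")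
    case True
    then have a: "a = v" "u = v"
      using Cons.prems(1) by (auto simp: walks_def)
    have "f v # tl (trace w' v L) = trace w' v L"
      using walks_ne[OF tr[OF u]] a by (cases "trace w' v L") auto
    then show ?thesis
      using ind[of v w' w] Cons.prems u a True by simp
  next
    case False
    define z where "z = hd \<alpha>"
    have a: "a = v" "adj G v z" and \<alpha>: "\<alpha> \<in> walks G z u"
      using Cons.prems walks_Cons_iff[OF G False] by (auto simp: z_def)
    have zv: "adj G z v"
      using adj_sym[OF G a(2)] .
    note ne = walks_ne[OF tr[OF u]] walks_ne[OF tr[OF zv]] walks_ne[OF \<alpha>]
    have e: "[f v, f z] \<in> walks H (f v) (f z)" "[g v, g z] \<in> walks H (g v) (g z)"
      using walks_edge[OF H] gmor_edge[OF f a(2)] gmor_edge[OF g a(2)] by auto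
    have f\<alpha>: "map f \<alpha> \<in> walks H (f z) (f u)" and g\<alpha>: "map g \<alpha> \<in> walks H (g z) (g u)"
      using walks_map[OF G H] f g \<alpha> by auto
    have l: "map f \<alpha> @ tl (trace w' u L) \<in> walks H (f z) (g u)"
      using walks_glue[OF H f\<alpha> tr[OF u]] .
    \<comment> \<open>The induction hypothesis is taken with \<open>v\<close> as the neighbour of
      \<open>z\<close>, pointing back along the edge just split off.\<close>
    have "([f v, f z] @ tl (map f \<alpha> @ tl (trace w' u L)), [f v, f z] @ tl (trace v z L @ tl (map g \<alpha>)))
        \<in> walk_rel H (f v) (g u)"
      by (rule walk_rel_glue[OF H e(1) l walk_rel_refl Cons.IH[OF \<alpha> zv]])
    moreover have "[f v, f z] @ tl (map f \<alpha> @ tl (trace w' u L)) = map f (a # \<alpha>) @ tl (trace w' u L)"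
      using False ne a(1) by (cases \<alpha>) auto
    moreover have t: "[f v, f z] @ tl (trace v z L) = f v # trace v z L"
      using ne by (cases "trace v z L") auto
    moreover have "[f v, f z] @ tl (trace v z L @ tl (map g \<alpha>)) = (f v # trace v z L) @ tl (map g \<alpha>)"
      using ne by (cases "trace v z L") auto
    ultimately have 1: "(map f (a # \<alpha>) @ tl (trace w' u L), (f v # trace v z L) @ tl (map g \<alpha>))
        \<in> walk_rel H (f v) (g u)"
      by simp
    have r: "f v # trace v z L \<in> walks H (f v) (g z)"
      using walks_glue[OF H e(1) tr[OF zv]] t by simp
    have r': "trace z v L @ [g z] \<in> walks H (f v) (g z)"
      using walks_glue[OF H tr[OF a(2)] e(2)] by simp
    \<comment> \<open>The square of the edge from \<open>v\<close> to \<open>z\<close>.\<close>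
    have "(trace z v L @ [g z], f v # trace v z L) \<in> walk_rel H (f v) (g z)"
      by (rule walk_rel_step[OF H gmor_verts[OF f v] r' r trace_edge[OF G H a(2) L f]])
    \<comment> \<open>At \<open>v\<close> the given neighbour \<open>w\<close> is replaced by the
      next vertex \<open>z\<close>.\<close>
    moreover have "(trace w v L @ tl [g v, g z], trace z v L @ tl [g v, g z]) \<in> walk_rel H (f v) (g z)"
      by (rule walk_rel_glue[OF H tr[OF Cons.prems(2)] e(2) ind[OF Cons.prems(2) a(2)] walk_rel_refl])
    ultimately have "(f v # trace v z L, trace w v L @ [g z]) \<in> walk_rel H (f v) (g z)"
      using walk_rel_trans walk_rel_sym by fastforce
    from walk_rel_glue[OF H r g\<alpha> this walk_rel_refl]
    have "((f v # trace v z L) @ tl (map g \<alpha>), (trace w v L @ [g z]) @ tl (map g \<alpha>)) \<in> walk_rel H (f v) (g u)" .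
    moreover have "(trace w v L @ [g z]) @ tl (map g \<alpha>) = trace w v L @ tl (map g (a # \<alpha>))"
      using ne(3) by (cases \<alpha>) auto
    ultimately show ?thesis
      using walk_rel_trans[OF 1] by simp
  qed
qed

definition neighbour :: "'a graph \<Rightarrow> 'a \<Rightarrow> 'a" where
  "neighbour G v = (SOME w. adj G v w)"

lemma adj_neighbour: "no_isolated G \<Longrightarrow> v \<in> verts G \<Longrightarrow> adj G v (neighbour G v)"
  unfolding neighbour_def no_isolated_def by (metis (no_types, lifting) someI_ex)

text \<open>The ends are read off from the list, so the family depends on \<open>L\<close> alone and
  lists related by \<open>hrel\<close> can give equal families.\<close>

definition walk_trans :: "'a graph \<Rightarrow> 'a graph \<Rightarrow> ('a \<Rightarrow> 'a) list \<Rightarrow> 'a \<Rightarrow> 'a walk_arrow" where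
  "walk_trans G H L =
     (\<lambda>v\<in>verts G. cls (walk_rel H) (hd L v) (last L v) (trace (neighbour G v) v L))"

locale hwalk =
  fixes G H :: "'a graph" and f g :: "'a \<Rightarrow> 'a" and L
  assumes G: "is_graph G" and H: "is_graph H" and iso: "no_isolated G"
    and L: "is_walk (hadj G H) f g L" and f: "f \<in> gmor G H"
begin

sublocale cod: quotient_data "verts H" "walks H" "walk_rel H" "\<lambda>v. [v]" "\<lambda>_ \<alpha> \<beta>. \<alpha> @ tl \<beta>"
  by (rule quotient_fund_groupoid[OF H])

sublocale dom: quotient_data "verts G" "walks G" "walk_rel G" "\<lambda>v. [v]" "\<lambda>_ \<alpha> \<beta>. \<alpha> @ tl \<beta>"
  by (rule quotient_fund_groupoid[OF G])

lemma g: "g \<in> gmor G H"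
  using is_walk_gmor(1)[OF L f] .

lemma verts: "v \<in> verts G \<Longrightarrow> f v \<in> verts H" "v \<in> verts G \<Longrightarrow> g v \<in> verts H"
  using gmor_verts[OF f] gmor_verts[OF g] by auto

lemma ends: "L \<noteq> []" "hd L = f" "last L = g"
  using L by (auto simp: is_walk_def)

lemma trace_in: "adj G v w \<Longrightarrow> trace w v L \<in> walks H (f v) (g v)"
  using trace_is_walk[OF G H _ L] adj_verts[OF G] verts by (simp add: walks_iff[OF H])

text \<open>Any neighbour computes the component. Horizontal composites depend on this freedom: the
  neighbour of \<open>g v\<close> that arises there is the image under \<open>g\<close> of a
  neighbour of \<open>v\<close>.\<close>

lemma walk_trans_eq: "adj G v w \<Longrightarrow> walk_trans G H L v = cls (walk_rel H) (f v) (g v) (trace w v L)"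
proof -
  assume vw: "adj G v w"
  then have v: "v \<in> verts G"
    using adj_verts[OF G] by blast
  have n: "adj G v (neighbour G v)"
    by (rule adj_neighbour[OF iso v])
  have "(trace (neighbour G v) v L, trace w v L) \<in> walk_rel H (f v) (g v)"
    by (rule walk_rel_step[OF H verts(1)[OF v] trace_in[OF n] trace_in[OF vw]
          trace_step[OF G H n vw step_hcross_refl[OF L]]])
  then show ?thesis
    using cod.cls_eqI[OF verts(1)[OF v] verts(2)[OF v] trace_in[OF n]] v
    by (simp add: walk_trans_def ends)
qed

lemma walk_trans_in:
  "walk_trans G H L \<in> nat_trans (fund_groupoid G) (fund_groupoid H) (induced_functor G f H) (induced_functor G g H)"
proof (rule nat_transI)
  fix v assume "v \<in> Ob (fund_groupoid G)"
  then have v: "v \<in> verts G"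
    by (simp add: fund_groupoid_def)
  then show "walk_trans G H L v \<in> Arr (fund_groupoid H) \<and>
      Dom (fund_groupoid H) (walk_trans G H L v) = fst (induced_functor G f H) v \<and>
      Cod (fund_groupoid H) (walk_trans G H L v) = fst (induced_functor G g H) v"
    using walk_trans_eq[OF adj_neighbour[OF iso v]] cod.cls_in[OF verts(1)[OF v] verts(2)[OF v] trace_in[OF adj_neighbour[OF iso v]]]
    by (simp add: fund_groupoid_quot induced_functor_def)
next
  fix a assume "a \<in> Arr (fund_groupoid G)"
  then obtain v u \<alpha> where vu: "v \<in> verts G" "u \<in> verts G" and \<alpha>: "\<alpha> \<in> walks G v u" and a: "a = cls (walk_rel G) v u \<alpha>"
    unfolding fund_groupoid_quot by (rule dom.ArrE)
  have n: "adj G v (neighbour G v)" "adj G u (neighbour G u)"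
    using adj_neighbour[OF iso] vu by auto
  have m: "map f \<alpha> \<in> walks H (f v) (f u)" "map g \<alpha> \<in> walks H (g v) (g u)"
    using walks_map[OF G H] f g \<alpha> by auto
  have "Comp (fund_groupoid H) (walk_trans G H L u) (snd (induced_functor G f H) a) =
      cls (walk_rel H) (f v) (g u) (map f \<alpha> @ tl (trace (neighbour G u) u L))"
    unfolding a snd_induced_functor[OF G H f \<alpha>] walk_trans_eq[OF n(2)] fund_groupoid_quot
    using vu verts trace_in n m by (intro cod.Comp_cls) auto
  also have "\<dots> = cls (walk_rel H) (f v) (g u) (trace (neighbour G v) v L @ tl (map g \<alpha>))"
    using vu verts walks_glue[OF H m(1) trace_in[OF n(2)]] trace_natural[OF G H L f n(2) \<alpha> n(1)]
    by (intro cod.cls_eqI) auto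
  also have "\<dots> = Comp (fund_groupoid H) (snd (induced_functor G g H) a) (walk_trans G H L v)"
    unfolding a snd_induced_functor[OF G H g \<alpha>] walk_trans_eq[OF n(1)] fund_groupoid_quot
    using vu verts trace_in n m by (intro cod.Comp_cls[symmetric]) auto
  finally show "Comp (fund_groupoid H) (walk_trans G H L (Cod (fund_groupoid G) a)) (snd (induced_functor G f H) a) =
      Comp (fund_groupoid H) (snd (induced_functor G g H) a) (walk_trans G H L (Dom (fund_groupoid G) a))"
    by (simp add: a)
qed (simp add: walk_trans_def)

text \<open>Along the chain of steps the chosen neighbour stays fixed and \<open>trace_step\<close>
  relates the two traces.\<close>

lemma walk_trans_hrel:
  assumes "hrel G H L L'"
  shows "walk_trans G H L = walk_trans G H L'"
  using assms unfolding hrel_def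
proof (induction rule: rtranclp_induct)
  case (step M N)
  have w: "is_walk (hadj G H) f g M"
    using hrel_is_walk[OF G H f L] step.hyps(1) by (simp add: hrel_def)
  have w': "is_walk (hadj G H) f g N"
    by (rule step_hcross_is_walk[OF G H f w step.hyps(2)])
  interpret M: hwalk G H f g M by (rule hwalk.intro[OF G H iso w f])
  interpret N: hwalk G H f g N by (rule hwalk.intro[OF G H iso w' f])
  have "walk_trans G H M v = walk_trans G H N v" if v: "v \<in> verts G" for v
  proof -
    have n: "adj G v (neighbour G v)"
      by (rule adj_neighbour[OF iso v])
    have "(trace (neighbour G v) v M, trace (neighbour G v) v N) \<in> walk_rel H (f v) (g v)"
      by (rule walk_rel_step[OF H verts(1)[OF v] M.trace_in[OF n] N.trace_in[OF n] trace_step[OF G H n n step.hyps(2)]])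
    then show ?thesis
      unfolding M.walk_trans_eq[OF n] N.walk_trans_eq[OF n]
      using cod.cls_eqI[OF verts(1)[OF v] verts(2)[OF v] M.trace_in[OF n]] by simp
  qed
  then have "walk_trans G H M = walk_trans G H N"
    by (intro extensionalityI[of _ "verts G"]) (simp_all add: walk_trans_def)
  with step.IH show ?case by simp
qed simp

end

lemma (in hwalk) walk_trans_glue:
  assumes "hwalk G H g h M"
  shows "walk_trans G H (L @ tl M) =
    vcomp (fund_groupoid G) (fund_groupoid H) (walk_trans G H M) (walk_trans G H L)"
proof -
  interpret M: hwalk G H g h M by fact
  interpret LM: hwalk G H f h "L @ tl M"
    by (rule hwalk.intro[OF G H iso is_walk_glue[OF L M.L] f])
  have "walk_trans G H (L @ tl M) v = Comp (fund_groupoid H) (walk_trans G H M v) (walk_trans G H L v)"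
    if v: "v \<in> verts G" for v
  proof -
    have n: "adj G v (neighbour G v)"
      by (rule adj_neighbour[OF iso v])
    have "trace (neighbour G v) v (L @ tl M) = trace (neighbour G v) v L @ tl (trace (neighbour G v) v M)"
      using ends M.ends by (intro trace_glue) auto
    then show ?thesis
      unfolding walk_trans_eq[OF n] M.walk_trans_eq[OF n] LM.walk_trans_eq[OF n] fund_groupoid_quot
      using cod.Comp_cls[OF verts(1)[OF v] verts(2)[OF v] M.verts(2)[OF v] trace_in[OF n] M.trace_in[OF n]] by simp
  qed
  then show ?thesis
    by (intro extensionalityI[of _ "verts G"]) (simp_all add: vcomp_def walk_trans_def[of G H "L @ tl M"])
qed

lemma walk_trans_single:
  assumes "is_graph G" "is_graph H" "no_isolated G" "f \<in> gmor G H"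
  shows "walk_trans G H [f] = id_trans (fund_groupoid G) (fund_groupoid H) (induced_functor G f H)"
  by (intro extensionalityI[of _ "verts G"])
    (simp_all add: walk_trans_def id_trans_def induced_functor_def)

text \<open>At \<open>v\<close> the trace splits into the image under \<open>k\<close> of the trace
  of \<open>L\<close> and the trace of \<open>M\<close> at \<open>g v\<close>. The latter uses the
  neighbour \<open>g w\<close>, which is allowed by \<open>walk_trans_eq\<close> for
  \<open>M\<close>.\<close>

lemma (in hwalk) walk_trans_hcomp:
  assumes "hwalk H K k k' M"
  shows "walk_trans G K (map (compose (verts G) k) L @ tl (map (\<lambda>h. compose (verts G) h g) M)) =
    hcomp (fund_groupoid G) (fund_groupoid K) (induced_functor G g H) (induced_functor H k K)
      (walk_trans H K M) (walk_trans G H L)"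
proof -
  interpret M: hwalk H K k k' M by fact
  let ?c = "compose (verts G)"
  let ?P = "map (?c k) L" and ?Q = "map (\<lambda>h. ?c h g) M"
  interpret P: hwalk G K "?c k f" "?c k g" ?P
    by (rule hwalk.intro[OF G M.H iso is_walk_post[OF G L M.f] compose_gmor[OF G f M.f]])
  interpret Q: hwalk G K "?c k g" "?c k' g" ?Q
    by (rule hwalk.intro[OF G M.H iso is_walk_pre[OF G M.L g] compose_gmor[OF G g M.f]])
  interpret PQ: hwalk G K "?c k f" "?c k' g" "?P @ tl ?Q"
    by (rule hwalk.intro[OF G M.H iso is_walk_glue[OF P.L Q.L] P.f])
  have "walk_trans G K (?P @ tl ?Q) v =
      Comp (fund_groupoid K) (walk_trans H K M (g v)) (snd (induced_functor H k K) (walk_trans G H L v))"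
    if v: "v \<in> verts G" for v
  proof -
    let ?w = "neighbour G v"
    have n: "adj G v ?w" "?w \<in> verts G"
      using adj_neighbour[OF iso v] adj_verts[OF G] by auto
    have gn: "adj H (g v) (g ?w)"
      by (rule gmor_edge[OF g n(1)])
    have "trace ?w v ?P = map k (trace ?w v L)"
      by (rule map_trace) (use v n in \<open>simp add: compose_def\<close>)
    moreover have "trace ?w v ?Q = trace (g ?w) (g v) M"
      by (rule trace_map) (use v n in \<open>simp add: compose_def\<close>)
    moreover have "trace ?w v (?P @ tl ?Q) = trace ?w v ?P @ tl (trace ?w v ?Q)"
      using P.ends Q.ends by (intro trace_glue) auto
    ultimately have t: "trace ?w v (?P @ tl ?Q) = map k (trace ?w v L) @ tl (trace (g ?w) (g v) M)"
      by simp
    have "walk_trans G K (?P @ tl ?Q) v =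
        cls (walk_rel K) (k (f v)) (k' (g v)) (map k (trace ?w v L) @ tl (trace (g ?w) (g v) M))"
      unfolding PQ.walk_trans_eq[OF n(1)] t using v by (simp add: compose_def)
    also have "\<dots> = Comp (fund_groupoid K) (cls (walk_rel K) (k (g v)) (k' (g v)) (trace (g ?w) (g v) M))
        (cls (walk_rel K) (k (f v)) (k (g v)) (map k (trace ?w v L)))"
      unfolding fund_groupoid_quot
      by (rule M.cod.Comp_cls[OF M.verts(1)[OF verts(1)[OF v]] M.verts(1)[OF verts(2)[OF v]]
            M.verts(2)[OF verts(2)[OF v]] walks_map[OF H M.H M.f trace_in[OF n(1)]] M.trace_in[OF gn], symmetric])
    finally show ?thesis
      unfolding M.walk_trans_eq[OF gn] walk_trans_eq[OF n(1)]
        snd_induced_functor[OF H M.H M.f trace_in[OF n(1)]] .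
  qed
  then show ?thesis
    by (intro extensionalityI[of _ "verts G"])
      (simp_all add: hcomp_def walk_trans_def[of G K] induced_functor_def)
qed

section \<open>Functoriality on 1-cells\<close>

lemma induced_functor_id:
  assumes "is_graph G"
  shows "induced_functor G (\<lambda>v\<in>verts G. v) G = id_functor (fund_groupoid G)"
proof (rule functors_ext)
  interpret quotient_data "verts G" "walks G" "walk_rel G" "\<lambda>v. [v]" "\<lambda>_ \<alpha> \<beta>. \<alpha> @ tl \<beta>"
    by (rule quotient_fund_groupoid[OF assms])
  show "induced_functor G (\<lambda>v\<in>verts G. v) G \<in> functors (fund_groupoid G) (fund_groupoid G)"
    by (rule induced_functor_in[OF assms assms id_gmor[OF assms]])
  show "id_functor (fund_groupoid G) \<in> functors (fund_groupoid G) (fund_groupoid G)"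
    using id_functor_in category by (simp add: fund_groupoid_quot)
  fix a assume a: "a \<in> Arr (fund_groupoid G)"
  then obtain v w \<alpha> where vw: "v \<in> verts G" "w \<in> verts G" "\<alpha> \<in> walks G v w" "a = cls (walk_rel G) v w \<alpha>"
    unfolding fund_groupoid_quot by (rule ArrE)
  have "map (\<lambda>v\<in>verts G. v) \<alpha> = \<alpha>"
    using vw walks_verts[OF assms vw(1)] by (intro map_idI) (auto simp: walks_iff[OF assms])
  then show "snd (induced_functor G (\<lambda>v\<in>verts G. v) G) a = snd (id_functor (fund_groupoid G)) a"
    using snd_induced_functor[OF assms assms id_gmor[OF assms] vw(3)] a vw by (simp add: id_functor_def)
qed (simp add: induced_functor_def id_functor_def)

lemma induced_functor_compose:
  assumes "is_graph G" "is_graph H" "is_graph K" "f \<in> gmor G H" "g \<in> gmor H K"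
  shows "induced_functor G (compose (verts G) g f) K =
    comp_functor (fund_groupoid G) (induced_functor H g K) (induced_functor G f H)"
proof (rule functors_ext)
  interpret quotient_data "verts G" "walks G" "walk_rel G" "\<lambda>v. [v]" "\<lambda>_ \<alpha> \<beta>. \<alpha> @ tl \<beta>"
    by (rule quotient_fund_groupoid[OF assms(1)])
  note gf = compose_gmor[OF assms(1,4,5)]
  show "induced_functor G (compose (verts G) g f) K \<in> functors (fund_groupoid G) (fund_groupoid K)"
    by (rule induced_functor_in[OF assms(1,3) gf])
  show "comp_functor (fund_groupoid G) (induced_functor H g K) (induced_functor G f H)
      \<in> functors (fund_groupoid G) (fund_groupoid K)"
    by (rule comp_functor_in[OF induced_functor_in[OF assms(1,2,4)] induced_functor_in[OF assms(2,3,5)]])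
  fix v assume "v \<in> Ob (fund_groupoid G)"
  then show "fst (induced_functor G (compose (verts G) g f) K) v =
      fst (comp_functor (fund_groupoid G) (induced_functor H g K) (induced_functor G f H)) v"
    using gmor_verts[OF assms(4)] by (simp add: fst_comp_functor induced_functor_def compose_def)
next
  interpret quotient_data "verts G" "walks G" "walk_rel G" "\<lambda>v. [v]" "\<lambda>_ \<alpha> \<beta>. \<alpha> @ tl \<beta>"
    by (rule quotient_fund_groupoid[OF assms(1)])
  note gf = compose_gmor[OF assms(1,4,5)]
  fix a assume a: "a \<in> Arr (fund_groupoid G)"
  then obtain v w \<alpha> where vw: "v \<in> verts G" "w \<in> verts G" "\<alpha> \<in> walks G v w" "a = cls (walk_rel G) v w \<alpha>"
    unfolding fund_groupoid_quot by (rule ArrE)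
  have e: "map (compose (verts G) g f) \<alpha> = map g (map f \<alpha>)"
    using vw walks_verts[OF assms(1) vw(1)] by (auto simp: walks_iff[OF assms(1)] compose_def)
  have s: "snd (induced_functor H g K) (cls (walk_rel H) (f v) (f w) (map f \<alpha>)) =
      cls (walk_rel K) (g (f v)) (g (f w)) (map g (map f \<alpha>))"
    by (rule snd_induced_functor[OF assms(2,3,5) walks_map[OF assms(1,2,4) vw(3)]])
  show "snd (induced_functor G (compose (verts G) g f) K) a =
      snd (comp_functor (fund_groupoid G) (induced_functor H g K) (induced_functor G f H)) a"
    unfolding snd_comp_functor[OF a]
    unfolding vw(4) snd_induced_functor[OF assms(1,3) gf vw(3)]
      snd_induced_functor[OF assms(1,2,4) vw(3)] e s
    using vw(1,2) by (simp add: compose_def)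
qed

lemma fund_groupoid_map_simps [simp]: "src (fund_groupoid_map f) = fund_groupoid (src f)"
  "tgt (fund_groupoid_map f) = fund_groupoid (tgt f)"
  "body (fund_groupoid_map f) = induced_functor (src f) (body f) (tgt f)"
  by (simp_all add: fund_groupoid_map_def)

lemma fund_groupoid_map_in: "f \<in> Arr Gph1 \<Longrightarrow> fund_groupoid_map f \<in> Arr Grpd1"
  by (simp add: Arr_Gph1 Arr_Grpd1 groupoid_fund_groupoid induced_functor_in)

lemma fund_groupoid_map_comp:
  assumes "f \<in> Arr Gph1" "g \<in> Arr Gph1" "tgt f = src g"
  shows "fund_groupoid_map (g \<odot> f) = Comp Grpd1 (fund_groupoid_map g) (fund_groupoid_map f)"
  using assms induced_functor_compose[of "src f" "src g" "tgt g" "body f" "body g"]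
  by (simp add: fund_groupoid_map_def Arr_Gph1)

lemma cells1_functor_fund_groupoid: "cat_functor Gph1 Grpd1 fund_groupoid fund_groupoid_map"
proof -
  interpret Gph1: category Gph1 by (rule category_Gph1)
  interpret Grpd1: category Grpd1 by (rule category_Grpd1)
  show ?thesis
  proof
    fix G :: "'a graph"
    assume "G \<in> Ob Gph1"
    then show "fund_groupoid G \<in> Ob Grpd1" "fund_groupoid_map (Ide Gph1 G) = Ide Grpd1 (fund_groupoid G)"
      by (simp_all add: groupoid_fund_groupoid fund_groupoid_map_def induced_functor_id)
  next
    fix f g :: "'a graph_arrow"
    assume "f \<in> Arr Gph1" "g \<in> Arr Gph1" "Cod Gph1 f = Dom Gph1 g"
    then show "fund_groupoid_map (Comp Gph1 g f) = Comp Grpd1 (fund_groupoid_map g) (fund_groupoid_map f)"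
      using fund_groupoid_map_comp[of f g] by simp
  qed (simp_all add: fund_groupoid_map_in)
qed

section \<open>The action on 2-cells and the 2-functor\<close>

definition fund_groupoid_cell :: "'a htpy_arrow \<Rightarrow> ('a, 'a walk_arrow) nat_trans_arrow" where
  "fund_groupoid_cell = lift_cls (\<lambda>f g x. Arrow (fund_groupoid_map f)
     (walk_trans (src f) (tgt f) (frames (src f) x)) (fund_groupoid_map g))"

lemma cells2_hwalk:
  assumes "f \<in> Arr Gph1" "g \<in> Arr Gph1" "x \<in> cells2 f g"
  shows "hwalk (src f) (tgt f) (body f) (body g) (frames (src f) x)"
  using assms by unfold_locales (auto simp: cells2_iff Arr_Gph1)

lemma fund_groupoid_cell_cls:
  assumes fg: "f \<in> Arr Gph1" "g \<in> Arr Gph1" and x: "x \<in> cells2 f g"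
  shows "fund_groupoid_cell (cls cells2_rel f g x) = Arrow (fund_groupoid_map f)
    (walk_trans (src f) (tgt f) (frames (src f) x)) (fund_groupoid_map g)"
  unfolding fund_groupoid_cell_def
proof (rule V.lift_cls[OF fg x])
  fix y assume "(x, y) \<in> cells2_rel f g"
  then have "hrel (src f) (tgt f) (frames (src f) x) (frames (src f) y)"
    using fg cells2_par[OF x] by (simp add: cells2_rel_iff)
  then show "Arrow (fund_groupoid_map f) (walk_trans (src f) (tgt f) (frames (src f) x)) (fund_groupoid_map g) =
      Arrow (fund_groupoid_map f) (walk_trans (src f) (tgt f) (frames (src f) y)) (fund_groupoid_map g)"
    using hwalk.walk_trans_hrel[OF cells2_hwalk[OF fg x]] by simp
qed

lemma fund_groupoid_cell_in:
  assumes fg: "f \<in> Arr Gph1" "g \<in> Arr Gph1" and x: "x \<in> cells2 f g"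
  shows "fund_groupoid_cell (cls cells2_rel f g x) \<in> Arr Grpd_vert"
  using fg cells2_par[OF x] hwalk.walk_trans_in[OF cells2_hwalk[OF fg x]]
  by (simp add: fund_groupoid_cell_cls[OF fg x] Arr_Grpd_vert fund_groupoid_map_in)

lemma vert_functor_fund_groupoid: "cat_functor Gph_vert Grpd_vert fund_groupoid_map fund_groupoid_cell"
  unfolding Gph_vert_quot
proof (rule V.functorI)
  show "category Grpd_vert"
    by (rule category_Grpd_vert)
next
  fix f :: "'a graph_arrow"
  assume f: "f \<in> Arr Gph1"
  then show "fund_groupoid_map f \<in> Ob Grpd_vert"
    by (simp add: fund_groupoid_map_in)
  show "fund_groupoid_cell (cls cells2_rel f f (const_htpy (src f) (body f))) =
      Ide Grpd_vert (fund_groupoid_map f)"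
    using f walk_trans_single[of "src f" "tgt f" "body f"]
    by (simp add: fund_groupoid_cell_cls[OF f f cells2_const[OF f]] frames_const_Gph1 Arr_Gph1)
next
  fix f g :: "'a graph_arrow" and x
  assume fg: "f \<in> Arr Gph1" "g \<in> Arr Gph1" and x: "x \<in> cells2 f g"
  then show "fund_groupoid_cell (cls cells2_rel f g x) \<in> Arr Grpd_vert \<and>
      Dom Grpd_vert (fund_groupoid_cell (cls cells2_rel f g x)) = fund_groupoid_map f \<and>
      Cod Grpd_vert (fund_groupoid_cell (cls cells2_rel f g x)) = fund_groupoid_map g"
    by (simp add: fund_groupoid_cell_in) (simp add: fund_groupoid_cell_cls)
next
  fix f g h :: "'a graph_arrow" and x y
  assume fgh: "f \<in> Arr Gph1" "g \<in> Arr Gph1" "h \<in> Arr Gph1" and x: "x \<in> cells2 f g" and y: "y \<in> cells2 g h"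
  have "hwalk (src f) (tgt f) (body g) (body h) (frames (src f) y)"
    using cells2_hwalk[OF fgh(2,3) y] cells2_par[OF x] by simp
  from hwalk.walk_trans_glue[OF cells2_hwalk[OF fgh(1,2) x] this]
  show "fund_groupoid_cell (cls cells2_rel f h (hconcat (src f) x y)) =
      Comp Grpd_vert (fund_groupoid_cell (cls cells2_rel g h y)) (fund_groupoid_cell (cls cells2_rel f g x))"
    unfolding fund_groupoid_cell_cls[OF fgh(1,2) x] fund_groupoid_cell_cls[OF fgh(2,3) y]
      fund_groupoid_cell_cls[OF fgh(1,3) cells2_hconcat[OF fgh x y]]
    using cells2_par[OF x] by (simp add: frames_hconcat)
qed

lemma horz_functor_fund_groupoid: "cat_functor Gph_horz Grpd_horz fund_groupoid fund_groupoid_cell"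
proof (intro cat_functor.intro cat_functor_axioms.intro)
  fix \<alpha> :: "'a htpy_arrow"
  assume "\<alpha> \<in> Arr Gph_horz"
  then have "\<alpha> \<in> Arr Gph_vert"
    by simp
  then obtain f g x where fg: "f \<in> Arr Gph1" "g \<in> Arr Gph1" and x: "x \<in> cells2 f g" and \<alpha>: "\<alpha> = cls cells2_rel f g x"
    by (rule Arr_Gph_vertE)
  show "fund_groupoid_cell \<alpha> \<in> Arr Grpd_horz"
    unfolding \<alpha> Grpd_horz_simps by (rule fund_groupoid_cell_in[OF fg x])
  show "Dom Grpd_horz (fund_groupoid_cell \<alpha>) = fund_groupoid (Dom Gph_horz \<alpha>)"
    "Cod Grpd_horz (fund_groupoid_cell \<alpha>) = fund_groupoid (Cod Gph_horz \<alpha>)"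
    unfolding \<alpha> by (simp_all add: fund_groupoid_cell_cls[OF fg x])
next
  fix G :: "'a graph"
  assume "G \<in> Ob Gph_horz"
  then have G: "G \<in> Ob Gph1"
    by simp
  then have "Ide Gph1 G \<in> Ob Gph_vert"
    by (simp add: Arr_Gph1 id_gmor)
  \<comment> \<open>A horizontal identity is the vertical identity of an identity 1-cell, so this
    combines the functoriality already known on 2-cells and on 1-cells.\<close>
  from cat_functor.Ide_map[OF vert_functor_fund_groupoid this] cat_functor.Ide_map[OF cells1_functor_fund_groupoid G]
  show "fund_groupoid_cell (Ide Gph_horz G) = Ide Grpd_horz (fund_groupoid G)"
    unfolding Gph_horz_simps Grpd_horz_simps using G by (simp add: induced_functor_id)
  show "fund_groupoid G \<in> Ob Grpd_horz"
    using G by (simp add: groupoid_fund_groupoid)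
next
  fix \<alpha> \<beta> :: "'a htpy_arrow"
  assume "\<alpha> \<in> Arr Gph_horz" "\<beta> \<in> Arr Gph_horz" "Cod Gph_horz \<alpha> = Dom Gph_horz \<beta>"
  then have "\<alpha> \<in> Arr Gph_vert" "\<beta> \<in> Arr Gph_vert" "tgt (src \<alpha>) = src (src \<beta>)"
    by simp_all
  then obtain f f' g g' x y where h: "hcomposable f f' g g' x y"
    and eq: "\<alpha> = cls cells2_rel f f' x" "\<beta> = cls cells2_rel g g' y"
    by (rule hcomposableE)
  interpret hcomposable f f' g g' x y by (rule h)
  have "hwalk (src f) (src g) (body f) (body f') (frames (src f) x)"
    using cells2_hwalk[OF f x] par by simp
  from hwalk.walk_trans_hcomp[OF this cells2_hwalk[OF g y]]
  show "fund_groupoid_cell (Comp Gph_horz \<beta> \<alpha>) =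
      Comp Grpd_horz (fund_groupoid_cell \<beta>) (fund_groupoid_cell \<alpha>)"
    unfolding eq Comp_horz fund_groupoid_cell_cls[OF comp_in(1,2) hmul_in]
      fund_groupoid_cell_cls[OF f x] fund_groupoid_cell_cls[OF g y]
      fund_groupoid_map_comp[OF f(1) g(1) fg] fund_groupoid_map_comp[OF f(2) g(2) trans[OF par(2) par(3)[symmetric]]]
    using par frames_hmul' by simp
qed (rule category_Gph_horz category_Grpd_horz)+

lemma two_functor_fund_groupoid:
  "two_functor Gph Grpd fund_groupoid fund_groupoid_map fund_groupoid_cell"
  by (intro two_functor.intro two_functor_axioms.intro two_category_Gph two_category_Grpd)
    (simp_all add: Gph_def Grpd_def cells1_functor_fund_groupoid vert_functor_fund_groupoid
      horz_functor_fund_groupoid)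

section \<open>The functor on homotopy classes\<close>

definition fund_groupoid_class ::
  "('a graph, ('a \<Rightarrow> 'a) set) arrow \<Rightarrow>
    (('a, 'a walk_arrow) cat, (('a \<Rightarrow> 'a) \<times> ('a walk_arrow \<Rightarrow> 'a walk_arrow)) set) arrow" where
  "fund_groupoid_class = lift_cls (\<lambda>G H \<phi>.
     cls nat_iso_rel (fund_groupoid G) (fund_groupoid H) (induced_functor G \<phi> H))"

interpretation hF: quotient_data finite_graphs gmor htpc_rel "\<lambda>G. \<lambda>v\<in>verts G. v"
  "\<lambda>G f g. compose (verts G) g f"
  by (rule quotient_hFGph)

interpretation hG: quotient_data "{C. groupoid C}" functors nat_iso_rel id_functor
  "\<lambda>C F G. comp_functor C G F"
  by (rule quotient_hGrpd)

text \<open>Homotopic morphisms have naturally isomorphic induced functors: a connecting walk of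
  morphisms yields a natural transformation by \<open>walk_trans_in\<close>, and its components are
  invertible because they lie in a groupoid.\<close>

lemma fund_groupoid_class_cls:
  assumes GH: "G \<in> finite_graphs" "H \<in> finite_graphs" and \<phi>: "\<phi> \<in> gmor G H"
  shows "fund_groupoid_class (cls htpc_rel G H \<phi>) =
    cls nat_iso_rel (fund_groupoid G) (fund_groupoid H) (induced_functor G \<phi> H)"
  unfolding fund_groupoid_class_def
proof (rule hF.lift_cls[OF GH \<phi>])
  fix \<psi> assume r: "(\<phi>, \<psi>) \<in> htpc_rel G H"
  have graphs: "is_graph G" "is_graph H"
    using GH by auto
  obtain L where L: "is_walk (hadj G H) \<phi> \<psi> L" and \<psi>: "\<psi> \<in> gmor G H"
    using r by (auto simp: htpc_rel_iff[OF graphs])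
  have "hwalk G H \<phi> \<psi> L"
    by unfold_locales (use GH \<phi> L in auto)
  from hwalk.walk_trans_in[OF this] have "(induced_functor G \<phi> H, induced_functor G \<psi> H) \<in> nat_iso_rel (fund_groupoid G) (fund_groupoid H)"
    using induced_functor_in[OF graphs] \<phi> \<psi>
    by (auto simp: nat_iso_rel_iff[OF groupoid_fund_groupoid[OF graphs(2)]])
  then show "cls nat_iso_rel (fund_groupoid G) (fund_groupoid H) (induced_functor G \<phi> H) =
      cls nat_iso_rel (fund_groupoid G) (fund_groupoid H) (induced_functor G \<psi> H)"
    using graphs induced_functor_in[OF graphs \<phi>] by (intro hG.cls_eqI) (auto simp: groupoid_fund_groupoid)
qed

lemma functor_fund_groupoid_class: "cat_functor hFGph hGrpd fund_groupoid fund_groupoid_class"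
  unfolding hFGph_quot
proof (rule hF.functorI)
  show "category hGrpd"
    unfolding hGrpd_quot by (rule hG.category)
next
  fix G :: "'a graph"
  assume G: "G \<in> finite_graphs"
  then show "fund_groupoid G \<in> Ob hGrpd"
    by (simp add: hGrpd_quot groupoid_fund_groupoid)
  show "fund_groupoid_class (cls htpc_rel G G (\<lambda>v\<in>verts G. v)) = Ide hGrpd (fund_groupoid G)"
    using G by (simp add: fund_groupoid_class_cls id_gmor induced_functor_id hGrpd_quot)
next
  fix G H :: "'a graph" and \<phi>
  assume GH: "G \<in> finite_graphs" "H \<in> finite_graphs" and \<phi>: "\<phi> \<in> gmor G H"
  then have "cls nat_iso_rel (fund_groupoid G) (fund_groupoid H) (induced_functor G \<phi> H) \<in> Arr hGrpd"
    unfolding hGrpd_quot by (intro hG.cls_in) (auto simp: groupoid_fund_groupoid induced_functor_in)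
  then show "fund_groupoid_class (cls htpc_rel G H \<phi>) \<in> Arr hGrpd \<and>
      Dom hGrpd (fund_groupoid_class (cls htpc_rel G H \<phi>)) = fund_groupoid G \<and>
      Cod hGrpd (fund_groupoid_class (cls htpc_rel G H \<phi>)) = fund_groupoid H"
    unfolding fund_groupoid_class_cls[OF GH \<phi>] by (simp add: hGrpd_quot)
next
  fix G H K :: "'a graph" and \<phi> \<psi>
  assume GHK: "G \<in> finite_graphs" "H \<in> finite_graphs" "K \<in> finite_graphs"
    and \<phi>: "\<phi> \<in> gmor G H" and \<psi>: "\<psi> \<in> gmor H K"
  then have graphs: "is_graph G" "is_graph H" "is_graph K"
    by auto
  have "Comp hGrpd (cls nat_iso_rel (fund_groupoid H) (fund_groupoid K) (induced_functor H \<psi> K))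
      (cls nat_iso_rel (fund_groupoid G) (fund_groupoid H) (induced_functor G \<phi> H)) =
    cls nat_iso_rel (fund_groupoid G) (fund_groupoid K)
      (comp_functor (fund_groupoid G) (induced_functor H \<psi> K) (induced_functor G \<phi> H))"
    unfolding hGrpd_quot using graphs \<phi> \<psi>
    by (intro hG.Comp_cls) (auto simp: groupoid_fund_groupoid induced_functor_in)
  then show "fund_groupoid_class (cls htpc_rel G K (compose (verts G) \<psi> \<phi>)) =
      Comp hGrpd (fund_groupoid_class (cls htpc_rel H K \<psi>)) (fund_groupoid_class (cls htpc_rel G H \<phi>))"
    unfolding fund_groupoid_class_cls[OF GHK(1,2) \<phi>] fund_groupoid_class_cls[OF GHK(2,3) \<psi>]
      fund_groupoid_class_cls[OF GHK(1,3) compose_gmor[OF graphs(1) \<phi> \<psi>]]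
      induced_functor_compose[OF graphs \<phi> \<psi>] by simp
qed

theorem corollary4p8:
  shows "(\<exists>\<Pi>2. two_functor (Gph :: ('a graph, 'a graph_arrow, 'a htpy_arrow) two_cat) Grpd
                 fund_groupoid fund_groupoid_map \<Pi>2) \<and>
         (\<exists>\<Pi>h. cat_functor (hFGph :: ('a graph, ('a graph, ('a \<Rightarrow> 'a) set) arrow) cat) hGrpd
                 fund_groupoid \<Pi>h \<and>
               (\<forall>G \<in> Ob hFGph. \<forall>H \<in> Ob hFGph. \<forall>\<phi> \<in> gmor G H.
                  \<Pi>h (Arrow G (htpc_rel G H `` {\<phi>}) H) =
                  Arrow (fund_groupoid G)
                    (nat_iso_rel (fund_groupoid G) (fund_groupoid H) `` {induced_functor G \<phi> H})
                    (fund_groupoid H)))"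
proof (intro conjI exI ballI)
  show "two_functor Gph Grpd fund_groupoid fund_groupoid_map fund_groupoid_cell"
    by (rule two_functor_fund_groupoid)
  show "cat_functor hFGph hGrpd fund_groupoid fund_groupoid_class"
    by (rule functor_fund_groupoid_class)
  fix G H :: "'a graph" and \<phi>
  assume "G \<in> Ob hFGph" "H \<in> Ob hFGph" "\<phi> \<in> gmor G H"
  then show "fund_groupoid_class (Arrow G (htpc_rel G H `` {\<phi>}) H) =
      Arrow (fund_groupoid G)
        (nat_iso_rel (fund_groupoid G) (fund_groupoid H) `` {induced_functor G \<phi> H})
        (fund_groupoid H)"
    using fund_groupoid_class_cls[of G H \<phi>] by (simp add: cls_def hFGph_quot)
qed

end
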